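(* Let $K$ be a local field with finite residue field of characteristic $p$ and cardinality $q$, and let $e>0$ be an integer with $e\not\equiv0\pmod p$. The set $\mathcal T_{e,1}(K)$ of $K$-isomorphism classes of totally ramified (separable) extensions of $K$ of degree $e$ is in canonical bijection with the set $\mathcal R_e(K)$ of ramified lines in $K^\times/K^{\times e}$, a ramified line $D$ corresponding to the class of $K(\sqrt[e]{D})$. In particular, the cardinality of $\mathcal T_{e,1}(K)$ is $g=\gcd(q-1,e)$.
   Context: A local field is a field complete for a discrete valuation with finite residue field. Let $\bar w:K^\times/K^{\times e}\to\mathbf Z/e\mathbf Z$ be induced by the normalised valuation of $K$. A ramified line in $K^\times/K^{\times e}$ is a subgroup $D$ on which $\bar w$ restricts to an isomorphism $D\to\mathbf Z/e\mathbf Z$. It is generated by the image of a uniformiser $\pi$ of $K$, this image being the unique element of $D$ mapping to $1\in\mathbf Z/e\mathbf Z$, and $K(\sqrt[e]{D})$ denotes $K[T]/(T^e-\pi)$, which up to $K$-isomorphism does not depend on the choice of $\pi$. *)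

theory Defs
  imports "HOL-Algebra.Algebra"
begin

text \<open>HOL-Algebra has two identical constants called mult_of; this picks the one for which the group
  structure is developed.\<close>

abbreviation units_grp :: "('a, 'm) ring_scheme \<Rightarrow> 'a monoid" where
  "units_grp K \<equiv> Multiplicative_Group.mult_of K"

section \<open>Local fields\<close>

text \<open>A normalised discrete valuation is an integer-valued function on the nonzero elements; its
  value at zero is junk, and every definition below treats zero separately.\<close>

locale discrete_valuation = field K for K :: "('a, 'm) ring_scheme" (structure) +
  fixes v :: "'a \<Rightarrow> int"
  assumes v_epi: "v \<in> epi (units_grp K) integer_group"
    and v_add: "\<lbrakk>x \<in> carrier K - {\<zero>}; y \<in> carrier K - {\<zero>}; x \<oplus> y \<noteq> \<zero>\<rbrakk>
                  \<Longrightarrow> min (v x) (v y) \<le> v (x \<oplus> y)"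

definition val_ball :: "('a, 'm) ring_scheme \<Rightarrow> ('a \<Rightarrow> int) \<Rightarrow> int \<Rightarrow> 'a set" where
  "val_ball K v n = {x \<in> carrier K. x = \<zero>\<^bsub>K\<^esub> \<or> n \<le> v x}"

definition val_complete :: "('a, 'm) ring_scheme \<Rightarrow> ('a \<Rightarrow> int) \<Rightarrow> bool" where
  "val_complete K v \<longleftrightarrow>
     (\<forall>s :: nat \<Rightarrow> 'a.
        range s \<subseteq> carrier K \<and>
        (\<forall>N. \<exists>k. \<forall>m\<ge>k. \<forall>n\<ge>k. s m \<ominus>\<^bsub>K\<^esub> s n \<in> val_ball K v N) \<longrightarrow>
        (\<exists>l \<in> carrier K. \<forall>N. \<exists>k. \<forall>n\<ge>k. s n \<ominus>\<^bsub>K\<^esub> l \<in> val_ball K v N))"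

text \<open>The valuation ring and its maximal ideal are the balls of radius 0 and 1.\<close>

definition residue_field :: "('a, 'm) ring_scheme \<Rightarrow> ('a \<Rightarrow> int) \<Rightarrow> 'a set ring" where
  "residue_field K v = (K\<lparr>carrier := val_ball K v 0\<rparr>) Quot (val_ball K v 1)"

definition ring_characteristic :: "('a, 'm) ring_scheme \<Rightarrow> nat" where
  "ring_characteristic R = group.ord (add_monoid R) \<one>\<^bsub>R\<^esub>"

locale local_field = discrete_valuation +
  assumes complete: "val_complete K v"
    and finite_residue_field: "finite (carrier (residue_field K v))"

section \<open>Field extensions\<close>

text \<open>An extension of K is a field together with an embedding of K into it.\<close>

type_synonym ('a, 'b) extension = "'b ring \<times> ('a \<Rightarrow> 'b)"

definition field_extension :: "('a, 'm) ring_scheme \<Rightarrow> ('a, 'b) extension \<Rightarrow> bool" where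
  "field_extension K = (\<lambda>(L, i). field K \<and> field L \<and> i \<in> ring_hom K L)"

definition extension_iso ::
    "('a, 'm) ring_scheme \<Rightarrow> ('a, 'b) extension \<Rightarrow> ('a, 'c) extension \<Rightarrow> bool" where
  "extension_iso K = (\<lambda>(L, i) (M, j). \<exists>h \<in> ring_iso L M. \<forall>x \<in> carrier K. h (i x) = j x)"

definition has_degree :: "('a, 'm) ring_scheme \<Rightarrow> ('a, 'b) extension \<Rightarrow> nat \<Rightarrow> bool" where
  "has_degree K = (\<lambda>(L, i) n. ring.dimension L n (i ` carrier K) (carrier L))"

text \<open>Polynomials are coefficient lists with the leading coefficient first.\<close>

definition (in ring) poly_derivative :: "'a list \<Rightarrow> 'a list" where
  "poly_derivative f = normalize (map (\<lambda>k. add_pow R (degree f - k) (f ! k)) [0..<degree f])"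

definition (in ring) separable_poly :: "'a set \<Rightarrow> 'a list \<Rightarrow> bool" where
  "separable_poly k f \<longleftrightarrow>
     (\<exists>a \<in> carrier (k[X]). \<exists>b \<in> carrier (k[X]).
        (a \<otimes>\<^bsub>k[X]\<^esub> f) \<oplus>\<^bsub>k[X]\<^esub> (b \<otimes>\<^bsub>k[X]\<^esub> poly_derivative f) = \<one>\<^bsub>k[X]\<^esub>)"

definition (in ring) separable_over :: "'a set \<Rightarrow> 'a \<Rightarrow> bool" where
  "separable_over k x \<longleftrightarrow> (algebraic over k) x \<and> separable_poly k (Irr k x)"

definition separable_extension :: "('a, 'm) ring_scheme \<Rightarrow> ('a, 'b) extension \<Rightarrow> bool" where
  "separable_extension K =
     (\<lambda>(L, i). \<forall>x \<in> carrier L. ring.separable_over L (i ` carrier K) x)"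

text \<open>The extension has ramification index n if its normalised valuation restricts to n times
  the valuation of K.  For finite extensions of a complete field the prolongation exists and is
  unique, so the existential quantifier involves no choice there.\<close>

definition has_ramification_index ::
    "('a, 'm) ring_scheme \<Rightarrow> ('a \<Rightarrow> int) \<Rightarrow> ('a, 'b) extension \<Rightarrow> nat \<Rightarrow> bool" where
  "has_ramification_index K v = (\<lambda>(L, i) n.
     \<exists>w. discrete_valuation L w \<and> (\<forall>x \<in> carrier (units_grp K). w (i x) = int n * v x))"

definition totally_ramified ::
    "('a, 'm) ring_scheme \<Rightarrow> ('a \<Rightarrow> int) \<Rightarrow> nat \<Rightarrow> ('a, 'b) extension \<Rightarrow> bool" where
  "totally_ramified K v n E \<longleftrightarrow>
     field_extension K E \<and> has_degree K E n \<and> has_ramification_index K v E n"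

text \<open>Isomorphism classes are taken among extensions whose elements are sets of lists over K, as the
  quotients of K[T] are; every finite extension is isomorphic to one of these.  The representative E
  itself may have any carrier type.\<close>

definition extension_class ::
    "('a, 'm) ring_scheme \<Rightarrow> ('a, 'b) extension \<Rightarrow> ('a, 'a list set) extension set" where
  "extension_class K E = {F. field_extension K F \<and> extension_iso K E F}"

definition totally_ramified_classes ::
    "('a, 'm) ring_scheme \<Rightarrow> ('a \<Rightarrow> int) \<Rightarrow> nat \<Rightarrow> ('a, 'a list set) extension set set" where
  "totally_ramified_classes K v n =
     extension_class K ` {E :: ('a, 'a list set) extension.
                            totally_ramified K v n E \<and> separable_extension K E}"

section \<open>Ramified lines\<close>

definition powers :: "('a, 'm) ring_scheme \<Rightarrow> nat \<Rightarrow> 'a set" where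
  "powers K e = (\<lambda>x. x [^]\<^bsub>K\<^esub> e) ` carrier (units_grp K)"

definition power_classes :: "('a, 'm) ring_scheme \<Rightarrow> nat \<Rightarrow> 'a set monoid" where
  "power_classes K e = units_grp K Mod powers K e"

definition val_mod :: "('a \<Rightarrow> int) \<Rightarrow> nat \<Rightarrow> 'a set \<Rightarrow> int" where
  "val_mod v e C = the_elem ((\<lambda>x. v x mod int e) ` C)"

definition ramified_lines ::
    "('a, 'm) ring_scheme \<Rightarrow> ('a \<Rightarrow> int) \<Rightarrow> nat \<Rightarrow> 'a set set set" where
  "ramified_lines K v e =
     {D. subgroup D (power_classes K e) \<and>
         val_mod v e \<in> iso ((power_classes K e)\<lparr>carrier := D\<rparr>) (integer_mod_group e)}"

definition line_uniformisers ::
    "('a, 'm) ring_scheme \<Rightarrow> ('a \<Rightarrow> int) \<Rightarrow> nat \<Rightarrow> 'a set set \<Rightarrow> 'a set" where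
  "line_uniformisers K v e D =
     {\<pi> \<in> carrier (units_grp K). v \<pi> = 1 \<and> powers K e #>\<^bsub>units_grp K\<^esub> \<pi> \<in> D}"

text \<open>The K-algebra K[T]/(T^n - a).\<close>

definition (in ring) adjoin_root :: "nat \<Rightarrow> 'a \<Rightarrow> ('a, 'a list set) extension" where
  "adjoin_root n a =
     (let f = X [^]\<^bsub>poly_ring R\<^esub> n \<ominus>\<^bsub>poly_ring R\<^esub> poly_of_const a
      in (Rupt (carrier R) f, \<lambda>x. rupture_surj (carrier R) f (poly_of_const x)))"

definition adjoin_line ::
    "('a, 'm) ring_scheme \<Rightarrow> ('a \<Rightarrow> int) \<Rightarrow> nat \<Rightarrow> 'a set set \<Rightarrow> ('a, 'a list set) extension" where
  "adjoin_line K v e D = ring.adjoin_root K e (SOME \<pi>. \<pi> \<in> line_uniformisers K v e D)"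

end

theory Submission
  imports Defs
begin

text \<open>Let L be totally ramified of degree e with uniformiser t. The valuations of 1, t, ..., t^(e-1)
  are distinct modulo e, so these powers form a K-basis of L, the valuation of a linear combination
  is the least valuation of its terms, L is complete and has the same residue field as K. Hence
  t^e = a \<pi> u with \<pi> a uniformiser of K, a a unit of K and u a 1-unit of L. As e is prime to
  the residue characteristic, u has an e-th root in L, and dividing t by it gives an e-th root of the
  uniformiser a \<pi>. Two uniformisers of K with an e-th root in the same L differ, for the same
  reasons, by an e-th power of K. Conversely K[T]/(T^e - \<pi>) is shown to be a totally ramified field by
  writing down its valuation on the basis of powers of T. Ramified lines correspond to classes of
  uniformisers modulo e-th powers, and these form a torsor under the units modulo e-th powers, that is
  (again by the e-th roots of 1-units) under the cyclic group of the residue field modulo e-th powers.\<close>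

section \<open>Discrete valuations and roots of 1-units\<close>

text \<open>\<open>K[T]/(T^e - p)\<close> is not known to be a field when its valuation is built.
  The filtration by balls is therefore defined on a mere commutative ring, by conditions on
  coordinates. Its primality property rules out zero divisors, and finite dimension over K then
  supplies inverses, so that irreducibility of \<open>T^e - p\<close> is a consequence and not a
  starting point. For an abstract extension the argument runs in the opposite direction: a valuation
  is given, and coordinates are deduced from it. The bijection is obtained by indexing both sides by
  uniformisers of K. Sending p to the class of \<open>adjoin_root e p\<close> reaches every class,
  sending p to \<open>line e p\<close> reaches every line, and two uniformisers have the same image
  on either side exactly when they agree modulo e-th powers. The condition on the residue
  characteristic acts through one fact, that e times 1 has valuation 0. It passes from K to L
  because valuations are multiplied by the ramification index; it allows the division by e when
  roots are extracted, and that e times 1 is nonzero keeps derivatives of minimal polynomials from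
  vanishing.\<close>

context discrete_valuation
begin

lemma v_mult: "\<lbrakk>x \<in> carrier K - {\<zero>}; y \<in> carrier K - {\<zero>}\<rbrakk> \<Longrightarrow> v (x \<otimes> y) = v x + v y"
  using v_epi by (auto simp: epi_def hom_def)

lemma v_surj: "\<exists>x \<in> carrier K - {\<zero>}. v x = n"
proof -
  have "n \<in> v ` (carrier K - {\<zero>})"
    using v_epi by (auto simp: epi_def)
  then show ?thesis by auto
qed

lemma v_one [simp]: "v \<one> = 0"
  using v_mult[of \<one> \<one>] by simp

lemma nonzero_m_closed: "\<lbrakk>x \<in> carrier K - {\<zero>}; y \<in> carrier K - {\<zero>}\<rbrakk> \<Longrightarrow> x \<otimes> y \<in> carrier K - {\<zero>}"
  by (auto simp: integral_iff)

lemma nonzero_inv_closed: "x \<in> carrier K - {\<zero>} \<Longrightarrow> inv x \<in> carrier K - {\<zero>}"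
  using Units_inv_Units[of x] unfolding field_Units .

lemma nonzero_r_inv: "x \<in> carrier K - {\<zero>} \<Longrightarrow> x \<otimes> inv x = \<one>"
  using Units_r_inv[of x] unfolding field_Units .

lemma nonzero_l_inv: "x \<in> carrier K - {\<zero>} \<Longrightarrow> inv x \<otimes> x = \<one>"
  using Units_l_inv[of x] unfolding field_Units .

lemma v_inv: "x \<in> carrier K - {\<zero>} \<Longrightarrow> v (inv x) = - v x"
  using v_mult[of x "inv x"] nonzero_inv_closed[of x] nonzero_r_inv[of x] by simp

lemma nonzero_pow_closed: "x \<in> carrier K - {\<zero>} \<Longrightarrow> x [^] (n::nat) \<in> carrier K - {\<zero>}"
  by (induction n) (auto simp: integral_iff)

lemma v_pow: "x \<in> carrier K - {\<zero>} \<Longrightarrow> v (x [^] (n::nat)) = int n * v x"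
proof (induction n)
  case (Suc n)
  then show ?case
    using v_mult[OF nonzero_pow_closed[of x n], of x] by (simp add: algebra_simps)
qed simp

text \<open>The square of -1 is 1 and the value group has no torsion, so -1 has valuation 0.\<close>

lemma v_neg: assumes "x \<in> carrier K - {\<zero>}" shows "v (\<ominus> x) = v x"
proof -
  have m: "\<ominus> \<one> \<in> carrier K - {\<zero>}"
    using add.inv_eq_1_iff[of \<one>] by auto
  have "(\<ominus> \<one>) \<otimes> (\<ominus> \<one>) = \<one>" by algebra
  then have "2 * v (\<ominus> \<one>) = 0"
    using v_mult[OF m m] by simp
  moreover have "\<ominus> x = (\<ominus> \<one>) \<otimes> x" using assms by (simp add: l_minus)
  ultimately show ?thesis using v_mult[OF m assms] by simp
qed

abbreviation ball :: "int \<Rightarrow> 'a set" where "ball n \<equiv> val_ball K v n"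

lemma ball_closed: "x \<in> ball n \<Longrightarrow> x \<in> carrier K"
  by (simp add: val_ball_def)

lemma ball_iff: "x \<in> carrier K - {\<zero>} \<Longrightarrow> x \<in> ball n \<longleftrightarrow> n \<le> v x"
  by (auto simp: val_ball_def)

lemma ball_zero [simp]: "\<zero> \<in> ball n"
  by (simp add: val_ball_def)

lemma ball_one [simp]: "\<one> \<in> ball n \<longleftrightarrow> n \<le> 0"
  by (simp add: val_ball_def)

lemma ball_mono: "\<lbrakk>x \<in> ball n; m \<le> n\<rbrakk> \<Longrightarrow> x \<in> ball m"
  by (auto simp: val_ball_def)

lemma ball_add: "\<lbrakk>x \<in> ball n; y \<in> ball n\<rbrakk> \<Longrightarrow> x \<oplus> y \<in> ball n"
  using v_add[of x y] by (cases "x = \<zero>"; cases "y = \<zero>"; cases "x \<oplus> y = \<zero>") (auto simp: val_ball_def)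

lemma ball_neg: "x \<in> ball n \<Longrightarrow> \<ominus> x \<in> ball n"
  using v_neg[of x] by (auto simp: val_ball_def)

lemma ball_diff: "\<lbrakk>x \<in> ball n; y \<in> ball n\<rbrakk> \<Longrightarrow> x \<ominus> y \<in> ball n"
  by (simp add: a_minus_def ball_add ball_neg)

lemma ball_mult: "\<lbrakk>x \<in> ball m; y \<in> ball n\<rbrakk> \<Longrightarrow> x \<otimes> y \<in> ball (m + n)"
  using v_mult[of x y] by (auto simp: val_ball_def integral_iff)

lemma ball_mult0: "\<lbrakk>x \<in> ball 0; y \<in> ball n\<rbrakk> \<Longrightarrow> x \<otimes> y \<in> ball n"
  using ball_mult[of x 0 y n] by simp

lemma ball_pow: "x \<in> ball 0 \<Longrightarrow> x [^] (n::nat) \<in> ball 0"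
  using ball_mult[of _ 0 x 0] by (induction n) auto

lemma ball_all_imp_zero: assumes "\<And>n::nat. x \<in> ball (int n)" shows "x = \<zero>"
proof (rule ccontr)
  assume "x \<noteq> \<zero>"
  with assms[of "nat (v x + 1)"] show False by (auto simp: val_ball_def split: if_splits)
qed

lemma diff_swap: "\<lbrakk>x \<in> carrier K; y \<in> carrier K; x \<ominus> y \<in> ball n\<rbrakk> \<Longrightarrow> y \<ominus> x \<in> ball n"
proof -
  assume a: "x \<in> carrier K" "y \<in> carrier K" "x \<ominus> y \<in> ball n"
  have "y \<ominus> x = \<ominus> (x \<ominus> y)" using a(1,2) by algebra
  then show ?thesis using ball_neg[OF a(3)] by simp
qed

lemma diff_trans: "\<lbrakk>x \<in> carrier K; y \<in> carrier K; z \<in> carrier K; x \<ominus> y \<in> ball n; y \<ominus> z \<in> ball n\<rbrakk>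
   \<Longrightarrow> x \<ominus> z \<in> ball n"
proof -
  assume a: "x \<in> carrier K" "y \<in> carrier K" "z \<in> carrier K" "x \<ominus> y \<in> ball n" "y \<ominus> z \<in> ball n"
  have "x \<ominus> z = (x \<ominus> y) \<oplus> (y \<ominus> z)" using a(1-3) by algebra
  then show ?thesis using ball_add[OF a(4,5)] by simp
qed

text \<open>If \<open>v y\<close> exceeded \<open>v x\<close>, then x, as the sum of
  \<open>x - y\<close> and y, would lie in a smaller ball than its valuation allows. Both lemmas on
  sums of terms with distinct valuations rest on this.\<close>

lemma v_eq_of_close: 
  assumes x: "x \<in> carrier K - {\<zero>}" and y: "y \<in> carrier K" and d: "x \<ominus> y \<in> ball (v x + 1)"
  shows "y \<noteq> \<zero>" "v y = v x"
proof -
  have xc: "x \<in> carrier K" using x by simp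
  show ny: "y \<noteq> \<zero>"
  proof
    assume "y = \<zero>"
    then have "x \<in> ball (v x + 1)" using d x by (simp add: a_minus_def)
    then show False using ball_iff[OF x] by simp
  qed
  have "x \<in> ball (v x)" using ball_iff[OF x] by simp
  moreover have "x \<ominus> (x \<ominus> y) = y" using xc y by algebra
  moreover have "x \<ominus> y \<in> ball (v x)" using ball_mono[OF d] by simp
  ultimately have 1: "y \<in> ball (v x)" using ball_diff[of x "v x" "x \<ominus> y"] by metis
  have "\<not> v x + 1 \<le> v y"
  proof
    assume "v x + 1 \<le> v y"
    then have "y \<in> ball (v x + 1)" using ball_iff y ny by simp
    moreover have "(x \<ominus> y) \<oplus> y = x" using xc y by algebra
    ultimately have "x \<in> ball (v x + 1)" using ball_add[OF d, of y] by metis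
    then show False using ball_iff[OF x] by simp
  qed
  with 1 show "v y = v x" using ball_iff[of y] y ny by simp
qed

text \<open>The sum differs from its term of smaller valuation by the other term, so
  \<open>v_eq_of_close\<close> applies to that pair.\<close>

lemma v_add_distinct:
  assumes x: "x \<in> carrier K - {\<zero>}" and y: "y \<in> carrier K - {\<zero>}" and ne: "v x \<noteq> v y"
  shows "x \<oplus> y \<noteq> \<zero>" "v (x \<oplus> y) = min (v x) (v y)"
proof -
  have *: "x \<oplus> y \<noteq> \<zero> \<and> v (x \<oplus> y) = v x"
    if x: "x \<in> carrier K - {\<zero>}" and y: "y \<in> carrier K - {\<zero>}" and lt: "v x < v y" for x y
  proof -
    have xy: "x \<in> carrier K" "y \<in> carrier K" using x y by auto
    have "x \<ominus> (x \<oplus> y) = \<ominus> y" using xy by algebra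
    moreover have "y \<in> ball (v x + 1)" using ball_iff[OF y] lt by simp
    ultimately have "x \<ominus> (x \<oplus> y) \<in> ball (v x + 1)" using ball_neg by simp
    from v_eq_of_close[OF x _ this] show ?thesis using xy by simp
  qed
  consider "v x < v y" | "v y < v x" using ne by linarith
  then have "x \<oplus> y \<noteq> \<zero> \<and> v (x \<oplus> y) = min (v x) (v y)"
  proof cases
    case 1 then show ?thesis using *[OF x y] by simp
  next
    case 2
    have "y \<oplus> x = x \<oplus> y" using x y by (simp add: a_comm)
    then show ?thesis using *[OF y x 2] 2 by simp
  qed
  then show "x \<oplus> y \<noteq> \<zero>" "v (x \<oplus> y) = min (v x) (v y)" by auto
qed

text \<open>Terms of distinct valuations cannot cancel, so each is at least as small as the sum.
  This permits testing a linear combination term by term. The inequality is asked only of nonzero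
  terms because \<open>v\<close> is arbitrary at zero.\<close>

lemma ball_sum_parts:
  assumes x: "x \<in> carrier K" and y: "y \<in> carrier K"
    and ne: "\<lbrakk>x \<noteq> \<zero>; y \<noteq> \<zero>\<rbrakk> \<Longrightarrow> v x \<noteq> v y" and s: "x \<oplus> y \<in> ball n"
  shows "x \<in> ball n" "y \<in> ball n"
proof -
  have *: "x \<in> ball n" if x: "x \<in> carrier K" and y: "y \<in> carrier K"
    and ne: "\<lbrakk>x \<noteq> \<zero>; y \<noteq> \<zero>\<rbrakk> \<Longrightarrow> v x \<noteq> v y" and s: "x \<oplus> y \<in> ball n" for x y
  proof (cases "x = \<zero> \<or> y = \<zero>")
    case True then show ?thesis using s x y by auto
  next
    case False
    then have nx: "x \<in> carrier K - {\<zero>}" and ny: "y \<in> carrier K - {\<zero>}" using x y by auto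
    consider "v x < v y" | "v y < v x" using ne False by fastforce
    then show ?thesis
    proof cases
      case 1
      have "x \<ominus> (x \<oplus> y) = \<ominus> y" using x y by algebra
      moreover have "y \<in> ball (v x + 1)" using ball_iff[OF ny] 1 by simp
      ultimately have "x \<ominus> (x \<oplus> y) \<in> ball (v x + 1)" using ball_neg by simp
      from v_eq_of_close[OF nx _ this] show ?thesis using s x y ball_iff[OF nx] ball_iff[of "x \<oplus> y"] by auto
    next
      case 2
      have "y \<ominus> (x \<oplus> y) = \<ominus> x" using x y by algebra
      moreover have "x \<in> ball (v y + 1)" using ball_iff[OF nx] 2 by simp
      ultimately have "y \<ominus> (x \<oplus> y) \<in> ball (v y + 1)" using ball_neg by simp
      from v_eq_of_close[OF ny _ this] have "x \<oplus> y \<noteq> \<zero>" "v (x \<oplus> y) = v y" using x y by auto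
      then have "n \<le> v y" using s x y ball_iff[of "x \<oplus> y"] by auto
      then show ?thesis using 2 ball_iff[OF nx] by simp
    qed
  qed
  show "x \<in> ball n" by (rule *[OF x y ne s])
  show "y \<in> ball n" using *[OF y x] ne s x y by (metis add.m_comm)
qed

lemma add_pow_one_ball: "[(n::nat)] \<cdot> \<one> \<in> ball 0"
  by (induction n) (auto intro: ball_add)

text \<open>For 1-units a and b,
  \<open>a b - 1 = (a - 1)(b - 1) + (a - 1) + (b - 1)\<close>.\<close>

lemma one_unit_pow:
  assumes "y \<in> carrier K" "y \<ominus> \<one> \<in> ball 1"
  shows "y [^] (n::nat) \<ominus> \<one> \<in> ball 1"
proof (induction n)
  case 0 then show ?case by (simp add: a_minus_def r_neg)
next
  case (Suc n)
  have c: "y [^] n \<in> carrier K" using assms by simp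
  have "(y [^] n \<ominus> \<one>) \<otimes> (y \<ominus> \<one>) \<oplus> (y [^] n \<ominus> \<one>) \<oplus> (y \<ominus> \<one>) = y [^] n \<otimes> y \<ominus> \<one>"
    using c assms(1) by algebra
  moreover have "(y [^] n \<ominus> \<one>) \<otimes> (y \<ominus> \<one>) \<in> ball 1"
    using ball_mono[OF ball_mult[OF Suc assms(2)]] by simp
  ultimately show ?case using ball_add[OF ball_add[OF _ Suc] assms(2)] by (metis nat_pow_Suc)
qed

text \<open>The factor s is \<open>y^(n-1) + y^(n-2) z + ... + z^(n-1)\<close>. Each of its n terms
  is a 1-unit, so s is congruent to n modulo the maximal ideal. It plays the role of the derivative
  in the contraction estimate.\<close>

lemma pow_diff_factor:
  assumes "y \<in> carrier K" "y \<ominus> \<one> \<in> ball 1" "z \<in> carrier K" "z \<ominus> \<one> \<in> ball 1"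
  shows "\<exists>s \<in> carrier K. y [^] (n::nat) \<ominus> z [^] n = (y \<ominus> z) \<otimes> s \<and> s \<ominus> [n] \<cdot> \<one> \<in> ball 1"
proof (induction n)
  case 0
  show ?case using assms by (intro bexI[of _ \<zero>]) (auto simp: a_minus_def r_neg)
next
  case (Suc n)
  then obtain s where s: "s \<in> carrier K" "y [^] n \<ominus> z [^] n = (y \<ominus> z) \<otimes> s" "s \<ominus> [n] \<cdot> \<one> \<in> ball 1"
    by blast
  have c: "y [^] n \<in> carrier K" "z [^] n \<in> carrier K" "[n] \<cdot> \<one> \<in> carrier K" using assms by auto
  let ?s = "s \<otimes> y \<oplus> z [^] n"
  have "y [^] n \<otimes> y \<ominus> z [^] n \<otimes> z = (y [^] n \<ominus> z [^] n) \<otimes> y \<oplus> z [^] n \<otimes> (y \<ominus> z)"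
    using c assms(1,3) by algebra
  also have "\<dots> = (y \<ominus> z) \<otimes> ?s"
    unfolding s(2) using c assms(1,3) s(1) by algebra
  finally have 1: "y [^] Suc n \<ominus> z [^] Suc n = (y \<ominus> z) \<otimes> ?s" by simp
  have "(s \<ominus> [n] \<cdot> \<one>) \<oplus> [n] \<cdot> \<one> = s" using s(1) c by algebra
  then have "s \<in> ball 0" using ball_add[OF ball_mono[OF s(3), of 0] add_pow_one_ball[of n]] by simp
  then have "s \<otimes> (y \<ominus> \<one>) \<in> ball 1" using ball_mult0 assms(2) by simp
  then have "s \<otimes> (y \<ominus> \<one>) \<oplus> (s \<ominus> [n] \<cdot> \<one>) \<oplus> (z [^] n \<ominus> \<one>) \<in> ball 1"
    using s(3) one_unit_pow[OF assms(3,4), of n] by (intro ball_add)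
  moreover have "s \<otimes> (y \<ominus> \<one>) \<oplus> (s \<ominus> [n] \<cdot> \<one>) \<oplus> (z [^] n \<ominus> \<one>) = ?s \<ominus> ([n] \<cdot> \<one> \<oplus> \<one>)"
    using s(1) c assms(1,3) by algebra
  ultimately have "?s \<ominus> [Suc n] \<cdot> \<one> \<in> ball 1" by simp
  with 1 show ?case using s(1) c assms(1) by blast
qed

text \<open>The map y - (y^e - u)/e is a contraction of the group of 1-units, with the roots as fixed points.\<close>

lemma one_unit_root_exists:
  assumes compl: "val_complete K v" and e: "[e] \<cdot> \<one> \<noteq> \<zero>" "v ([(e::nat)] \<cdot> \<one>) = 0"
    and u: "u \<in> carrier K" "u \<ominus> \<one> \<in> ball 1"
  shows "\<exists>y \<in> carrier K - {\<zero>}. y [^] e = u"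
proof -
  define E where "E = [e] \<cdot> \<one>"
  have E: "E \<in> carrier K - {\<zero>}" using e by (simp add: E_def)
  have iE: "inv E \<in> carrier K - {\<zero>}" using nonzero_inv_closed[OF E] .
  have iE0: "inv E \<in> ball 0" using ball_iff[OF iE] v_inv[OF E] e(2) by (simp add: E_def)
  define f where "f y = y \<ominus> inv E \<otimes> (y [^] e \<ominus> u)" for y
  define U where "U = {y \<in> carrier K. y \<ominus> \<one> \<in> ball 1}"
  have fc: "f y \<in> carrier K" if "y \<in> carrier K" for y
    using that iE u by (simp add: f_def)
  have fU: "f y \<in> U" if "y \<in> U" for y
  proof -
    have y: "y \<in> carrier K" "y \<ominus> \<one> \<in> ball 1" using that by (auto simp: U_def)
    have c: "y [^] e \<in> carrier K" "inv E \<in> carrier K" using y iE by auto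
    have "(y [^] e \<ominus> \<one>) \<ominus> (u \<ominus> \<one>) \<in> ball 1"
      using ball_diff[OF one_unit_pow[OF y, of e] u(2)] .
    moreover have "(y [^] e \<ominus> \<one>) \<ominus> (u \<ominus> \<one>) = y [^] e \<ominus> u" using c u by algebra
    ultimately have "inv E \<otimes> (y [^] e \<ominus> u) \<in> ball 1" using ball_mult0[OF iE0] by simp
    then have "(y \<ominus> \<one>) \<ominus> inv E \<otimes> (y [^] e \<ominus> u) \<in> ball 1" using ball_diff[OF y(2)] by simp
    moreover have "(y \<ominus> \<one>) \<ominus> inv E \<otimes> (y [^] e \<ominus> u) = f y \<ominus> \<one>"
      unfolding f_def using c u y by algebra
    ultimately show ?thesis using fc y by (simp add: U_def)
  qed
  \<comment> \<open>With s from \<open>pow_diff_factor\<close>, the difference of the images is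
    \<open>-(y - z)(s - E)/E\<close>. The factor \<open>s - E\<close> contributes the extra unit of
    valuation, and dividing by E costs nothing.\<close>
  have contr: "f y \<ominus> f z \<in> ball (n + 1)" if "y \<in> U" "z \<in> U" "y \<ominus> z \<in> ball n" for y z n
  proof -
    have yz: "y \<in> carrier K" "z \<in> carrier K" using that by (auto simp: U_def)
    have "\<exists>s \<in> carrier K. y [^] e \<ominus> z [^] e = (y \<ominus> z) \<otimes> s \<and> s \<ominus> E \<in> ball 1"
      unfolding E_def using that by (intro pow_diff_factor) (auto simp: U_def)
    then obtain s where s: "s \<in> carrier K" "y [^] e \<ominus> z [^] e = (y \<ominus> z) \<otimes> s" "s \<ominus> E \<in> ball 1"
      by (elim bexE conjE)
    have c: "y [^] e \<in> carrier K" "z [^] e \<in> carrier K" "inv E \<in> carrier K" "E \<in> carrier K" using yz iE E by auto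
    have "f y \<ominus> f z = (y \<ominus> z) \<ominus> inv E \<otimes> (y [^] e \<ominus> z [^] e)"
      unfolding f_def using c yz u by algebra
    also have "\<dots> = (inv E \<otimes> E) \<otimes> (y \<ominus> z) \<ominus> inv E \<otimes> ((y \<ominus> z) \<otimes> s)"
      unfolding s(2) nonzero_l_inv[OF E] using yz by simp
    also have "\<dots> = \<ominus> (inv E \<otimes> ((y \<ominus> z) \<otimes> (s \<ominus> E)))" using c yz s(1) by algebra
    finally show ?thesis
      using ball_neg[OF ball_mult0[OF iE0 ball_mult[OF that(3) s(3)]]] by simp
  qed
  define y where "y n = (f ^^ n) \<one>" for n
  have yU: "y n \<in> U" for n
    by (induction n) (simp_all add: y_def fU, simp add: U_def a_minus_def r_neg)
  have ySuc: "y (Suc n) = f (y n)" for n by (simp add: y_def)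
  have yc: "y n \<in> carrier K" for n using yU by (simp add: U_def)
  have step: "y (Suc n) \<ominus> y n \<in> ball (int n + 1)" for n
  proof (induction n)
    case 0
    have "y 0 = \<one>" by (simp add: y_def)
    then show ?case using yU[of 1] by (simp add: U_def)
  next
    case (Suc n)
    show ?case using contr[OF yU[of "Suc n"] yU[of n] Suc] by (simp add: ySuc add.commute)
  qed
  \<comment> \<open>By the ultrametric inequality the distance over k steps is governed by the
    largest single step; no series has to be summed.\<close>
  have mono: "y (n + k) \<ominus> y n \<in> ball (int n + 1)" for n k
  proof (induction k)
    case 0 then show ?case using yc[of n] by (simp add: a_minus_def r_neg)
  next
    case (Suc k)
    show ?case
      using diff_trans[OF yc yc yc ball_mono[OF step[of "n + k"]] Suc] by simp
  qed
  have "\<exists>k. \<forall>m\<ge>k. \<forall>n\<ge>k. y m \<ominus> y n \<in> ball N" for N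
  proof (intro exI allI impI)
    fix m n assume "nat N \<le> m" "nat N \<le> n"
    then have "y m \<ominus> y (nat N) \<in> ball (int (nat N) + 1)" "y n \<ominus> y (nat N) \<in> ball (int (nat N) + 1)"
      using mono[of "nat N" "m - nat N"] mono[of "nat N" "n - nat N"] by auto
    then have "y m \<ominus> y n \<in> ball (int (nat N) + 1)"
      using diff_trans[OF yc yc yc _ diff_swap[OF yc yc]] by blast
    then show "y m \<ominus> y n \<in> ball N" using ball_mono by fastforce
  qed
  then obtain l where l: "l \<in> carrier K" "\<And>N. \<exists>k. \<forall>n\<ge>k. y n \<ominus> l \<in> ball N"
    using compl[unfolded val_complete_def, rule_format, of y] yc by blast
  have lU: "l \<in> U"
  proof -
    obtain k where "y k \<ominus> l \<in> ball 1" using l(2)[of 1] by blast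
    then have "l \<ominus> y k \<in> ball 1" using diff_swap l(1) yc by blast
    then have "l \<ominus> \<one> \<in> ball 1" using diff_trans[OF l(1) yc[of k] one_closed] yU[of k] by (simp add: U_def)
    then show ?thesis using l(1) by (simp add: U_def)
  qed
  \<comment> \<open>Both \<open>f l\<close> and l are limits of the sequence: the contraction
    estimate also serves as continuity of f.\<close>
  have "f l \<ominus> l \<in> ball (int N)" for N
  proof -
    obtain k where k: "\<forall>n\<ge>k. y n \<ominus> l \<in> ball (int N)" using l(2) by blast
    have "f (y k) \<ominus> f l \<in> ball (int N)"
      using ball_mono[OF contr[OF yU lU, of k "int N"]] k by simp
    then have 1: "f l \<ominus> y (Suc k) \<in> ball (int N)"
      using diff_swap[OF yc[of "Suc k"] fc[OF l(1)]] by (simp add: ySuc)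
    have "y (Suc k) \<ominus> l \<in> ball (int N)" using k by (meson le_SucI order_refl)
    then show ?thesis using diff_trans[OF fc[OF l(1)] yc l(1) 1] by blast
  qed
  then have "f l \<ominus> l = \<zero>" by (rule ball_all_imp_zero)
  moreover have c: "l [^] e \<in> carrier K" "inv E \<in> carrier K" using l iE by auto
  have "f l \<ominus> l = \<ominus> (inv E \<otimes> (l [^] e \<ominus> u))" unfolding f_def using c l(1) u by algebra
  ultimately have "inv E \<otimes> (l [^] e \<ominus> u) = \<zero>" using c u by (metis a_inv_closed m_closed minus_closed minus_minus minus_zero)
  then have "l [^] e \<ominus> u = \<zero>" using iE c u by (simp add: integral_iff)
  then have "l [^] e = u" using c u by simp
  moreover have "l \<noteq> \<zero>"
  proof
    assume "l = \<zero>"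
    then have "\<one> \<in> ball 1" using lU ball_neg[of "\<ominus> \<one>" 1] by (simp add: U_def a_minus_def)
    then show False by simp
  qed
  ultimately show ?thesis using l(1) by blast
qed

end

section \<open>Bases of powers\<close>

text \<open>L is only a commutative ring because the locale is also applied to
  \<open>K[T]/(T^e - p)\<close> before this is known to be a field, and to the product ring that
  carries the graph of an isomorphism.\<close>

locale embedded_field = K: field K + cring L for K :: "('a, 'm) ring_scheme" and L :: "('b, 'n) ring_scheme" (structure) +
  fixes i :: "'a \<Rightarrow> 'b"
  assumes i_hom: "i \<in> ring_hom K L"
begin

sublocale emb: ring_hom_cring K L i
  by unfold_locales (rule i_hom)

text \<open>The coefficient of t^j ranges over W j. Constant W gives K-linear spans; letting W j depend on j
  gives the balls of a valuation in which t is a uniformiser.\<close>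

primrec tspan :: "'b \<Rightarrow> (nat \<Rightarrow> 'a set) \<Rightarrow> nat \<Rightarrow> 'b set" where
  "tspan t W 0 = {\<zero>}"
| "tspan t W (Suc n) = {i a \<otimes> t [^] n \<oplus> r | a r. a \<in> W n \<and> r \<in> tspan t W n}"

text \<open>Only additive closure is demanded. The effect of a multiplication is stated in each
  lemma as an inclusion from one family of coefficient groups into another, since multiplication
  changes the radius of a ball.\<close>

definition coeff_groups :: "(nat \<Rightarrow> 'a set) \<Rightarrow> bool" where
  "coeff_groups W \<longleftrightarrow> (\<forall>n. W n \<subseteq> carrier K \<and> \<zero>\<^bsub>K\<^esub> \<in> W n \<and>
     (\<forall>a \<in> W n. \<ominus>\<^bsub>K\<^esub> a \<in> W n \<and> (\<forall>b \<in> W n. a \<oplus>\<^bsub>K\<^esub> b \<in> W n)))"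

abbreviation Kspan :: "'b \<Rightarrow> nat \<Rightarrow> 'b set" where
  "Kspan t \<equiv> tspan t (\<lambda>_. carrier K)"

lemma coeff_groups_all [simp]: "coeff_groups (\<lambda>_. carrier K)"
  by (simp add: coeff_groups_def)

lemma coeff_groupsD:
  assumes "coeff_groups W"
  shows "a \<in> W n \<Longrightarrow> a \<in> carrier K" "\<zero>\<^bsub>K\<^esub> \<in> W n" "a \<in> W n \<Longrightarrow> \<ominus>\<^bsub>K\<^esub> a \<in> W n"
    "a \<in> W n \<Longrightarrow> b \<in> W n \<Longrightarrow> a \<oplus>\<^bsub>K\<^esub> b \<in> W n"
  using assms by (auto simp: coeff_groups_def)

lemma tspan_SucI: "\<lbrakk>a \<in> W n; r \<in> tspan t W n\<rbrakk> \<Longrightarrow> i a \<otimes> t [^] n \<oplus> r \<in> tspan t W (Suc n)"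
  by auto

lemma tspan_SucE:
  assumes "x \<in> tspan t W (Suc n)"
  obtains a r where "a \<in> W n" "r \<in> tspan t W n" "x = i a \<otimes> t [^] n \<oplus> r"
  using assms by auto

declare tspan.simps(2) [simp del]

lemma tspan_closed: "\<lbrakk>coeff_groups W; t \<in> carrier L; x \<in> tspan t W n\<rbrakk> \<Longrightarrow> x \<in> carrier L"
proof (induction n arbitrary: x)
  case (Suc n)
  from Suc.prems(3) show ?case
    by (rule tspan_SucE) (use Suc in \<open>auto dest: coeff_groupsD\<close>)
qed simp

lemma tspan_zero: assumes "coeff_groups W" "t \<in> carrier L" shows "\<zero> \<in> tspan t W n"
proof (induction n)
  case (Suc n)
  show ?case
    using tspan_SucI[where W=W, OF coeff_groupsD(2)[OF assms(1)] Suc] assms(2) by simp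
qed simp

lemma tspan_add:
  assumes W: "coeff_groups W" and t: "t \<in> carrier L"
  shows "\<lbrakk>x \<in> tspan t W n; y \<in> tspan t W n\<rbrakk> \<Longrightarrow> x \<oplus> y \<in> tspan t W n"
proof (induction n arbitrary: x y)
  case (Suc n)
  obtain a r where x: "a \<in> W n" "r \<in> tspan t W n" "x = i a \<otimes> t [^] n \<oplus> r"
    using Suc.prems(1) by (rule tspan_SucE)
  obtain b s where y: "b \<in> W n" "s \<in> tspan t W n" "y = i b \<otimes> t [^] n \<oplus> s"
    using Suc.prems(2) by (rule tspan_SucE)
  have c: "i a \<in> carrier L" "i b \<in> carrier L" "t [^] n \<in> carrier L" "r \<in> carrier L" "s \<in> carrier L"
    using x y t tspan_closed[OF W t] coeff_groupsD(1)[OF W] by auto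
  have "x \<oplus> y = (i a \<oplus> i b) \<otimes> t [^] n \<oplus> (r \<oplus> s)" unfolding x(3) y(3) using c by algebra
  also have "\<dots> = i (a \<oplus>\<^bsub>K\<^esub> b) \<otimes> t [^] n \<oplus> (r \<oplus> s)"
    using coeff_groupsD(1)[OF W] x y by simp
  finally show ?case using tspan_SucI[where W=W, OF coeff_groupsD(4)[OF W x(1) y(1)] Suc.IH[OF x(2) y(2)]] by simp
qed simp

lemma tspan_neg:
  assumes W: "coeff_groups W" and t: "t \<in> carrier L"
  shows "x \<in> tspan t W n \<Longrightarrow> \<ominus> x \<in> tspan t W n"
proof (induction n arbitrary: x)
  case (Suc n)
  obtain a r where x: "a \<in> W n" "r \<in> tspan t W n" "x = i a \<otimes> t [^] n \<oplus> r"
    using Suc.prems by (rule tspan_SucE)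
  have c: "i a \<in> carrier L" "t [^] n \<in> carrier L" "r \<in> carrier L"
    using x t tspan_closed[OF W t] coeff_groupsD(1)[OF W] by auto
  have "\<ominus> x = (\<ominus> i a) \<otimes> t [^] n \<oplus> (\<ominus> r)" unfolding x(3) using c by algebra
  also have "\<dots> = i (\<ominus>\<^bsub>K\<^esub> a) \<otimes> t [^] n \<oplus> (\<ominus> r)"
    using coeff_groupsD(1)[OF W] x by simp
  finally show ?case using tspan_SucI[where W=W, OF coeff_groupsD(3)[OF W x(1)] Suc.IH[OF x(2)]] by simp
qed simp

lemma tspan_diff:
  assumes "coeff_groups W" "t \<in> carrier L" "x \<in> tspan t W n" "y \<in> tspan t W n"
  shows "x \<ominus> y \<in> tspan t W n"
  using assms by (simp add: a_minus_def tspan_add tspan_neg)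

lemma tspan_mono: "(\<And>j. j < n \<Longrightarrow> W j \<subseteq> W' j) \<Longrightarrow> tspan t W n \<subseteq> tspan t W' n"
proof (induction n)
  case (Suc n)
  then have "tspan t W n \<subseteq> tspan t W' n" "W n \<subseteq> W' n" by auto
  then show ?case by (auto elim!: tspan_SucE intro!: tspan_SucI)
qed simp

lemma tspan_Suc_incl:
  assumes W: "coeff_groups W" and t: "t \<in> carrier L" and x: "x \<in> tspan t W n"
  shows "x \<in> tspan t W (Suc n)"
  using tspan_SucI[where W=W, OF coeff_groupsD(2)[OF W] x] t tspan_closed[OF W t x] by simp

lemma tspan_incl:
  assumes W: "coeff_groups W" and t: "t \<in> carrier L" and x: "x \<in> tspan t W n" and "n \<le> m"
  shows "x \<in> tspan t W m"
  using \<open>n \<le> m\<close> by (induction m rule: dec_induct) (auto simp: x tspan_Suc_incl[OF W t])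

lemma tspan_const:
  assumes W: "coeff_groups W" and t: "t \<in> carrier L" and a: "a \<in> W 0" and n: "0 < n"
  shows "i a \<in> tspan t W n"
proof -
  have "i a \<in> tspan t W (Suc 0)"
    using tspan_SucI[where W=W, OF a, of \<zero> t] coeff_groupsD(1)[OF W a] t by simp
  then show ?thesis using tspan_incl[OF W t, of "i a" "Suc 0"] n by simp
qed

lemma tspan_smult:
  assumes W: "coeff_groups W" and t: "t \<in> carrier L" and c: "c \<in> carrier K"
    and m: "\<And>j a. a \<in> W j \<Longrightarrow> c \<otimes>\<^bsub>K\<^esub> a \<in> W' j"
  shows "x \<in> tspan t W n \<Longrightarrow> i c \<otimes> x \<in> tspan t W' n"
proof (induction n arbitrary: x)
  case (Suc n)
  obtain a r where x: "a \<in> W n" "r \<in> tspan t W n" "x = i a \<otimes> t [^] n \<oplus> r"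
    using Suc.prems by (rule tspan_SucE)
  have cc: "i c \<in> carrier L" "i a \<in> carrier L" "t [^] n \<in> carrier L" "r \<in> carrier L"
    using x t c tspan_closed[OF W t] coeff_groupsD(1)[OF W] by auto
  have "i c \<otimes> x = (i c \<otimes> i a) \<otimes> t [^] n \<oplus> i c \<otimes> r" unfolding x(3) using cc by algebra
  also have "\<dots> = i (c \<otimes>\<^bsub>K\<^esub> a) \<otimes> t [^] n \<oplus> i c \<otimes> r"
    using coeff_groupsD(1)[OF W] x c by simp
  finally show ?case using tspan_SucI[where W=W', OF m[OF x(1)] Suc.IH[OF x(2)]] by simp
qed (use c in simp)

lemma tspan_shift:
  assumes W: "coeff_groups W" "coeff_groups W'" and t: "t \<in> carrier L"
    and m: "\<And>j. W j \<subseteq> W' (Suc j)"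
  shows "x \<in> tspan t W n \<Longrightarrow> t \<otimes> x \<in> tspan t W' (Suc n)"
proof (induction n arbitrary: x)
  case 0
  then show ?case using tspan_zero[OF W(2) t, of "Suc 0"] t by simp
next
  case (Suc n)
  obtain a r where x: "a \<in> W n" "r \<in> tspan t W n" "x = i a \<otimes> t [^] n \<oplus> r"
    using Suc.prems by (rule tspan_SucE)
  have cc: "i a \<in> carrier L" "t [^] n \<in> carrier L" "r \<in> carrier L"
    using x t tspan_closed[OF W(1) t] coeff_groupsD(1)[OF W(1)] by auto
  have "t \<otimes> x = i a \<otimes> (t [^] n \<otimes> t) \<oplus> t \<otimes> r" unfolding x(3) using cc t by algebra
  also have "\<dots> = i a \<otimes> t [^] (Suc n) \<oplus> t \<otimes> r" by simp
  finally show ?case using tspan_SucI[where W=W' and a=a, OF _ Suc.IH[OF x(2)]] m x(1) by auto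
qed

text \<open>Multiplication by t moves every coefficient up one place, except that the top one
  returns to place 0 multiplied by p, because \<open>t^e\<close> is the image of p. Assumptions
  \<open>m\<close> and \<open>c\<close> control these two movements.\<close>

lemma tspan_shift_cyclic:
  assumes W: "coeff_groups W" "coeff_groups W'" and t: "t \<in> carrier L"
    and m: "\<And>j. W j \<subseteq> W' (Suc j)" and e: "0 < e"
    and p: "p \<in> carrier K" "t [^] e = i p" and c: "\<And>a. a \<in> W (e - 1) \<Longrightarrow> a \<otimes>\<^bsub>K\<^esub> p \<in> W' 0"
    and x: "x \<in> tspan t W e"
  shows "t \<otimes> x \<in> tspan t W' e"
proof -
  obtain n where n: "e = Suc n" using e by (cases e) auto
  obtain a r where x: "a \<in> W n" "r \<in> tspan t W n" "x = i a \<otimes> t [^] n \<oplus> r"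
    using x unfolding n by (rule tspan_SucE)
  have cc: "i a \<in> carrier L" "t [^] n \<in> carrier L" "r \<in> carrier L"
    using x t tspan_closed[OF W(1) t] coeff_groupsD(1)[OF W(1)] by auto
  have "t \<otimes> x = i a \<otimes> (t [^] n \<otimes> t) \<oplus> t \<otimes> r" unfolding x(3) using cc t by algebra
  also have "\<dots> = i a \<otimes> i p \<oplus> t \<otimes> r" using p(2) n by simp
  also have "\<dots> = i (a \<otimes>\<^bsub>K\<^esub> p) \<oplus> t \<otimes> r"
    using p(1) coeff_groupsD(1)[OF W(1) x(1)] by simp
  finally have "t \<otimes> x = i (a \<otimes>\<^bsub>K\<^esub> p) \<oplus> t \<otimes> r" .
  moreover have "t \<otimes> r \<in> tspan t W' e" unfolding n by (rule tspan_shift[OF W t m x(2)])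
  moreover have "i (a \<otimes>\<^bsub>K\<^esub> p) \<in> tspan t W' e" using c x(1) n tspan_const[OF W(2) t _ e] by simp
  ultimately show ?thesis using tspan_add[OF W(2) t] by simp
qed

text \<open>By distributivity a product need only be checked on monomials of the first factor. The
  target S is arbitrary so that the lemma serves both the full span and the balls.\<close>

lemma tspan_mult_into:
  assumes W: "coeff_groups W" and t: "t \<in> carrier L" and y: "y \<in> carrier L"
    and S: "\<zero> \<in> S" "\<And>u w. \<lbrakk>u \<in> S; w \<in> S\<rbrakk> \<Longrightarrow> u \<oplus> w \<in> S"
    and m: "\<And>j a. \<lbrakk>j < n; a \<in> W j\<rbrakk> \<Longrightarrow> i a \<otimes> (t [^] j \<otimes> y) \<in> S"
  shows "x \<in> tspan t W n \<Longrightarrow> x \<otimes> y \<in> S"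
  using m
proof (induction n arbitrary: x)
  case 0 then show ?case using y S by simp
next
  case (Suc n)
  obtain a r where x: "a \<in> W n" "r \<in> tspan t W n" "x = i a \<otimes> t [^] n \<oplus> r"
    using Suc.prems(1) by (rule tspan_SucE)
  have cc: "i a \<in> carrier L" "t [^] n \<in> carrier L" "r \<in> carrier L"
    using x t tspan_closed[OF W(1) t] coeff_groupsD(1)[OF W(1)] by auto
  have "x \<otimes> y = i a \<otimes> (t [^] n \<otimes> y) \<oplus> r \<otimes> y" unfolding x(3) using cc y by algebra
  moreover have "r \<otimes> y \<in> S" using Suc.IH[OF x(2)] Suc.prems(2) by simp
  ultimately show ?case using S(2) Suc.prems(2)[of n a] x(1) by simp
qed

lemma Kspan_pow_mult:
  assumes t: "t \<in> carrier L" and e: "0 < e" and p: "p \<in> carrier K" "t [^] e = i p"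
    and y: "y \<in> Kspan t e"
  shows "t [^] (j::nat) \<otimes> y \<in> Kspan t e"
proof (induction j)
  case 0 then show ?case using y tspan_closed[OF _ t y] by simp
next
  case (Suc j)
  have "t \<otimes> (t [^] j \<otimes> y) \<in> Kspan t e"
    by (rule tspan_shift_cyclic[OF _ _ t _ e p _ Suc]) (use p in auto)
  moreover have "t \<otimes> (t [^] j \<otimes> y) = t [^] Suc j \<otimes> y"
    using t tspan_closed[OF _ t y] by (simp add: m_ac)
  ultimately show ?case by simp
qed

lemma Kspan_mult:
  assumes t: "t \<in> carrier L" and e: "0 < e" and p: "p \<in> carrier K" "t [^] e = i p"
    and x: "x \<in> Kspan t e" and y: "y \<in> Kspan t e"
  shows "x \<otimes> y \<in> Kspan t e"
proof (rule tspan_mult_into[OF _ t _ _ _ _ x])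
  show "i a \<otimes> (t [^] j \<otimes> y) \<in> Kspan t e" if "a \<in> carrier K" for j :: nat and a
    by (rule tspan_smult[where W = "\<lambda>_. carrier K" and W' = "\<lambda>_. carrier K",
          OF _ t that _ Kspan_pow_mult[OF t e p y]]) (use that in auto)
qed (use tspan_zero[OF _ t] tspan_add[OF _ t] tspan_closed[OF _ t y] in auto)

text \<open>Linear independence in triangular form: only the top coefficient of a relation has to
  vanish, and the lower ones follow from the same condition for smaller n. This matches the
  recursion of \<open>tspan\<close>.\<close>

definition indep_powers :: "'b \<Rightarrow> nat \<Rightarrow> bool" where
  "indep_powers t e \<longleftrightarrow> (\<forall>n<e. \<forall>a \<in> carrier K. \<forall>r \<in> Kspan t n. i a \<otimes> t [^] n \<oplus> r = \<zero> \<longrightarrow> a = \<zero>\<^bsub>K\<^esub>)"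

lemma indep_powers_unique:
  assumes I: "indep_powers t e" and t: "t \<in> carrier L" and n: "n < e"
    and a: "a \<in> carrier K" "b \<in> carrier K" and r: "r \<in> Kspan t n" "s \<in> Kspan t n"
    and eq: "i a \<otimes> t [^] n \<oplus> r = i b \<otimes> t [^] n \<oplus> s"
  shows "a = b" "r = s"
proof -
  have c: "i a \<in> carrier L" "i b \<in> carrier L" "t [^] n \<in> carrier L" "r \<in> carrier L" "s \<in> carrier L"
    using a t r tspan_closed[where W = "\<lambda>_. carrier K", OF _ t] by auto
  have "i (a \<ominus>\<^bsub>K\<^esub> b) = i a \<ominus> i b" using a by (simp add: a_minus_def)
  moreover have "r \<ominus> s \<in> Kspan t n" using tspan_diff[OF _ t r] by simp
  moreover have "(i a \<ominus> i b) \<otimes> t [^] n \<oplus> (r \<ominus> s) = \<zero>"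
  proof -
    have "(i a \<ominus> i b) \<otimes> t [^] n \<oplus> (r \<ominus> s) = (i a \<otimes> t [^] n \<oplus> r) \<ominus> (i b \<otimes> t [^] n \<oplus> s)"
      using c by algebra
    also have "\<dots> = \<zero>" unfolding eq using c by algebra
    finally show ?thesis .
  qed
  ultimately have "a \<ominus>\<^bsub>K\<^esub> b = \<zero>\<^bsub>K\<^esub>"
    using I n a unfolding indep_powers_def by (metis K.minus_closed)
  then show "a = b" using a by simp
  then show "r = s" using eq c by simp
qed

definition power_basis :: "'b \<Rightarrow> nat \<Rightarrow> bool" where
  "power_basis t e \<longleftrightarrow> t \<in> carrier L \<and> 0 < e \<and> indep_powers t e \<and> Kspan t e = carrier L"

end

section \<open>Isomorphism of extensions with power bases over the same root\<close>

lemma RDirProd_simps: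
  "carrier (RDirProd R S) = carrier R \<times> carrier S"
  "\<zero>\<^bsub>RDirProd R S\<^esub> = (\<zero>\<^bsub>R\<^esub>, \<zero>\<^bsub>S\<^esub>)" "\<one>\<^bsub>RDirProd R S\<^esub> = (\<one>\<^bsub>R\<^esub>, \<one>\<^bsub>S\<^esub>)"
  "(x, y) \<otimes>\<^bsub>RDirProd R S\<^esub> (x', y') = (x \<otimes>\<^bsub>R\<^esub> x', y \<otimes>\<^bsub>S\<^esub> y')"
  "(x, y) \<oplus>\<^bsub>RDirProd R S\<^esub> (x', y') = (x \<oplus>\<^bsub>R\<^esub> x', y \<oplus>\<^bsub>S\<^esub> y')"
  by (auto simp: RDirProd_def DirProd_def monoid.defs)

lemma RDirProd_pow: "(x, y) [^]\<^bsub>RDirProd R S\<^esub> (n::nat) = (x [^]\<^bsub>R\<^esub> n, y [^]\<^bsub>S\<^esub> n)"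
  by (induction n) (simp_all add: RDirProd_simps nat_pow_def)

lemma RDirProd_cring:
  assumes "cring R" "cring S" shows "cring (RDirProd R S)"
proof -
  interpret R: cring R by fact
  interpret S: cring S by fact
  interpret ring "RDirProd R S" using RDirProd_ring R.ring_axioms S.ring_axioms by blast
  show ?thesis
    by unfold_locales (auto simp: RDirProd_simps R.m_comm S.m_comm)
qed

text \<open>The graph of the isomorphism is the K-span of the powers of (t, s) in the product ring, which is
  closed under multiplication because (t, s)^e is the image of p.\<close>

lemma power_basis_iso:
  fixes K :: "('a, 'm) ring_scheme" and L :: "('c, 'n) ring_scheme" and M :: "('d, 'o) ring_scheme"
  assumes KL: "embedded_field K L i" and KM: "embedded_field K M j"
    and t: "embedded_field.power_basis K L i t e" "t [^]\<^bsub>L\<^esub> e = i p"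
    and s: "embedded_field.power_basis K M j s e" "s [^]\<^bsub>M\<^esub> e = j p"
    and p: "p \<in> carrier K"
  shows "\<exists>h \<in> ring_iso L M. \<forall>x \<in> carrier K. h (i x) = j x"
proof -
  interpret L: embedded_field K L i by fact
  interpret M: embedded_field K M j by fact
  let ?D = "RDirProd L M" and ?d = "\<lambda>a. (i a, j a)"
  interpret D: cring ?D by (rule RDirProd_cring) unfold_locales
  interpret D: embedded_field K ?D ?d
    by unfold_locales (auto intro!: ring_hom_memI simp: RDirProd_simps)
  have tc: "t \<in> carrier L" and sc: "s \<in> carrier M" and e: "0 < e"
    using t s by (auto simp: L.power_basis_def M.power_basis_def)
  have It: "L.indep_powers t e" "L.Kspan t e = carrier L" using t by (auto simp: L.power_basis_def)
  have Is: "M.indep_powers s e" "M.Kspan s e = carrier M" using s by (auto simp: M.power_basis_def)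
  have uc: "(t, s) \<in> carrier ?D" using tc sc by (simp add: RDirProd_simps)
  have up: "(t, s) [^]\<^bsub>?D\<^esub> e = ?d p" by (simp add: RDirProd_pow t s)
  \<comment> \<open>The span in the product ring projects onto the two given spans, which for
    \<open>n = e\<close> makes the graph total on both sides.\<close>
  have proj: "fst ` D.Kspan (t, s) n = L.Kspan t n \<and> snd ` D.Kspan (t, s) n = M.Kspan s n" for n
  proof (induction n)
    case 0 show ?case by (simp add: RDirProd_simps)
  next
    case (Suc n)
    have 1: "D.Kspan (t, s) (Suc n) =
        {(i a \<otimes>\<^bsub>L\<^esub> t [^]\<^bsub>L\<^esub> n \<oplus>\<^bsub>L\<^esub> x, j a \<otimes>\<^bsub>M\<^esub> s [^]\<^bsub>M\<^esub> n \<oplus>\<^bsub>M\<^esub> y) | a x y. a \<in> carrier K \<and> (x, y) \<in> D.Kspan (t, s) n}"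
      by (auto simp: D.tspan.simps(2) RDirProd_pow RDirProd_simps)
    have "fst ` {(f a x, g a y) | a x y. a \<in> A \<and> (x, y) \<in> B} = {f a x | a x. a \<in> A \<and> x \<in> fst ` B}"
      "snd ` {(f a x, g a y) | a x y. a \<in> A \<and> (x, y) \<in> B} = {g a y | a y. a \<in> A \<and> y \<in> snd ` B}"
      for f :: "'a \<Rightarrow> 'c \<Rightarrow> 'c" and g :: "'a \<Rightarrow> 'd \<Rightarrow> 'd" and A and B :: "('c \<times> 'd) set"
      by force+
    from this(1)[of "\<lambda>a x. i a \<otimes>\<^bsub>L\<^esub> t [^]\<^bsub>L\<^esub> n \<oplus>\<^bsub>L\<^esub> x"] this(2)[of _ "\<lambda>a y. j a \<otimes>\<^bsub>M\<^esub> s [^]\<^bsub>M\<^esub> n \<oplus>\<^bsub>M\<^esub> y"]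
    show ?case unfolding 1 L.tspan.simps(2) M.tspan.simps(2) using Suc by simp
  qed
  \<comment> \<open>Independence on either side kills the top coefficient, which is shared by both
    coordinates, so by induction neither coordinate vanishes alone. Applied to differences, this
    makes the graph single-valued and injective.\<close>
  have zero: "(x, y) \<in> D.Kspan (t, s) n \<Longrightarrow> x = \<zero>\<^bsub>L\<^esub> \<longleftrightarrow> y = \<zero>\<^bsub>M\<^esub>" if "n \<le> e" for n x y
    using that
  proof (induction n arbitrary: x y)
    case 0 then show ?case by (simp add: RDirProd_simps)
  next
    case (Suc n)
    from Suc.prems(1) obtain a x' y' where a: "a \<in> carrier K" and xy': "(x', y') \<in> D.Kspan (t, s) n"
      and xy: "x = i a \<otimes>\<^bsub>L\<^esub> t [^]\<^bsub>L\<^esub> n \<oplus>\<^bsub>L\<^esub> x'" "y = j a \<otimes>\<^bsub>M\<^esub> s [^]\<^bsub>M\<^esub> n \<oplus>\<^bsub>M\<^esub> y'"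
      by (auto simp: D.tspan.simps(2) RDirProd_pow RDirProd_simps)
    have x': "x' \<in> L.Kspan t n" "y' \<in> M.Kspan s n"
      using proj[of n] imageI[OF xy', of fst] imageI[OF xy', of snd] by simp_all
    then have c: "x' \<in> carrier L" "y' \<in> carrier M"
      using L.tspan_closed[OF L.coeff_groups_all tc] M.tspan_closed[OF M.coeff_groups_all sc] by auto
    have n: "n < e" "n \<le> e" using Suc.prems by auto
    have IH: "x' = \<zero>\<^bsub>L\<^esub> \<longleftrightarrow> y' = \<zero>\<^bsub>M\<^esub>" using Suc.IH[OF xy' n(2)] .
    show ?case
    proof
      assume x0: "x = \<zero>\<^bsub>L\<^esub>"
      then have "a = \<zero>\<^bsub>K\<^esub>" using It(1)[unfolded L.indep_powers_def, rule_format, OF n(1) a x'(1)] xy(1) by simp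
      then show "y = \<zero>\<^bsub>M\<^esub>" using xy x0 IH c tc sc by simp
    next
      assume y0: "y = \<zero>\<^bsub>M\<^esub>"
      then have "a = \<zero>\<^bsub>K\<^esub>" using Is(1)[unfolded M.indep_powers_def, rule_format, OF n(1) a x'(2)] xy(2) by simp
      then show "x = \<zero>\<^bsub>L\<^esub>" using xy y0 IH c tc sc by simp
    qed
  qed
  define V where "V = D.Kspan (t, s) e"
  have Vc: "x \<in> carrier L" "y \<in> carrier M" if "(x, y) \<in> V" for x y
    using D.tspan_closed[OF D.coeff_groups_all uc] that by (auto simp: V_def RDirProd_simps)
  have Vadd: "(x \<oplus>\<^bsub>L\<^esub> x', y \<oplus>\<^bsub>M\<^esub> y') \<in> V" if "(x, y) \<in> V" "(x', y') \<in> V" for x y x' y'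
    using D.tspan_add[OF D.coeff_groups_all uc] that unfolding V_def RDirProd_simps(5)[symmetric] by blast
  have Vmult: "(x \<otimes>\<^bsub>L\<^esub> x', y \<otimes>\<^bsub>M\<^esub> y') \<in> V" if "(x, y) \<in> V" "(x', y') \<in> V" for x y x' y'
    using D.Kspan_mult[OF uc e p up] that unfolding V_def RDirProd_simps(4)[symmetric] by blast
  have Vconst: "(i a, j a) \<in> V" if "a \<in> carrier K" for a
    unfolding V_def using D.tspan_const[OF D.coeff_groups_all uc that e] .
  have Vsub: "(x \<ominus>\<^bsub>L\<^esub> x', y \<ominus>\<^bsub>M\<^esub> y') \<in> V" if xy: "(x, y) \<in> V" "(x', y') \<in> V" for x y x' y'
  proof -
    have "(i (\<ominus>\<^bsub>K\<^esub> \<one>\<^bsub>K\<^esub>), j (\<ominus>\<^bsub>K\<^esub> \<one>\<^bsub>K\<^esub>)) \<in> V" by (rule Vconst) simp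
    from Vadd[OF xy(1) Vmult[OF this xy(2)]] show ?thesis
      using Vc[OF xy(2)] by (simp add: a_minus_def L.l_minus M.l_minus)
  qed
  have Vinj: "x = x' \<longleftrightarrow> y = y'" if xy: "(x, y) \<in> V" "(x', y') \<in> V" for x y x' y'
    using zero[OF order_refl Vsub[OF xy, unfolded V_def]] Vc[OF xy(1)] Vc[OF xy(2)] by simp
  have Vex1: "\<exists>y. (x, y) \<in> V" if "x \<in> carrier L" for x
    using that proj[of e] It(2) unfolding V_def by force
  have Vex2: "\<exists>x. (x, y) \<in> V" if "y \<in> carrier M" for y
    using that proj[of e] Is(2) unfolding V_def by force
  define h where "h x = (SOME y. (x, y) \<in> V)" for x
  have h: "(x, h x) \<in> V" if "x \<in> carrier L" for x
    unfolding h_def using Vex1[OF that] by (rule someI_ex)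
  have hI: "h x = y" if "(x, y) \<in> V" for x y
    using Vinj[OF h[OF Vc(1)[OF that]] that] by simp
  have "h \<in> ring_hom L M"
  proof (rule ring_hom_memI)
    show "h x \<in> carrier M" if "x \<in> carrier L" for x using Vc(2)[OF h[OF that]] .
    show "h (x \<otimes>\<^bsub>L\<^esub> y) = h x \<otimes>\<^bsub>M\<^esub> h y" if "x \<in> carrier L" "y \<in> carrier L" for x y
      using hI[OF Vmult[OF h[OF that(1)] h[OF that(2)]]] .
    show "h (x \<oplus>\<^bsub>L\<^esub> y) = h x \<oplus>\<^bsub>M\<^esub> h y" if "x \<in> carrier L" "y \<in> carrier L" for x y
      using hI[OF Vadd[OF h[OF that(1)] h[OF that(2)]]] .
    show "h \<one>\<^bsub>L\<^esub> = \<one>\<^bsub>M\<^esub>" using hI[OF Vconst[OF L.K.one_closed]] by simp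
  qed
  moreover have "bij_betw h (carrier L) (carrier M)"
    unfolding bij_betw_def
  proof (intro conjI inj_onI equalityI subsetI)
    show "x = y" if "x \<in> carrier L" "y \<in> carrier L" "h x = h y" for x y
      using Vinj[OF h[OF that(1)] h[OF that(2)]] that(3) by simp
    show "y \<in> carrier M" if "y \<in> h ` carrier L" for y using that Vc(2)[OF h] by auto
    show "y \<in> h ` carrier L" if "y \<in> carrier M" for y
      using Vex2[OF that] hI Vc by (metis imageI)
  qed
  ultimately show ?thesis using hI[OF Vconst] by (auto simp: ring_iso_def)
qed

section \<open>Power bases and dimension over the image of K\<close>

context embedded_field
begin

lemma exp_base_Suc: "exp_base t (Suc n) = t [^] n # exp_base t n"
  by (simp add: exp_base_def)

lemma Kspan_eq_Span: "Kspan t n = Span (i ` carrier K) (exp_base t n)"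
proof (induction n)
  case 0 then show ?case by (simp add: exp_base_def)
next
  case (Suc n)
  have "x \<in> Kspan t (Suc n) \<longleftrightarrow> x \<in> Span (i ` carrier K) (exp_base t (Suc n))" for x
    unfolding tspan.simps(2) exp_base_Suc Suc by (auto simp: line_extension_mem_iff)
  then show ?case by blast
qed

lemma image_subfield: "\<one> \<noteq> \<zero> \<Longrightarrow> subfield (i ` carrier K) L"
  using ring_hom_ring.img_is_subfield(2)[OF ring_hom_ringI2[OF K.ring_axioms ring_axioms i_hom] K.carrier_is_subfield] by simp

text \<open>A nonzero top coefficient is invertible in K, so a relation can be solved for its
  highest power. This brings the triangular form to the shape of the inductive definition of
  \<open>independent\<close>.\<close>

lemma indep_powers_iff:
  assumes t: "t \<in> carrier L" and ne: "\<one> \<noteq> \<zero>"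
  shows "indep_powers t e \<longleftrightarrow> (\<forall>n<e. t [^] n \<notin> Kspan t n)"
proof (intro iffI allI impI notI)
  fix n assume I: "indep_powers t e" and n: "n < e" and m: "t [^] n \<in> Kspan t n"
  have "i (\<ominus>\<^bsub>K\<^esub> \<one>\<^bsub>K\<^esub>) \<otimes> t [^] n \<oplus> t [^] n = \<zero>" using t by (simp add: l_minus l_neg)
  then have "\<ominus>\<^bsub>K\<^esub> \<one>\<^bsub>K\<^esub> = \<zero>\<^bsub>K\<^esub>" using I n m unfolding indep_powers_def by (meson K.one_closed K.a_inv_closed)
  then show False using K.add.inv_eq_1_iff[of "\<one>\<^bsub>K\<^esub>"] by simp
next
  assume N: "\<forall>n<e. t [^] n \<notin> Kspan t n"
  show "indep_powers t e" unfolding indep_powers_def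
  proof (intro allI impI ballI)
    fix n a r assume n: "n < e" and a: "a \<in> carrier K" and r: "r \<in> Kspan t n"
      and z: "i a \<otimes> t [^] n \<oplus> r = \<zero>"
    show "a = \<zero>\<^bsub>K\<^esub>"
    proof (rule ccontr)
      assume "a \<noteq> \<zero>\<^bsub>K\<^esub>"
      then have aU: "a \<in> Units K" using a K.field_Units by simp
      let ?b = "inv\<^bsub>K\<^esub> a"
      have b: "?b \<in> carrier K" using aU by simp
      have rc: "r \<in> carrier L" using tspan_closed[OF coeff_groups_all t r] .
      have "i ?b \<otimes> i a = \<one>" using aU a b emb.hom_mult[symmetric] by (simp del: emb.hom_mult)
      then have "t [^] n = i ?b \<otimes> (i a \<otimes> t [^] n)"
        using t a b by (simp add: m_assoc[symmetric])
      also have "i a \<otimes> t [^] n = \<ominus> r"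
        using z t a rc by (simp add: minus_equality)
      finally have "t [^] n \<in> Kspan t n"
        using tspan_smult[where W = "\<lambda>_. carrier K" and W' = "\<lambda>_. carrier K",
            OF _ t b _ tspan_neg[OF _ t r]] b by simp
      then show False using N n by blast
    qed
  qed
qed

lemma indep_powers_iff_independent:
  assumes t: "t \<in> carrier L" and ne: "\<one> \<noteq> \<zero>"
  shows "indep_powers t e \<longleftrightarrow> independent (i ` carrier K) (exp_base t e)"
  unfolding indep_powers_iff[OF t ne] Kspan_eq_Span
proof (induction e)
  case 0 then show ?case by (simp add: exp_base_def)
next
  case (Suc e)
  show ?case unfolding exp_base_Suc less_Suc_eq
    using Suc independent_backwards[of "i ` carrier K" "t [^] e" "exp_base t e"] li_Cons[of "t [^] e" "i ` carrier K" "exp_base t e"] t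
    by blast
qed

lemma power_basis_dimension:
  assumes "power_basis t e" and ne: "\<one> \<noteq> \<zero>"
  shows "dimension e (i ` carrier K) (carrier L)"
proof -
  have t: "t \<in> carrier L" and I: "independent (i ` carrier K) (exp_base t e)"
    and S: "Span (i ` carrier K) (exp_base t e) = carrier L"
    using assms indep_powers_iff_independent[OF _ ne] unfolding power_basis_def Kspan_eq_Span by blast+
  have "length (exp_base t e) = e" by (simp add: exp_base_def)
  then show ?thesis using dimensionI[OF image_subfield[OF ne] I S] by simp
qed

text \<open>In a space of dimension e any e independent vectors span.\<close>

lemma power_basisI_dimension:
  assumes t: "t \<in> carrier L" and ne: "\<one> \<noteq> \<zero>" and e: "0 < e"
    and I: "indep_powers t e" and d: "dimension e (i ` carrier K) (carrier L)"
  shows "power_basis t e"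
proof -
  have "independent (i ` carrier K) (exp_base t e)" using I indep_powers_iff_independent[OF t ne] by blast
  moreover have "length (exp_base t e) = e" by (simp add: exp_base_def)
  ultimately have "Span (i ` carrier K) (exp_base t e) = carrier L"
    using independent_length_eq_dimension[OF image_subfield[OF ne] d] exp_base_closed[OF t] by blast
  then show ?thesis using t e I by (simp add: power_basis_def Kspan_eq_Span)
qed

end

text \<open>Division by the monic polynomial \<open>T^e - p\<close> gives each class a unique
  representative of degree below e. Here p is an arbitrary element, so the quotient is only shown to
  be a nontrivial ring.\<close>

lemma (in field) adjoin_root_power_basis:
  assumes p: "p \<in> carrier R" and e: "0 < e" and Li: "adjoin_root e p = (L, i)"
  shows "embedded_field R L i" "\<one>\<^bsub>L\<^esub> \<noteq> \<zero>\<^bsub>L\<^esub>"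
    "\<exists>t. embedded_field.power_basis R L i t e \<and> t [^]\<^bsub>L\<^esub> e = i p"
proof -
  let ?K = "carrier R"
  define f where "f = X [^]\<^bsub>poly_ring R\<^esub> e \<ominus>\<^bsub>poly_ring R\<^esub> poly_of_const p"
  let ?h = "rupture_surj ?K f"
  have L: "L = Rupt ?K f" and i: "i = (\<lambda>x. ?h (poly_of_const x))"
    using Li by (auto simp: adjoin_root_def f_def Let_def)
  note sf = carrier_is_subfield and sr = carrier_is_subring
  interpret UP: domain "poly_ring R" using univ_poly_is_domain[OF sr] .
  have cc: "poly_of_const x \<in> carrier (poly_ring R)" if "x \<in> ?K" for x
    using ring_hom_memE(1)[OF canonical_embedding_is_hom[OF sr]] that by simp
  have Xc: "X [^]\<^bsub>poly_ring R\<^esub> (n::nat) \<in> carrier (poly_ring R)" for n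
    using var_pow_closed[OF sr] .
  have fc: "f \<in> carrier (poly_ring R)" unfolding f_def using cc[OF p] Xc by simp
  have lX: "length (X [^]\<^bsub>poly_ring R\<^esub> e) = Suc e"
    unfolding unitary_monom_eq_var_pow[OF sr, symmetric] by (simp add: monom_def)
  \<comment> \<open>The constant term is shorter than \<open>T^e\<close> because e is positive, so
    it leaves the leading term of f alone.\<close>
  have "length (\<ominus>\<^bsub>poly_ring R\<^esub> poly_of_const p) \<le> 1"
    using univ_poly_a_inv_length[OF sr cc[OF p]] by (simp add: poly_of_const_def)
  then have "length f = Suc e"
    unfolding f_def a_minus_def univ_poly_add
    using poly_add_length_eq[OF sr, of "X [^]\<^bsub>poly_ring R\<^esub> e" "\<ominus>\<^bsub>poly_ring R\<^esub> poly_of_const p"] lX e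
      Xc[of e] UP.a_inv_closed[OF cc[OF p]] by (simp add: univ_poly_carrier)
  then have deg: "degree f = e" and fn: "f \<noteq> []" by auto
  have degpos: "degree f > 0" using deg e by simp
  interpret I: ideal "PIdl\<^bsub>poly_ring R\<^esub> f" "poly_ring R" using UP.cgenideal_ideal[OF fc] .
  have Lc: "cring L" unfolding L rupture_def using I.quotient_is_cring UP.cring_axioms by blast
  have hh: "?h \<in> ring_hom (poly_ring R) L" unfolding L using rupture_surj_hom(1)[OF sr fc] .
  have ih: "i \<in> ring_hom R L"
    using ring_hom_trans[OF canonical_embedding_is_hom[OF sr] hh] by (simp add: i comp_def)
  interpret L: cring L by (rule Lc)
  show emb: "embedded_field R L i"
    by unfold_locales (rule ih)
  interpret E: embedded_field R L i by (rule emb)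
  interpret H': ring_hom_ring "poly_ring R" L ?h unfolding L by (rule rupture_surj_hom(2)[OF sr fc])
  interpret H: ring_hom_cring "poly_ring R" L ?h by unfold_locales (rule hh)
  show ne: "\<one>\<^bsub>L\<^esub> \<noteq> \<zero>\<^bsub>L\<^esub>" using rupture_one_not_zero[OF sf fc degpos] unfolding L .
  let ?t = "?h X"
  have Xc1: "X \<in> carrier (poly_ring R)" using var_closed(1)[OF sr] .
  have tc: "?t \<in> carrier L" using Xc1 by simp
  have "?h f = \<zero>\<^bsub>L\<^esub>"
    using UP.a_rcos_zero[OF UP.cgenideal_ideal[OF fc] UP.cgenideal_self[OF fc]] 
    unfolding L rupture_def FactRing_def by simp
  moreover have "?h (X [^]\<^bsub>poly_ring R\<^esub> e \<ominus>\<^bsub>poly_ring R\<^esub> poly_of_const p) = ?t [^]\<^bsub>L\<^esub> e \<ominus>\<^bsub>L\<^esub> i p"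
    using Xc[of e] Xc1 cc[OF p] unfolding i by (simp add: a_minus_def)
  ultimately have "?t [^]\<^bsub>L\<^esub> e \<ominus>\<^bsub>L\<^esub> i p = \<zero>\<^bsub>L\<^esub>"
    using arg_cong[OF f_def, of ?h] by simp
  then have tp: "?t [^]\<^bsub>L\<^esub> e = i p" using tc p by simp
  have hb: "map ?h (UP.exp_base X n) = L.exp_base ?t n" for n
    unfolding UP.exp_base_def L.exp_base_def using Xc1 by simp
  have iK: "i ` ?K = ?h ` (poly_of_const ` ?K)" by (auto simp: i)
  have len: "(\<lambda>q. q pmod f) ` carrier (poly_ring R) = {q \<in> carrier (poly_ring R). length q \<le> e}"
    using pmod_image_characterization[OF sf fc fn] deg by simp
  note subc = univ_poly_subfield_of_consts[OF sf]
  \<comment> \<open>\<open>length q \<le> n\<close> means degree below n, a coefficient list being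
    one longer than its degree.\<close>
  have S: "L.Span (i ` ?K) (L.exp_base ?t n) = ?h ` {q \<in> carrier (poly_ring R). length q \<le> n}" for n
    unfolding hb[symmetric] iK
    using H'.Span_hom[OF subfieldE(3)[OF subc] UP.exp_base_closed[OF Xc1]] Span_var_pow_base[OF sf] by simp
  have "E.Kspan ?t e = carrier L"
    unfolding E.Kspan_eq_Span S
    using rupture_carrier_as_pmod_image[OF sf fc] len unfolding L by simp
  moreover have "inj_on ?h (UP.Span (poly_of_const ` ?K) (UP.exp_base X e))"
    unfolding Span_var_pow_base[OF sf] using rupture_surj_inj_on[OF sf fc] len by simp
  then have "L.independent (i ` ?K) (L.exp_base ?t e)"
    using H'.inj_hom_preserves_independent[OF subc ne _ var_pow_base_independent[OF sf, of e]] unfolding hb iK by simp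
  then have "E.indep_powers ?t e" using E.indep_powers_iff_independent[OF tc ne] by blast
  ultimately have "E.power_basis ?t e" using tc e by (simp add: E.power_basis_def)
  then show "\<exists>t. E.power_basis t e \<and> t [^]\<^bsub>L\<^esub> e = i p" using tp by blast
qed

section \<open>The valuation of a root of a uniformiser\<close>

locale uniformiser_root = V: discrete_valuation K v + embedded_field K L i
  for K :: "('a, 'm) ring_scheme" and v and L :: "('b, 'n) ring_scheme" (structure) and i +
  fixes t :: 'b and e :: nat and p :: 'a
  assumes basis: "power_basis t e" and root: "t [^] e = i p"
    and p: "p \<in> carrier K - {\<zero>\<^bsub>K\<^esub>}" "v p = 1" and nontrivial: "\<one> \<noteq> \<zero>"
begin

lemma t_closed [simp]: "t \<in> carrier L" and e_pos: "0 < e" and indep: "indep_powers t e"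
  and Kspan_all: "Kspan t e = carrier L"
  using basis by (auto simp: power_basis_def)

text \<open>The bound is on \<open>e * v a + j\<close>, the valuation that the monomial
  \<open>a t^j\<close> is forced to have when \<open>t^e = p\<close> and
  \<open>v p = 1\<close>.\<close>

definition weights :: "int \<Rightarrow> nat \<Rightarrow> 'a set" where
  "weights N j = {a \<in> carrier K. a = \<zero>\<^bsub>K\<^esub> \<or> N \<le> int e * v a + int j}"

definition wball :: "int \<Rightarrow> 'b set" where
  "wball N = tspan t (weights N) e"

lemma weights_groups [simp]: "coeff_groups (weights N)"
proof -
  have "a \<oplus>\<^bsub>K\<^esub> b \<in> weights N j" if a: "a \<in> weights N j" and b: "b \<in> weights N j" for a b j
  proof (cases "a = \<zero>\<^bsub>K\<^esub> \<or> b = \<zero>\<^bsub>K\<^esub> \<or> a \<oplus>\<^bsub>K\<^esub> b = \<zero>\<^bsub>K\<^esub>")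
    case True
    then show ?thesis using a b by (auto simp: weights_def)
  next
    case False
    have ab: "a \<in> carrier K" "b \<in> carrier K" using a b by (auto simp: weights_def)
    then have "min (v a) (v b) \<le> v (a \<oplus>\<^bsub>K\<^esub> b)" using V.v_add False by simp
    then have "v a \<le> v (a \<oplus>\<^bsub>K\<^esub> b) \<or> v b \<le> v (a \<oplus>\<^bsub>K\<^esub> b)" by auto
    then have "int e * v a \<le> int e * v (a \<oplus>\<^bsub>K\<^esub> b) \<or> int e * v b \<le> int e * v (a \<oplus>\<^bsub>K\<^esub> b)"
      by (auto intro: mult_left_mono)
    then show ?thesis using a b ab False by (auto simp: weights_def)
  qed
  moreover have "\<ominus>\<^bsub>K\<^esub> a \<in> weights N j" if "a \<in> weights N j" for a j
    using that V.v_neg[of a] by (auto simp: weights_def)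
  moreover have "weights N j \<subseteq> carrier K" "\<zero>\<^bsub>K\<^esub> \<in> weights N j" for j by (auto simp: weights_def)
  ultimately show ?thesis by (simp add: coeff_groups_def)
qed

lemma wball_closed: "x \<in> wball N \<Longrightarrow> x \<in> carrier L"
  using tspan_closed[OF weights_groups t_closed] by (simp add: wball_def)

lemma wball_zero [simp]: "\<zero> \<in> wball N"
  using tspan_zero[OF weights_groups t_closed] by (simp add: wball_def)

lemma wball_add: "\<lbrakk>x \<in> wball N; y \<in> wball N\<rbrakk> \<Longrightarrow> x \<oplus> y \<in> wball N"
  using tspan_add[OF weights_groups t_closed] by (simp add: wball_def)

lemma wball_diff: "\<lbrakk>x \<in> wball N; y \<in> wball N\<rbrakk> \<Longrightarrow> x \<ominus> y \<in> wball N"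
  using tspan_diff[OF weights_groups t_closed] by (simp add: wball_def)

lemma weights_mono: "M \<le> N \<Longrightarrow> weights N j \<subseteq> weights M j"
  by (auto simp: weights_def)

lemma wball_mono: "\<lbrakk>x \<in> wball N; M \<le> N\<rbrakk> \<Longrightarrow> x \<in> wball M"
  using tspan_mono[of e "weights N" "weights M" t] weights_mono by (auto simp: wball_def)

lemma wball_smult:
  assumes c: "c \<in> carrier K - {\<zero>\<^bsub>K\<^esub>}" and x: "x \<in> wball N"
  shows "i c \<otimes> x \<in> wball (N + int e * v c)"
  unfolding wball_def
proof (rule tspan_smult[OF weights_groups t_closed _ _ x[unfolded wball_def]])
  show "c \<otimes>\<^bsub>K\<^esub> a \<in> weights (N + int e * v c) j" if "a \<in> weights N j" for j a
    using that c V.v_mult[OF c, of a] by (auto simp: weights_def V.integral_iff algebra_simps)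
qed (use c in auto)

text \<open>Moving up one place adds 1 to the weight. At the wrap-around the same holds because
  \<open>v p = 1\<close>: the old weight \<open>e * v a + (e - 1)\<close> becomes
  \<open>e * v (a p) = e * (v a + 1)\<close>.\<close>

lemma wball_shift:
  assumes x: "x \<in> wball N" shows "t \<otimes> x \<in> wball (N + 1)"
  unfolding wball_def
proof (rule tspan_shift_cyclic[OF weights_groups weights_groups t_closed _ e_pos _ root _ x[unfolded wball_def]])
  show "a \<otimes>\<^bsub>K\<^esub> p \<in> weights (N + 1) 0" if "a \<in> weights N (e - 1)" for a
    using that p e_pos V.v_mult[of a p] by (auto simp: weights_def V.integral_iff algebra_simps of_nat_diff)
qed (use p in \<open>auto simp: weights_def\<close>)

lemma wball_pow_shift: "x \<in> wball N \<Longrightarrow> t [^] (j::nat) \<otimes> x \<in> wball (N + int j)"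
proof (induction j)
  case 0 then show ?case using wball_closed by simp
next
  case (Suc j)
  have "t \<otimes> (t [^] j \<otimes> x) = t [^] Suc j \<otimes> x"
    using wball_closed[OF Suc.prems] by (simp add: m_ac)
  then show ?case using wball_shift[OF Suc.IH[OF Suc.prems]] by (simp add: ac_simps)
qed

lemma wball_mult:
  assumes x: "x \<in> wball M" and y: "y \<in> wball N" shows "x \<otimes> y \<in> wball (M + N)"
proof (rule tspan_mult_into[OF weights_groups t_closed wball_closed[OF y] wball_zero wball_add _ x[unfolded wball_def]])
  fix j a assume a: "a \<in> weights M j"
  show "i a \<otimes> (t [^] j \<otimes> y) \<in> wball (M + N)"
  proof (cases "a = \<zero>\<^bsub>K\<^esub>")
    case True then show ?thesis using wball_closed[OF y] by simp
  next
    case False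
    then have "a \<in> carrier K - {\<zero>\<^bsub>K\<^esub>}" "M \<le> int e * v a + int j" using a by (auto simp: weights_def)
    then show ?thesis using wball_mono[OF wball_smult[OF _ wball_pow_shift[OF y]]] by simp
  qed
qed

text \<open>By uniqueness of coordinates the only expansion of \<open>i a\<close> has a in place 0
  and zeros elsewhere, so the other places impose no condition.\<close>

lemma const_in_tspan:
  assumes a: "a \<in> carrier K" and n: "0 < n" "n \<le> e" and m: "i a \<in> tspan t (weights N) n"
  shows "a \<in> weights N 0"
  using n m
proof (induction n)
  case (Suc n)
  obtain b r where b: "b \<in> weights N n" and r: "r \<in> tspan t (weights N) n" and eq: "i a = i b \<otimes> t [^] n \<oplus> r"
    using Suc.prems(3) by (rule tspan_SucE)
  have bc: "b \<in> carrier K" using b by (simp add: weights_def)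
  have rK: "r \<in> Kspan t n" using r tspan_mono[of n "weights N" "\<lambda>_. carrier K" t] by (auto simp: weights_def)
  show ?case
  proof (cases "n = 0")
    case True
    then have "r = \<zero>" using r by simp
    then have "i a = i b" using eq bc True by simp
    then have "i a \<otimes> t [^] (0::nat) \<oplus> \<zero> = i b \<otimes> t [^] (0::nat) \<oplus> \<zero>" by simp
    then have "a = b" using indep_powers_unique(1)[OF indep t_closed e_pos a bc] by simp
    then show ?thesis using b True by simp
  next
    case False
    have iaK: "i a \<in> Kspan t n" using tspan_const[OF coeff_groups_all t_closed a] False by simp
    have "i \<zero>\<^bsub>K\<^esub> \<otimes> t [^] n \<oplus> i a = i a" using a by simp
    also note eq
    finally have "i a = r"
      using indep_powers_unique(2)[OF indep t_closed _ V.zero_closed bc iaK rK] Suc.prems(2) by simp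
    then show ?thesis using Suc.IH r False Suc.prems by simp
  qed
qed simp

lemma const_in_wball: "a \<in> carrier K \<Longrightarrow> i a \<in> wball N \<longleftrightarrow> a \<in> weights N 0"
  using const_in_tspan[OF _ e_pos order_refl] tspan_const[OF weights_groups t_closed _ e_pos]
  by (auto simp: wball_def)

text \<open>A multiple of e is at least 1 as soon as it is positive. Hence the valuation ring and
  the maximal ideal of L meet K in those of K.\<close>

lemma weights_ball: "a \<in> weights 0 0 \<longleftrightarrow> a \<in> V.ball 0" "a \<in> weights 1 0 \<longleftrightarrow> a \<in> V.ball 1"
proof -
  have "0 \<le> int e * v a \<longleftrightarrow> 0 \<le> v a" "1 \<le> int e * v a \<longleftrightarrow> 1 \<le> v a"
    using e_pos zero_less_mult_iff[of "int e" "v a"] zero_le_mult_iff[of "int e" "v a"]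
    by (auto simp: int_one_le_iff_zero_less)
  then show "a \<in> weights 0 0 \<longleftrightarrow> a \<in> V.ball 0" "a \<in> weights 1 0 \<longleftrightarrow> a \<in> V.ball 1"
    by (auto simp: weights_def val_ball_def)
qed

text \<open>Together with \<open>wball_separated\<close> this gives every nonzero element a last
  ball containing it, which is how its valuation is defined.\<close>

lemma wball_exhaust:
  assumes "x \<in> carrier L" shows "\<exists>N. x \<in> wball N"
proof -
  have "\<exists>N. x \<in> tspan t (weights N) n" if "x \<in> Kspan t n" for n
    using that
  proof (induction n arbitrary: x)
    case (Suc n)
    obtain a r where a: "a \<in> carrier K" and r: "r \<in> Kspan t n" and x: "x = i a \<otimes> t [^] n \<oplus> r"
      using Suc.prems by (rule tspan_SucE)
    obtain N where N: "r \<in> tspan t (weights N) n" using Suc.IH[OF r] by blast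
    let ?N = "min N (int e * v a + int n)"
    have "r \<in> tspan t (weights ?N) n" using N tspan_mono[of n "weights N" "weights ?N" t] weights_mono by auto
    moreover have "a \<in> weights ?N n" using a by (simp add: weights_def)
    ultimately show ?case unfolding x using tspan_SucI[where W="weights ?N"] by blast
  qed simp
  then show ?thesis using assms by (simp add: Kspan_all wball_def)
qed

lemma wball_separated:
  assumes "x \<in> carrier L" "x \<noteq> \<zero>" shows "\<exists>N. x \<notin> wball N"
proof -
  have "\<exists>N. x \<notin> tspan t (weights N) n" if "n \<le> e" "x \<in> Kspan t n" "x \<noteq> \<zero>" for n
    using that
  proof (induction n arbitrary: x)
    case (Suc n)
    obtain a r where a: "a \<in> carrier K" and r: "r \<in> Kspan t n" and x: "x = i a \<otimes> t [^] n \<oplus> r"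
      using Suc.prems(2) by (rule tspan_SucE)
    have rc: "r \<in> carrier L" using tspan_closed[OF coeff_groups_all t_closed r] .
    have *: "a \<in> weights N n \<and> r \<in> tspan t (weights N) n" if N: "x \<in> tspan t (weights N) (Suc n)" for N
    proof -
      obtain b s where b: "b \<in> weights N n" and s: "s \<in> tspan t (weights N) n" and xb: "x = i b \<otimes> t [^] n \<oplus> s"
        using N by (rule tspan_SucE)
      have bc: "b \<in> carrier K" using b by (simp add: weights_def)
      have sK: "s \<in> Kspan t n" using s tspan_mono[of n "weights N" "\<lambda>_. carrier K" t] by (auto simp: weights_def)
      show ?thesis using indep_powers_unique[OF indep t_closed _ a bc r sK] x xb b s Suc.prems(1) by simp
    qed
    show ?case
    proof (cases "a = \<zero>\<^bsub>K\<^esub>")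
      case True
      then have "r \<noteq> \<zero>" using x rc Suc.prems(3) by auto
      then show ?thesis using Suc.IH[OF _ r] Suc.prems(1) * by auto
    next
      case False
      then have "a \<notin> weights (int e * v a + int n + 1) n" by (simp add: weights_def)
      then show ?thesis using * by blast
    qed
  qed simp
  then show ?thesis using assms by (simp add: Kspan_all wball_def)
qed

text \<open>For \<open>0 < n < e\<close> the weight \<open>e * v b + n\<close> is never 0, so a
  monomial of weight at least 0 already has weight at least 1. Modulo the ball of radius 1 only the
  constant term survives.\<close>

lemma wball_residue:
  assumes "x \<in> wball 0" shows "\<exists>a \<in> V.ball 0. x \<ominus> i a \<in> wball 1"
proof -
  have "\<exists>a \<in> V.ball 0. x \<ominus> i a \<in> tspan t (weights 1) n" if "0 < n" "n \<le> e" "x \<in> tspan t (weights 0) n" for n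
    using that
  proof (induction n arbitrary: x)
    case (Suc n)
    obtain b r where b: "b \<in> weights 0 n" and r: "r \<in> tspan t (weights 0) n" and x: "x = i b \<otimes> t [^] n \<oplus> r"
      using Suc.prems(3) by (rule tspan_SucE)
    have bc: "b \<in> carrier K" using b by (simp add: weights_def)
    have rc: "r \<in> carrier L" using tspan_closed[OF weights_groups t_closed r] .
    show ?case
    proof (cases "n = 0")
      case True
      then have "r = \<zero>" using r by simp
      then have "x \<ominus> i b = \<zero>" using x bc True by (simp add: a_minus_def r_neg)
      moreover have "b \<in> V.ball 0" using b True by (simp add: weights_ball)
      ultimately show ?thesis using tspan_zero[OF weights_groups t_closed, of 1 "Suc n"] by (metis (no_types))
    next
      case False
      then obtain a where a: "a \<in> V.ball 0" "r \<ominus> i a \<in> tspan t (weights 1) n"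
        using Suc.IH[OF _ _ r] Suc.prems(2) by auto
      have ac: "a \<in> carrier K" using V.ball_closed[OF a(1)] .
      have "b \<in> weights 1 n"
      proof (cases "b = \<zero>\<^bsub>K\<^esub>")
        case False
        then have "0 \<le> int e * v b + int n" using b by (simp add: weights_def)
        moreover have "int n < int e" using Suc.prems(2) by simp
        ultimately have "int e * (-1) < int e * v b" by simp
        then have "-1 < v b" using e_pos by (simp only: mult_less_cancel_left_pos of_nat_0_less_iff)
        then have "0 \<le> int e * v b" by simp
        then show ?thesis using bc \<open>n \<noteq> 0\<close> by (simp add: weights_def)
      qed (simp add: weights_def)
      then have "i b \<otimes> t [^] n \<oplus> (r \<ominus> i a) \<in> tspan t (weights 1) (Suc n)"
        using tspan_SucI[where W="weights 1"] a(2) by blast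
      moreover have "i b \<otimes> t [^] n \<oplus> (r \<ominus> i a) = x \<ominus> i a"
        unfolding x using bc rc ac by (simp add: a_minus_def a_ac)
      ultimately show ?thesis using a(1) by auto
    qed
  qed simp
  then show ?thesis using assms e_pos by (simp add: wball_def)
qed

text \<open>This makes the valuation multiplicative: modulo the ball of radius 1 both factors are constants.\<close>

lemma wball_prime_0:
  assumes x: "x \<in> wball 0" and y: "y \<in> wball 0" and xy: "x \<otimes> y \<in> wball 1"
  shows "x \<in> wball 1 \<or> y \<in> wball 1"
proof -
  obtain a where a: "a \<in> V.ball 0" "x \<ominus> i a \<in> wball 1" using wball_residue[OF x] by blast
  obtain b where b: "b \<in> V.ball 0" "y \<ominus> i b \<in> wball 1" using wball_residue[OF y] by blast
  have ab: "a \<in> carrier K" "b \<in> carrier K" using a b V.ball_closed by auto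
  have c: "x \<in> carrier L" "y \<in> carrier L" "i a \<in> carrier L" "i b \<in> carrier L"
    using x y wball_closed ab by auto
  have ia: "i a \<in> wball 0" using const_in_wball[OF ab(1)] a(1) weights_ball by simp
  \<comment> \<open>The subtracted bracket equals \<open>x y - a b\<close>, and both of its terms
    lie in the ball of radius 1.\<close>
  have "x \<otimes> y \<ominus> ((x \<ominus> i a) \<otimes> y \<oplus> i a \<otimes> (y \<ominus> i b)) \<in> wball 1"
    using wball_diff[OF xy wball_add[OF wball_mult[OF a(2) y, simplified] wball_mult[OF ia b(2), simplified]]] .
  moreover have "x \<otimes> y \<ominus> ((x \<ominus> i a) \<otimes> y \<oplus> i a \<otimes> (y \<ominus> i b)) = i a \<otimes> i b" using c by algebra
  ultimately have "i (a \<otimes>\<^bsub>K\<^esub> b) \<in> wball 1" using ab by simp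
  then have ab1: "a \<otimes>\<^bsub>K\<^esub> b \<in> V.ball 1" using const_in_wball[of "a \<otimes>\<^bsub>K\<^esub> b"] ab weights_ball by simp
  have "a \<in> V.ball 1 \<or> b \<in> V.ball 1"
  proof (rule ccontr)
    assume n: "\<not> (a \<in> V.ball 1 \<or> b \<in> V.ball 1)"
    then have ne: "a \<in> carrier K - {\<zero>\<^bsub>K\<^esub>}" "b \<in> carrier K - {\<zero>\<^bsub>K\<^esub>}" using ab by auto
    then have "v a = 0" "v b = 0" using n a(1) b(1) V.ball_iff by force+
    then show False using ab1 V.v_mult[OF ne] V.ball_iff[OF V.nonzero_m_closed[OF ne]] by simp
  qed
  then have "i a \<in> wball 1 \<or> i b \<in> wball 1" using const_in_wball ab weights_ball by simp
  moreover have "(x \<ominus> i a) \<oplus> i a = x" "(y \<ominus> i b) \<oplus> i b = y" using c by algebra+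
  ultimately show ?thesis using wball_add[OF a(2), of "i a"] wball_add[OF b(2), of "i b"] by auto
qed

text \<open>Powers of t and of its explicit inverse provide invertible elements of every weight
  before L is known to be a field. They are used to rescale to weight 0.\<close>

lemma unit_of_weight: "\<exists>u u'. u \<in> wball N \<and> u' \<in> wball (- N) \<and> u \<otimes> u' = \<one>"
proof -
  let ?ip = "inv\<^bsub>K\<^esub> p"
  have ip: "?ip \<in> carrier K - {\<zero>\<^bsub>K\<^esub>}" using V.nonzero_inv_closed[OF p(1)] .
  \<comment> \<open>Since \<open>t^e\<close> is the image of p, this is the inverse of t; its weight
    is \<open>(e - 1) - e = -1\<close>.\<close>
  define s where "s = t [^] (e - 1) \<otimes> i ?ip"
  have one: "\<one> \<in> wball 0" using const_in_wball[of "\<one>\<^bsub>K\<^esub>" 0] weights_ball by simp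
  have t1: "t \<in> wball 1" using wball_shift[OF one] by simp
  have "i ?ip \<in> wball (- int e)"
    using wball_smult[OF ip one] V.v_inv[OF p(1)] p(2) ip by simp
  then have s1: "s \<in> wball (- 1)"
    using wball_pow_shift[of "i ?ip" "- int e" "e - 1"] e_pos by (simp add: s_def of_nat_diff)
  have "t \<otimes> s = (t [^] (e - 1) \<otimes> t) \<otimes> i ?ip" using ip by (simp add: s_def m_ac)
  also have "t [^] (e - 1) \<otimes> t = t [^] e" using e_pos by (cases e) auto
  also have "\<dots> \<otimes> i ?ip = i (p \<otimes>\<^bsub>K\<^esub> ?ip)" using p ip by (simp add: root)
  finally have ts: "t \<otimes> s = \<one>" using V.nonzero_r_inv[OF p(1)] by simp
  have sc: "s \<in> carrier L" using wball_closed[OF s1] .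
  have pw: "t [^] (n::nat) \<in> wball (int n)" "s [^] n \<in> wball (- int n)" "t [^] n \<otimes> s [^] n = \<one>" for n
  proof -
    show "t [^] n \<in> wball (int n)" using wball_pow_shift[OF one, of n] by simp
    show "s [^] n \<in> wball (- int n)"
    proof (induction n)
      case (Suc n)
      then show ?case using wball_mult[OF Suc s1] by (simp add: algebra_simps)
    qed (simp add: one)
    show "t [^] n \<otimes> s [^] n = \<one>" using ts sc by (simp add: pow_mult_distrib[symmetric] m_comm)
  qed
  show ?thesis
  proof (cases "0 \<le> N")
    case True
    then show ?thesis using pw[of "nat N"] by auto
  next
    case False
    have "s [^] nat (- N) \<otimes> t [^] nat (- N) = \<one>" using pw(3)[of "nat (- N)"] sc by (simp add: m_comm)
    moreover have "s [^] nat (- N) \<in> wball N" "t [^] nat (- N) \<in> wball (- N)"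
      using pw(1,2)[of "nat (- N)"] False by simp_all
    ultimately show ?thesis by blast
  qed
qed

text \<open>Multiplying x and y by invertible elements of weights -M and -N reduces the claim to
  \<open>wball_prime_0\<close>.\<close>

lemma wball_prime:
  assumes x: "x \<in> wball M" and y: "y \<in> wball N" and xy: "x \<otimes> y \<in> wball (M + N + 1)"
  shows "x \<in> wball (M + 1) \<or> y \<in> wball (N + 1)"
proof -
  obtain u u' where u: "u \<in> wball M" "u' \<in> wball (- M)" "u \<otimes> u' = \<one>" using unit_of_weight by blast
  obtain w w' where w: "w \<in> wball N" "w' \<in> wball (- N)" "w \<otimes> w' = \<one>" using unit_of_weight by blast
  have c: "x \<in> carrier L" "y \<in> carrier L" "u \<in> carrier L" "u' \<in> carrier L" "w \<in> carrier L" "w' \<in> carrier L"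
    using x y u w wball_closed by auto
  have "(x \<otimes> y) \<otimes> (u' \<otimes> w') \<in> wball 1"
    using wball_mult[OF xy wball_mult[OF u(2) w(2)]] by simp
  moreover have "(x \<otimes> y) \<otimes> (u' \<otimes> w') = (x \<otimes> u') \<otimes> (y \<otimes> w')" using c by algebra
  ultimately have "x \<otimes> u' \<in> wball 1 \<or> y \<otimes> w' \<in> wball 1"
    using wball_prime_0 wball_mult[OF x u(2)] wball_mult[OF y w(2)] by simp
  moreover have "(x \<otimes> u') \<otimes> u = x" "(y \<otimes> w') \<otimes> w = y"
  proof -
    have "(x \<otimes> u') \<otimes> u = x \<otimes> (u \<otimes> u')" "(y \<otimes> w') \<otimes> w = y \<otimes> (w \<otimes> w')" using c by algebra+
    then show "(x \<otimes> u') \<otimes> u = x" "(y \<otimes> w') \<otimes> w = y" using c u(3) w(3) by simp_all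
  qed
  ultimately show ?thesis
    using wball_mult[OF _ u(1), of "x \<otimes> u'" 1] wball_mult[OF _ w(1), of "y \<otimes> w'" 1] by (auto simp: add.commute)
qed

text \<open>Zero lies in all balls, so there the choice has no witness; this agrees with the
  convention that a valuation is arbitrary at zero.\<close>

definition w :: "'b \<Rightarrow> int" where
  "w x = (SOME N. x \<in> wball N \<and> x \<notin> wball (N + 1))"

lemma w_spec:
  assumes "x \<in> carrier L - {\<zero>}" shows "x \<in> wball (w x)" "x \<notin> wball (w x + 1)"
proof -
  have "\<exists>N. x \<in> wball N \<and> x \<notin> wball (N + 1)"
  proof (rule ccontr)
    assume n: "\<not> (\<exists>N. x \<in> wball N \<and> x \<notin> wball (N + 1))"
    obtain N0 where N0: "x \<in> wball N0" using wball_exhaust assms by blast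
    have up: "x \<in> wball (N0 + int k)" for k
    proof (induction k)
      case (Suc k)
      then have "x \<in> wball (N0 + int k + 1)" using n by blast
      then show ?case by (simp add: ac_simps)
    qed (simp add: N0)
    then have "x \<in> wball N" for N
      using wball_mono[OF up[of "nat (N - N0)"], of N] by simp
    then show False using wball_separated assms by blast
  qed
  then have "x \<in> wball (w x) \<and> x \<notin> wball (w x + 1)" unfolding w_def by (rule someI_ex)
  then show "x \<in> wball (w x)" "x \<notin> wball (w x + 1)" by auto
qed

lemma wball_iff: "x \<in> carrier L - {\<zero>} \<Longrightarrow> x \<in> wball N \<longleftrightarrow> N \<le> w x"
  using w_spec[of x] wball_mono[of x N "w x + 1"] wball_mono[of x "w x" N] by linarith

lemma w_eqI: "\<lbrakk>x \<in> carrier L - {\<zero>}; x \<in> wball N; x \<notin> wball (N + 1)\<rbrakk> \<Longrightarrow> w x = N"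
  using wball_iff[of x N] wball_iff[of x "N + 1"] by simp

lemma w_mult:
  assumes x: "x \<in> carrier L - {\<zero>}" and y: "y \<in> carrier L - {\<zero>}"
  shows "x \<otimes> y \<noteq> \<zero>" "w (x \<otimes> y) = w x + w y"
proof -
  have n: "x \<otimes> y \<notin> wball (w x + w y + 1)" using wball_prime w_spec[OF x] w_spec[OF y] by blast
  then show ne: "x \<otimes> y \<noteq> \<zero>" by auto
  show "w (x \<otimes> y) = w x + w y" using w_eqI[OF _ wball_mult[OF w_spec(1)[OF x] w_spec(1)[OF y]] n] ne x y by simp
qed

lemma is_domain: "domain L"
  by unfold_locales (use nontrivial w_mult(1) in auto)

text \<open>L is a domain of finite dimension over the image of K. Each nonzero element is therefore
  algebraic, and its inverse lies in the subfield that it generates.\<close>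

lemma is_field: "field L"
proof -
  interpret domain L by (rule is_domain)
  let ?k = "i ` carrier K"
  have k: "subfield ?k L" using image_subfield[OF nontrivial] .
  have fd: "finite_dimension ?k (carrier L)"
    using finite_dimensionI[OF power_basis_dimension[OF basis nontrivial]] .
  show ?thesis
  proof (rule cring_fieldI, intro equalityI subsetI)
    fix x assume "x \<in> Units L"
    then show "x \<in> carrier L - {\<zero>}" using nontrivial by (metis DiffI Units_closed Units_l_inv l_null r_null singletonD Units_inv_closed)
  next
    fix x assume x: "x \<in> carrier L - {\<zero>}"
    then have "(algebraic over ?k) x" using finite_dimension_imp_algebraic[OF k carrier_is_subring fd] by simp
    then have S: "subfield (simple_extension ?k x) L"
      using simple_extension_is_subfield[OF k] x by simp
    have "x \<in> simple_extension ?k x" using simple_extension_mem[OF subfieldE(1)[OF k]] x by simp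
    then show "x \<in> Units L" using subfield_m_inv[OF S, of x] x subfieldE(3)[OF S]
      by (auto simp: Units_def)
  qed
qed

lemma w_discrete_valuation: "discrete_valuation L w"
proof -
  interpret field L by (rule is_field)
  show ?thesis
  proof unfold_locales
    have "\<exists>x \<in> carrier L - {\<zero>}. w x = N" for N
    proof -
      obtain u u' where u: "u \<in> wball N" "u' \<in> wball (- N)" "u \<otimes> u' = \<one>" using unit_of_weight by blast
      have c: "u \<in> carrier L" "u' \<in> carrier L" using u wball_closed by auto
      then have ne: "u \<noteq> \<zero>" using u(3) nontrivial by auto
      have "u \<notin> wball (N + 1)"
      proof
        assume "u \<in> wball (N + 1)"
        then have "i \<one>\<^bsub>K\<^esub> \<in> wball 1" using wball_mult[OF _ u(2)] u(3) by fastforce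
        then have "\<one>\<^bsub>K\<^esub> \<in> V.ball 1" using const_in_wball weights_ball by blast
        then show False by simp
      qed
      then show ?thesis using w_eqI[of u N] c ne u(1) by blast
    qed
    then have "w ` (carrier L - {\<zero>}) = UNIV" by (metis UNIV_eq_I imageI)
    then show "w \<in> epi (units_grp L) integer_group"
      using w_mult(2) by (simp add: epi_def hom_def)
    show "min (w x) (w y) \<le> w (x \<oplus> y)"
      if "x \<in> carrier L - {\<zero>}" "y \<in> carrier L - {\<zero>}" "x \<oplus> y \<noteq> \<zero>" for x y
    proof -
      have "x \<in> wball (min (w x) (w y))" "y \<in> wball (min (w x) (w y))" using wball_iff that by auto
      then have "x \<oplus> y \<in> wball (min (w x) (w y))" by (rule wball_add)
      then show ?thesis using wball_iff[of "x \<oplus> y"] that by simp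
    qed
  qed
qed

lemma w_embedding:
  assumes a: "a \<in> carrier K - {\<zero>\<^bsub>K\<^esub>}" shows "w (i a) = int e * v a"
proof -
  have m: "i a \<in> wball N \<longleftrightarrow> N \<le> int e * v a" for N
    using const_in_wball[of a N] a by (auto simp: weights_def)
  have "i a \<noteq> \<zero>" using m[of "int e * v a + 1"] wball_zero[of "int e * v a + 1"] by auto
  then show ?thesis using w_eqI[of "i a"] m a by simp
qed

end

section \<open>Totally ramified extensions\<close>

locale ramified_extension = V: discrete_valuation K v + embedded_field K L i + W: discrete_valuation L w
  for K :: "('a, 'm) ring_scheme" and v and L :: "('b, 'n) ring_scheme" (structure) and i and w +
  fixes e :: nat
  assumes e_pos: "0 < e" and w_i: "\<And>x. x \<in> carrier K - {\<zero>\<^bsub>K\<^esub>} \<Longrightarrow> w (i x) = int e * v x"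
    and dim_L: "dimension e (i ` carrier K) (carrier L)"
begin

lemma i_nonzero: assumes "a \<in> carrier K - {\<zero>\<^bsub>K\<^esub>}" shows "i a \<in> carrier L - {\<zero>}"
proof -
  have "i a \<otimes> i (inv\<^bsub>K\<^esub> a) = \<one>"
    using V.nonzero_r_inv[OF assms] V.nonzero_inv_closed[OF assms] assms emb.hom_mult[of a "inv\<^bsub>K\<^esub> a"] by simp
  then have "i a \<noteq> \<zero>" using V.nonzero_inv_closed[OF assms] by auto
  then show ?thesis using assms by simp
qed

lemma i_ball: assumes "a \<in> carrier K" shows "i a \<in> W.ball 0 \<longleftrightarrow> a \<in> V.ball 0" "i a \<in> W.ball 1 \<longleftrightarrow> a \<in> V.ball 1"
proof -
  have "0 \<le> int e * v a \<longleftrightarrow> 0 \<le> v a" "1 \<le> int e * v a \<longleftrightarrow> 1 \<le> v a"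
    using e_pos zero_less_mult_iff[of "int e" "v a"] zero_le_mult_iff[of "int e" "v a"]
    by (auto simp: int_one_le_iff_zero_less)
  moreover have "\<one>\<^bsub>K\<^esub> \<noteq> \<zero>\<^bsub>K\<^esub>" by simp
  ultimately show "i a \<in> W.ball 0 \<longleftrightarrow> a \<in> V.ball 0" "i a \<in> W.ball 1 \<longleftrightarrow> a \<in> V.ball 1"
    using w_i[of a] i_nonzero[of a] assms by (cases "a = \<zero>\<^bsub>K\<^esub>"; simp add: V.ball_iff W.ball_iff)+
qed

context
  fixes t assumes t: "t \<in> carrier L - {\<zero>}" and w_t: "w t = 1"
begin

lemma t_closed: "t \<in> carrier L" using t by simp

lemma monomial_nonzero: "a \<in> carrier K - {\<zero>\<^bsub>K\<^esub>} \<Longrightarrow> i a \<otimes> t [^] (n::nat) \<in> carrier L - {\<zero>}"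
  using W.nonzero_m_closed[OF i_nonzero W.nonzero_pow_closed[OF t]] .

lemma w_monomial: "a \<in> carrier K - {\<zero>\<^bsub>K\<^esub>} \<Longrightarrow> w (i a \<otimes> t [^] (n::nat)) = int e * v a + int n"
  using W.v_mult[OF i_nonzero W.nonzero_pow_closed[OF t]] w_i W.v_pow[OF t] w_t by simp

text \<open>The residue modulo e of the valuation of a combination is the exponent of its dominant
  monomial, hence below n. It thus differs from that of the next monomial, of exponent n, which
  drives the induction.\<close>

lemma w_Kspan: "\<lbrakk>n \<le> e; x \<in> Kspan t n; x \<noteq> \<zero>\<rbrakk> \<Longrightarrow> w x mod int e < int n"
proof (induction n arbitrary: x)
  case (Suc n)
  obtain a r where a: "a \<in> carrier K" and r: "r \<in> Kspan t n" and x: "x = i a \<otimes> t [^] n \<oplus> r"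
    using Suc.prems(2) by (rule tspan_SucE)
  have rc: "r \<in> carrier L" using tspan_closed[OF coeff_groups_all t_closed r] .
  have n: "n < e" using Suc.prems(1) by simp
  show ?case
  proof (cases "a = \<zero>\<^bsub>K\<^esub>")
    case True
    then have "x = r" using x rc t_closed by simp
    then show ?thesis using Suc.IH[of r] r Suc.prems by simp
  next
    case False
    then have a0: "a \<in> carrier K - {\<zero>\<^bsub>K\<^esub>}" using a by simp
    have wm: "w (i a \<otimes> t [^] n) mod int e = int n" using w_monomial[OF a0, of n] n by simp
    show ?thesis
    proof (cases "r = \<zero>")
      case True
      then show ?thesis using x wm a t_closed by simp
    next
      case False
      then have wr: "w r mod int e < int n" using Suc.IH[OF _ r] n by simp
      then have "w (i a \<otimes> t [^] n) \<noteq> w r" using wm by auto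
      then have "w x = min (w (i a \<otimes> t [^] n)) (w r)"
        unfolding x using W.v_add_distinct(2)[OF monomial_nonzero[OF a0]] False rc by simp
      then show ?thesis using wm wr by (auto simp: min_def)
    qed
  qed
qed simp

text \<open>\<open>w_Kspan\<close> separates the valuation of the top monomial from that of the
  remainder, so there is no cancellation. Independence, completeness and the residue field of L are
  all drawn from this.\<close>

lemma ball_parts:
  assumes n: "n < e" and a: "a \<in> carrier K" and r: "r \<in> Kspan t n" and s: "i a \<otimes> t [^] n \<oplus> r \<in> W.ball N"
  shows "i a \<otimes> t [^] n \<in> W.ball N" "r \<in> W.ball N"
proof -
  have rc: "r \<in> carrier L" using tspan_closed[OF coeff_groups_all t_closed r] .
  have "w (i a \<otimes> t [^] n) \<noteq> w r" if "i a \<otimes> t [^] n \<noteq> \<zero>" "r \<noteq> \<zero>"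
  proof -
    have "a \<in> carrier K - {\<zero>\<^bsub>K\<^esub>}" using a that(1) t_closed by auto
    then have "w (i a \<otimes> t [^] n) mod int e = int n" using w_monomial[of a n] n by simp
    moreover have "w r mod int e < int n" using w_Kspan[OF _ r that(2)] n by simp
    ultimately show ?thesis by auto
  qed
  then show "i a \<otimes> t [^] n \<in> W.ball N" "r \<in> W.ball N"
    using W.ball_sum_parts[OF _ rc _ s] a t_closed by auto
qed

lemma monomial_ball: "a \<in> carrier K \<Longrightarrow> i a \<otimes> t [^] (n::nat) \<in> W.ball (int e * N + int n) \<longleftrightarrow> a \<in> V.ball N"
  using w_monomial[of a n] monomial_nonzero[of a n] e_pos t_closed
  by (cases "a = \<zero>\<^bsub>K\<^esub>") (auto simp: W.ball_iff V.ball_iff)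

lemma indep_uniformiser: "indep_powers t e"
  unfolding indep_powers_def
proof (intro allI impI ballI)
  fix n a r assume h: "n < e" "a \<in> carrier K" "r \<in> Kspan t n" "i a \<otimes> t [^] n \<oplus> r = \<zero>"
  have "i a \<otimes> t [^] n \<in> W.ball (int N)" for N using ball_parts(1)[OF h(1-3)] h(4) by simp
  then have "i a \<otimes> t [^] n = \<zero>" by (rule W.ball_all_imp_zero)
  then show "a = \<zero>\<^bsub>K\<^esub>" using monomial_nonzero[of a n] h(2) by auto
qed

lemma basis_uniformiser: "power_basis t e"
  using power_basisI_dimension[OF t_closed _ e_pos indep_uniformiser dim_L] by simp

text \<open>Peeling off one coordinate at a time, \<open>ball_parts\<close> bounds the differences
  of coordinates by the differences of the sequence. The coordinates are then Cauchy in K, and their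
  limits are the coordinates of the limit.\<close>

lemma complete_L:
  assumes compl: "val_complete K v" shows "val_complete L w"
proof -
  define Cauchy where "Cauchy s \<longleftrightarrow> (\<forall>N. \<exists>k. \<forall>m\<ge>k. \<forall>n\<ge>k. s m \<ominus> s n \<in> W.ball N)" for s :: "nat \<Rightarrow> 'b"
  have *: "\<exists>l \<in> carrier L. \<forall>N. \<exists>k. \<forall>m\<ge>k. s m \<ominus> l \<in> W.ball N"
    if "n \<le> e" "\<And>k. s k \<in> Kspan t n" "Cauchy s" for n s
    using that
  proof (induction n arbitrary: s)
    case 0
    then show ?case by (intro bexI[of _ \<zero>]) (auto simp: a_minus_def)
  next
    case (Suc n)
    have n: "n < e" using Suc.prems(1) by simp
    have "\<exists>a r. a \<in> carrier K \<and> r \<in> Kspan t n \<and> s k = i a \<otimes> t [^] n \<oplus> r" for k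
      using Suc.prems(2)[of k] by (rule tspan_SucE) blast
    then obtain a r where a: "\<And>k. a k \<in> carrier K" and r: "\<And>k. r k \<in> Kspan t n"
      and s: "\<And>k. s k = i (a k) \<otimes> t [^] n \<oplus> r k"
      by metis
    have rc: "r k \<in> carrier L" for k using tspan_closed[OF coeff_groups_all t_closed r] .
    have tn: "t [^] n \<in> carrier L" using t_closed by simp
    have diff: "(i b \<otimes> t [^] n \<oplus> x) \<ominus> (i c \<otimes> t [^] n \<oplus> y) = i (b \<ominus>\<^bsub>K\<^esub> c) \<otimes> t [^] n \<oplus> (x \<ominus> y)"
      if "b \<in> carrier K" "c \<in> carrier K" "x \<in> carrier L" "y \<in> carrier L" for b c x y
    proof -
      have ic: "i b \<in> carrier L" "i c \<in> carrier L" using that by auto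
      have "i (b \<ominus>\<^bsub>K\<^esub> c) = i b \<ominus> i c" using that by (simp add: a_minus_def)
      moreover have "(i b \<otimes> t [^] n \<oplus> x) \<ominus> (i c \<otimes> t [^] n \<oplus> y) = (i b \<ominus> i c) \<otimes> t [^] n \<oplus> (x \<ominus> y)"
        using ic that tn by algebra
      ultimately show ?thesis by simp
    qed
    have parts: "i (a m \<ominus>\<^bsub>K\<^esub> a k) \<otimes> t [^] n \<in> W.ball N \<and> r m \<ominus> r k \<in> W.ball N"
      if "s m \<ominus> s k \<in> W.ball N" for m k N
      using ball_parts[OF n _ tspan_diff[OF coeff_groups_all t_closed r r], of "a m \<ominus>\<^bsub>K\<^esub> a k" m k N] that
        diff[of "a m" "a k" "r m" "r k"] a rc by (simp add: s)
    have "\<exists>k. \<forall>m\<ge>k. \<forall>l\<ge>k. a m \<ominus>\<^bsub>K\<^esub> a l \<in> V.ball N" for N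
    proof -
      obtain k where "\<forall>m\<ge>k. \<forall>l\<ge>k. s m \<ominus> s l \<in> W.ball (int e * N + int n)"
        using Suc.prems(3) unfolding Cauchy_def by blast
      then show ?thesis using parts monomial_ball[of "a _ \<ominus>\<^bsub>K\<^esub> a _" n N] a by (meson V.minus_closed)
    qed
    then obtain al where al: "al \<in> carrier K" "\<And>N. \<exists>k. \<forall>m\<ge>k. a m \<ominus>\<^bsub>K\<^esub> al \<in> V.ball N"
      using compl[unfolded val_complete_def, rule_format, of a] a by blast
    have "Cauchy r" unfolding Cauchy_def
    proof
      fix N
      obtain k where "\<forall>m\<ge>k. \<forall>l\<ge>k. s m \<ominus> s l \<in> W.ball N"
        using Suc.prems(3) unfolding Cauchy_def by blast
      then show "\<exists>k. \<forall>m\<ge>k. \<forall>l\<ge>k. r m \<ominus> r l \<in> W.ball N" using parts by blast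
    qed
    then have "\<exists>l \<in> carrier L. \<forall>N. \<exists>k. \<forall>m\<ge>k. r m \<ominus> l \<in> W.ball N"
      using Suc.IH[of r] r Suc.prems(1) by simp
    then obtain rl where rl: "rl \<in> carrier L" "\<And>N. \<exists>k. \<forall>m\<ge>k. r m \<ominus> rl \<in> W.ball N"
      by blast
    let ?l = "i al \<otimes> t [^] n \<oplus> rl"
    have "\<exists>k. \<forall>m\<ge>k. s m \<ominus> ?l \<in> W.ball N" for N
    proof -
      \<comment> \<open>The radius is raised to \<open>max 0 N\<close> because multiplication by e
        does not decrease a nonnegative integer but may decrease a negative one.\<close>
      obtain k1 where k1: "\<forall>m\<ge>k1. a m \<ominus>\<^bsub>K\<^esub> al \<in> V.ball (max 0 N)" using al(2) by blast
      obtain k2 where k2: "\<forall>m\<ge>k2. r m \<ominus> rl \<in> W.ball N" using rl(2) by blast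
      have "N \<le> max 0 N" by simp
      also have "\<dots> \<le> int e * max 0 N" using e_pos mult_right_mono[of 1 "int e" "max 0 N"] by simp
      finally have N: "N \<le> int e * max 0 N + int n" by simp
      have "s m \<ominus> ?l \<in> W.ball N" if m: "m \<ge> max k1 k2" for m
      proof -
        have "i (a m \<ominus>\<^bsub>K\<^esub> al) \<otimes> t [^] n \<in> W.ball N"
          using monomial_ball[of "a m \<ominus>\<^bsub>K\<^esub> al" n "max 0 N"] k1 m a al(1) W.ball_mono[OF _ N] by simp
        moreover have "r m \<ominus> rl \<in> W.ball N" using k2 m by simp
        ultimately show ?thesis using diff[of "a m" al "r m" rl] a al(1) rc rl(1) W.ball_add by (simp add: s)
      qed
      then show ?thesis by blast
    qed
    moreover have "?l \<in> carrier L" using al(1) rl(1) tn by simp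
    ultimately show ?case by blast
  qed
  have KL: "Kspan t e = carrier L" using basis_uniformiser by (simp add: power_basis_def)
  show ?thesis unfolding val_complete_def
  proof (intro allI impI, elim conjE)
    fix s :: "nat \<Rightarrow> 'b"
    assume s: "range s \<subseteq> carrier L" "\<forall>N. \<exists>k. \<forall>m\<ge>k. \<forall>n\<ge>k. s m \<ominus> s n \<in> W.ball N"
    show "\<exists>l\<in>carrier L. \<forall>N. \<exists>k. \<forall>n\<ge>k. s n \<ominus> l \<in> W.ball N"
      using *[OF order_refl, of s] s KL unfolding Cauchy_def by auto
  qed
qed

text \<open>A nonzero monomial \<open>b t^n\<close> with \<open>0 < n < e\<close> has valuation not
  divisible by e; if it lies in the valuation ring it lies in the maximal ideal. So only the
  constant term contributes to the residue.\<close>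

lemma residue_uniformiser:
  assumes "x \<in> W.ball 0" shows "\<exists>a \<in> V.ball 0. x \<ominus> i a \<in> W.ball 1"
proof -
  have "\<exists>a \<in> V.ball 0. x \<ominus> i a \<in> W.ball 1" if "0 < n" "n \<le> e" "x \<in> Kspan t n" "x \<in> W.ball 0" for n
    using that
  proof (induction n arbitrary: x)
    case (Suc n)
    have n: "n < e" using Suc.prems by simp
    obtain b r where b: "b \<in> carrier K" and r: "r \<in> Kspan t n" and x: "x = i b \<otimes> t [^] n \<oplus> r"
      using Suc.prems(3) by (rule tspan_SucE)
    have rc: "r \<in> carrier L" using tspan_closed[OF coeff_groups_all t_closed r] .
    have parts: "i b \<otimes> t [^] n \<in> W.ball 0" "r \<in> W.ball 0"
      using ball_parts[OF n b r, of 0] Suc.prems(4) x by auto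
    show ?case
    proof (cases "n = 0")
      case True
      then have "r = \<zero>" using r by simp
      then have xb: "x = i b" using x b True by simp
      then have "x \<ominus> i b = \<zero>" using b by (simp add: a_minus_def r_neg)
      moreover have "b \<in> V.ball 0" using i_ball(1)[OF b] xb Suc.prems(4) by simp
      ultimately show ?thesis using W.ball_zero[of 1] by metis
    next
      case False
      then obtain a where a: "a \<in> V.ball 0" "r \<ominus> i a \<in> W.ball 1"
        using Suc.IH[OF _ _ r parts(2)] n by auto
      have ac: "a \<in> carrier K" using V.ball_closed[OF a(1)] .
      have "i b \<otimes> t [^] n \<in> W.ball 1"
      proof (cases "b = \<zero>\<^bsub>K\<^esub>")
        case True then show ?thesis using t_closed by simp
      next
        case bne: False
        then have b0: "b \<in> carrier K - {\<zero>\<^bsub>K\<^esub>}" using b by simp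
        have "0 \<le> int e * v b + int n"
          using parts(1) W.ball_iff[OF monomial_nonzero[OF b0]] w_monomial[OF b0] by simp
        then have "int e * (-1) < int e * v b" using n by simp
        then have "-1 < v b" using e_pos by (simp only: mult_less_cancel_left_pos of_nat_0_less_iff)
        then have "0 \<le> int e * v b" by simp
        then show ?thesis using False W.ball_iff[OF monomial_nonzero[OF b0]] w_monomial[OF b0] by simp
      qed
      from W.ball_add[OF this a(2)] have "i b \<otimes> t [^] n \<oplus> (r \<ominus> i a) \<in> W.ball 1" .
      moreover have "i b \<otimes> t [^] n \<oplus> (r \<ominus> i a) = x \<ominus> i a"
        unfolding x using b rc ac t_closed by (simp add: a_minus_def a_ac)
      ultimately show ?thesis using a(1) by auto
    qed
  qed simp
  then show ?thesis using assms e_pos basis_uniformiser W.ball_closed[OF assms]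
    by (simp add: power_basis_def)
qed

end

lemma residue:
  assumes "x \<in> W.ball 0" shows "\<exists>a \<in> V.ball 0. x \<ominus> i a \<in> W.ball 1"
  using W.v_surj[of 1] residue_uniformiser[OF _ _ assms] by blast

lemma complete: "val_complete K v \<Longrightarrow> val_complete L w"
  using W.v_surj[of 1] complete_L by blast

lemma i_add_pow: "i ([(n::nat)] \<cdot>\<^bsub>K\<^esub> \<one>\<^bsub>K\<^esub>) = [n] \<cdot> \<one>"
  by (induction n) auto

text \<open>K and L have the same residue field, so the residue of u lifts to some a in K, and u
  divided by a is a 1-unit.\<close>

lemma unit_decomp:
  assumes u: "u \<in> carrier L - {\<zero>}" "w u = 0"
  obtains a where "a \<in> carrier K - {\<zero>\<^bsub>K\<^esub>}" "v a = 0" "u \<otimes> i (inv\<^bsub>K\<^esub> a) \<ominus> \<one> \<in> W.ball 1"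
proof -
  have "u \<in> W.ball 0" using W.ball_iff[OF u(1)] u(2) by simp
  then obtain a where a: "a \<in> V.ball 0" "u \<ominus> i a \<in> W.ball 1" using residue by blast
  have ac: "a \<in> carrier K" using V.ball_closed[OF a(1)] .
  have "i a \<noteq> \<zero>" "w (i a) = 0" using W.v_eq_of_close[OF u(1), of "i a"] a(2) u(2) ac by auto
  moreover from this have a0: "a \<in> carrier K - {\<zero>\<^bsub>K\<^esub>}" using ac by auto
  ultimately have va: "v a = 0" using w_i[OF a0] e_pos by simp
  have ia: "inv\<^bsub>K\<^esub> a \<in> carrier K - {\<zero>\<^bsub>K\<^esub>}" using V.nonzero_inv_closed[OF a0] .
  have c: "i a \<in> carrier L" "i (inv\<^bsub>K\<^esub> a) \<in> carrier L" "u \<in> carrier L" using ac ia u by auto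
  have "i a \<otimes> i (inv\<^bsub>K\<^esub> a) = \<one>"
    using V.nonzero_r_inv[OF a0] ia ac emb.hom_mult[of a "inv\<^bsub>K\<^esub> a"] by simp
  then have "u \<otimes> i (inv\<^bsub>K\<^esub> a) \<ominus> \<one> = i (inv\<^bsub>K\<^esub> a) \<otimes> (u \<ominus> i a)" using c by algebra
  moreover have "i (inv\<^bsub>K\<^esub> a) \<in> W.ball 0"
    using i_ball(1)[of "inv\<^bsub>K\<^esub> a"] V.ball_iff[OF ia] V.v_inv[OF a0] va ia by simp
  ultimately have "u \<otimes> i (inv\<^bsub>K\<^esub> a) \<ominus> \<one> \<in> W.ball 1" using W.ball_mult0[OF _ a(2)] by simp
  then show ?thesis using that a0 va by blast
qed

lemma pow_root_w:
  assumes s: "s \<in> carrier L" "s [^] e = i p" and p: "p \<in> carrier K - {\<zero>\<^bsub>K\<^esub>}" "v p = 1"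
  shows "s \<in> carrier L - {\<zero>}" "w s = 1"
proof -
  have "s \<noteq> \<zero>" using i_nonzero[OF p(1)] s e_pos by (cases e) auto
  then show s0: "s \<in> carrier L - {\<zero>}" using s by simp
  have "int e * w s = int e" using W.v_pow[OF s0, of e] w_i[OF p(1)] s(2) p(2) by simp
  then show "w s = 1" using e_pos by simp
qed

lemma exists_uniformiser_root:
  assumes compl: "val_complete K v" and e: "[e] \<cdot>\<^bsub>K\<^esub> \<one>\<^bsub>K\<^esub> \<noteq> \<zero>\<^bsub>K\<^esub>" "v ([e] \<cdot>\<^bsub>K\<^esub> \<one>\<^bsub>K\<^esub>) = 0"
  shows "\<exists>p s. p \<in> carrier K - {\<zero>\<^bsub>K\<^esub>} \<and> v p = 1 \<and> s \<in> carrier L \<and> s [^] e = i p"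
proof -
  obtain t where t: "t \<in> carrier L - {\<zero>}" "w t = 1" using W.v_surj by blast
  obtain q where q: "q \<in> carrier K - {\<zero>\<^bsub>K\<^esub>}" "v q = 1" using V.v_surj by blast
  have iq: "inv\<^bsub>K\<^esub> q \<in> carrier K - {\<zero>\<^bsub>K\<^esub>}" using V.nonzero_inv_closed[OF q(1)] .
  \<comment> \<open>Both \<open>t^e\<close> and the image of a uniformiser of K have valuation e in
    L, so their quotient is a unit.\<close>
  define u where "u = t [^] e \<otimes> i (inv\<^bsub>K\<^esub> q)"
  have u: "u \<in> carrier L - {\<zero>}"
    unfolding u_def using W.nonzero_m_closed[OF W.nonzero_pow_closed[OF t(1)] i_nonzero[OF iq]] .
  have wu: "w u = 0"
    unfolding u_def using W.v_mult[OF W.nonzero_pow_closed[OF t(1)] i_nonzero[OF iq]]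
      W.v_pow[OF t(1)] t(2) w_i[OF iq] V.v_inv[OF q(1)] q(2) by simp
  obtain a where a: "a \<in> carrier K - {\<zero>\<^bsub>K\<^esub>}" "v a = 0" "u \<otimes> i (inv\<^bsub>K\<^esub> a) \<ominus> \<one> \<in> W.ball 1"
    using unit_decomp[OF u wu] .
  have ia: "inv\<^bsub>K\<^esub> a \<in> carrier K - {\<zero>\<^bsub>K\<^esub>}" using V.nonzero_inv_closed[OF a(1)] .
  have eK: "[e] \<cdot>\<^bsub>K\<^esub> \<one>\<^bsub>K\<^esub> \<in> carrier K - {\<zero>\<^bsub>K\<^esub>}" using e by simp
  \<comment> \<open>The tameness condition transfers to L, since w is e times v on K.\<close>
  have "[e] \<cdot> \<one> \<noteq> \<zero>" "w ([e] \<cdot> \<one>) = 0"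
    using i_nonzero[OF eK] w_i[OF eK] e(2) by (auto simp: i_add_pow)
  then obtain y where y: "y \<in> carrier L - {\<zero>}" "y [^] e = u \<otimes> i (inv\<^bsub>K\<^esub> a)"
    using W.one_unit_root_exists[OF complete[OF compl] _ _ _ a(3)] u ia by auto
  have iy: "inv y \<in> carrier L - {\<zero>}" using W.nonzero_inv_closed[OF y(1)] .
  have one: "i q \<otimes> i (inv\<^bsub>K\<^esub> q) = \<one>" "i a \<otimes> i (inv\<^bsub>K\<^esub> a) = \<one>"
    using V.nonzero_r_inv[OF q(1)] V.nonzero_r_inv[OF a(1)] ia iq a q
      emb.hom_mult[of a "inv\<^bsub>K\<^esub> a"] emb.hom_mult[of q "inv\<^bsub>K\<^esub> q"] by simp_all
  have c: "t [^] e \<in> carrier L" "i q \<in> carrier L" "i (inv\<^bsub>K\<^esub> q) \<in> carrier L" "i a \<in> carrier L"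
    "i (inv\<^bsub>K\<^esub> a) \<in> carrier L" "y [^] e \<in> carrier L" "inv y [^] e \<in> carrier L"
    using t(1) q(1) iq a(1) ia y(1) iy by auto
  have yy: "y [^] e \<otimes> inv y [^] e = \<one>"
    using y(1) iy W.nonzero_r_inv[OF y(1)] by (simp add: nat_pow_distrib[symmetric])
  have "t [^] e = (i q \<otimes> i (inv\<^bsub>K\<^esub> q)) \<otimes> (i a \<otimes> i (inv\<^bsub>K\<^esub> a)) \<otimes> t [^] e"
    using c one by simp
  also have "\<dots> = (i a \<otimes> i q) \<otimes> y [^] e" unfolding y(2) u_def using c by algebra
  finally have te: "t [^] e = (i a \<otimes> i q) \<otimes> y [^] e" .
  have "(t \<otimes> inv y) [^] e = t [^] e \<otimes> inv y [^] e" using t iy by (simp add: nat_pow_distrib)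
  also have "\<dots> = (i a \<otimes> i q) \<otimes> (y [^] e \<otimes> inv y [^] e)" unfolding te using c by algebra
  also have "\<dots> = i (a \<otimes>\<^bsub>K\<^esub> q)" unfolding yy using a q by simp
  finally have "(t \<otimes> inv y) [^] e = i (a \<otimes>\<^bsub>K\<^esub> q)" .
  moreover have "a \<otimes>\<^bsub>K\<^esub> q \<in> carrier K - {\<zero>\<^bsub>K\<^esub>}" "v (a \<otimes>\<^bsub>K\<^esub> q) = 1"
    using V.nonzero_m_closed[OF a(1) q(1)] V.v_mult[OF a(1) q(1)] a(2) q(2) by auto
  moreover have "t \<otimes> inv y \<in> carrier L" using t iy by simp
  ultimately show ?thesis by blast
qed

text \<open>The quotient \<open>s/t\<close> need not lie in K. Its residue lifts to some a in K, and
  the e-th power b of the remaining 1-unit \<open>s/(t a)\<close> is the element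
  \<open>q/(p a^e)\<close> of K. Being a 1-unit there, b is \<open>y^e\<close> with y in K, and
  \<open>q = (a y)^e p\<close>.\<close>

lemma roots_differ_by_power:
  assumes compl: "val_complete K v" and e: "[e] \<cdot>\<^bsub>K\<^esub> \<one>\<^bsub>K\<^esub> \<noteq> \<zero>\<^bsub>K\<^esub>" "v ([e] \<cdot>\<^bsub>K\<^esub> \<one>\<^bsub>K\<^esub>) = 0"
    and t: "t \<in> carrier L" "t [^] e = i p" and p: "p \<in> carrier K - {\<zero>\<^bsub>K\<^esub>}" "v p = 1"
    and s: "s \<in> carrier L" "s [^] e = i q" and q: "q \<in> carrier K - {\<zero>\<^bsub>K\<^esub>}" "v q = 1"
  shows "\<exists>c \<in> carrier K - {\<zero>\<^bsub>K\<^esub>}. q = c [^]\<^bsub>K\<^esub> e \<otimes>\<^bsub>K\<^esub> p"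
proof -
  have t0: "t \<in> carrier L - {\<zero>}" "w t = 1" using pow_root_w[OF t p] by auto
  have s0: "s \<in> carrier L - {\<zero>}" "w s = 1" using pow_root_w[OF s q] by auto
  have it: "inv t \<in> carrier L - {\<zero>}" using W.nonzero_inv_closed[OF t0(1)] .
  define u where "u = s \<otimes> inv t"
  have u: "u \<in> carrier L - {\<zero>}" "w u = 0"
    unfolding u_def using W.nonzero_m_closed[OF s0(1) it] W.v_mult[OF s0(1) it] W.v_inv[OF t0(1)] t0 s0 by auto
  obtain a where a: "a \<in> carrier K - {\<zero>\<^bsub>K\<^esub>}" "v a = 0" "u \<otimes> i (inv\<^bsub>K\<^esub> a) \<ominus> \<one> \<in> W.ball 1"
    using unit_decomp[OF u] .
  have ia: "inv\<^bsub>K\<^esub> a \<in> carrier K - {\<zero>\<^bsub>K\<^esub>}" using V.nonzero_inv_closed[OF a(1)] .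
  have ip: "inv\<^bsub>K\<^esub> p \<in> carrier K - {\<zero>\<^bsub>K\<^esub>}" using V.nonzero_inv_closed[OF p(1)] .
  define b where "b = q \<otimes>\<^bsub>K\<^esub> inv\<^bsub>K\<^esub> p \<otimes>\<^bsub>K\<^esub> (inv\<^bsub>K\<^esub> a) [^]\<^bsub>K\<^esub> e"
  have bc: "b \<in> carrier K" using q ip ia by (simp add: b_def)
  have "i p \<otimes> inv t [^] e = \<one>"
    unfolding t(2)[symmetric] using t(1) it W.nonzero_r_inv[OF t0(1)] by (simp add: nat_pow_distrib[symmetric])
  moreover have "i (inv\<^bsub>K\<^esub> p) \<otimes> i p = \<one>"
    using V.nonzero_l_inv[OF p(1)] p ip emb.hom_mult[of "inv\<^bsub>K\<^esub> p" p] by simp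
  ultimately have itp: "inv t [^] e = i (inv\<^bsub>K\<^esub> p)"
    using p ip it by (metis DiffD1 emb.hom_closed inv_unique' m_comm nat_pow_closed comm_inv_char)
  have "(u \<otimes> i (inv\<^bsub>K\<^esub> a)) [^] e = s [^] e \<otimes> inv t [^] e \<otimes> i (inv\<^bsub>K\<^esub> a) [^] e"
    using s it ia by (simp add: u_def nat_pow_distrib)
  also have "\<dots> = i b" unfolding itp s(2) b_def using q ip ia by simp
  finally have ub: "(u \<otimes> i (inv\<^bsub>K\<^esub> a)) [^] e = i b" .
  have "(u \<otimes> i (inv\<^bsub>K\<^esub> a)) [^] e \<ominus> \<one> \<in> W.ball 1"
    using W.one_unit_pow[OF _ a(3)] u ia by simp
  then have "i (b \<ominus>\<^bsub>K\<^esub> \<one>\<^bsub>K\<^esub>) \<in> W.ball 1" unfolding ub using bc by (simp add: a_minus_def)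
  then have "b \<ominus>\<^bsub>K\<^esub> \<one>\<^bsub>K\<^esub> \<in> V.ball 1" using i_ball(2)[of "b \<ominus>\<^bsub>K\<^esub> \<one>\<^bsub>K\<^esub>"] bc by simp
  then obtain y where y: "y \<in> carrier K - {\<zero>\<^bsub>K\<^esub>}" "y [^]\<^bsub>K\<^esub> e = b"
    using V.one_unit_root_exists[OF compl e bc] by blast
  have "(a \<otimes>\<^bsub>K\<^esub> y) [^]\<^bsub>K\<^esub> e \<otimes>\<^bsub>K\<^esub> p = a [^]\<^bsub>K\<^esub> e \<otimes>\<^bsub>K\<^esub> b \<otimes>\<^bsub>K\<^esub> p"
    using a y by (simp add: V.nat_pow_distrib)
  also have "\<dots> = q \<otimes>\<^bsub>K\<^esub> (inv\<^bsub>K\<^esub> p \<otimes>\<^bsub>K\<^esub> p) \<otimes>\<^bsub>K\<^esub> (a [^]\<^bsub>K\<^esub> e \<otimes>\<^bsub>K\<^esub> (inv\<^bsub>K\<^esub> a) [^]\<^bsub>K\<^esub> e)"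
    unfolding b_def using a p q ia ip by (simp add: V.m_ac)
  also have "a [^]\<^bsub>K\<^esub> e \<otimes>\<^bsub>K\<^esub> (inv\<^bsub>K\<^esub> a) [^]\<^bsub>K\<^esub> e = \<one>\<^bsub>K\<^esub>"
    using a(1) ia V.nonzero_r_inv[OF a(1)] by (simp add: V.nat_pow_distrib[symmetric])
  also have "q \<otimes>\<^bsub>K\<^esub> (inv\<^bsub>K\<^esub> p \<otimes>\<^bsub>K\<^esub> p) \<otimes>\<^bsub>K\<^esub> \<one>\<^bsub>K\<^esub> = q"
    using V.nonzero_l_inv[OF p(1)] q by simp
  finally show ?thesis using V.nonzero_m_closed[OF a(1) y(1)] by metis
qed

end

section \<open>Separability\<close>

lemma (in ring) finite_dimension_over_larger_subfield:
  assumes k: "subfield k R" and F: "subfield F R" and kF: "k \<subseteq> F" and fd: "finite_dimension k (carrier R)"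
  shows "finite_dimension F (carrier R)"
proof -
  obtain n where "dimension n k (carrier R)" using fd by blast
  then obtain Us where Us: "set Us \<subseteq> carrier R" "Span k Us = carrier R"
    using exists_base[OF k] by blast
  have "Span k Us \<subseteq> Span F Us"
    unfolding Span_eq_combine_set[OF k Us(1)] Span_eq_combine_set[OF F Us(1)] using kF by blast
  then have "Span F Us = carrier R" using Us Span_subgroup_props(1)[OF F Us(1)] by auto
  then show ?thesis using Span_finite_dimension[OF F Us(1)] by simp
qed

text \<open>Multiplicativity of degrees in the tower formed by k, the simple extension by x, and
  R.\<close>

lemma (in domain) degree_Irr_dvd_dimension:
  assumes k: "subfield k R" and d: "dimension e k (carrier R)" and x: "x \<in> carrier R"
  shows "degree (Irr k x) dvd e"
proof -
  have fd: "finite_dimension k (carrier R)" using finite_dimensionI[OF d] .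
  have alg: "(algebraic over k) x" using finite_dimension_imp_algebraic[OF k carrier_is_subring fd x] .
  let ?F = "simple_extension k x"
  have F: "subfield ?F R" using simple_extension_is_subfield[OF k x] alg by simp
  have kF: "k \<subseteq> ?F" using simple_extension_incl[OF subfieldE(3)[OF k] x] .
  have "finite_dimension ?F (carrier R)"
    using finite_dimension_over_larger_subfield[OF k F kF fd] .
  then obtain m where "dimension m ?F (carrier R)" by blast
  then have "dimension (degree (Irr k x) * m) k (carrier R)"
    using telescopic_base[OF k F dimension_simple_extension[OF k x alg]] by simp
  then have "degree (Irr k x) * m = e" using dimension_is_inj[OF k] d by blast
  then show ?thesis by auto
qed

text \<open>Polynomials of degree below that of f represent distinct classes modulo f, so g has a
  nonzero class in the field \<open>k[X]/(f)\<close>. Lifting the inverse of that class gives the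
  Bezout relation.\<close>

lemma (in domain) irreducible_coprime_lower_degree:
  assumes k: "subfield k R" and f: "f \<in> carrier (k[X])" "pirreducible k f"
    and g: "g \<in> carrier (k[X])" "g \<noteq> []" "length g \<le> degree f"
  shows "\<exists>a \<in> carrier (k[X]). \<exists>b \<in> carrier (k[X]).
           (a \<otimes>\<^bsub>k[X]\<^esub> f) \<oplus>\<^bsub>k[X]\<^esub> (b \<otimes>\<^bsub>k[X]\<^esub> g) = \<one>\<^bsub>k[X]\<^esub>"
proof -
  let ?h = "rupture_surj k f"
  note sr = subfieldE(1)[OF k]
  interpret UP: domain "k[X]" using univ_poly_is_domain[OF sr] .
  interpret Q: field "Rupt k f" using rupture_is_field_iff_pirreducible[OF k f(1)] f(2) by simp
  interpret H: ring_hom_ring "k[X]" "Rupt k f" ?h using rupture_surj_hom(2)[OF sr f(1)] .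
  have fn: "f \<noteq> []" using g by auto
  have inj: "inj_on ?h {q \<in> carrier (k[X]). length q \<le> degree f}"
    using rupture_surj_inj_on[OF k f(1)] pmod_image_characterization[OF k f(1) fn] by simp
  have "?h g \<noteq> ?h []"
  proof
    assume "?h g = ?h []"
    then have "g = []" by (rule inj_onD[OF inj]) (use g univ_poly_zero_closed in auto)
    then show False using g(2) by simp
  qed
  then have hg: "?h g \<noteq> \<zero>\<^bsub>Rupt k f\<^esub>" using H.hom_zero by (simp add: univ_poly_zero)
  then have "?h g \<in> Units (Rupt k f)" using g(1) Q.field_Units by simp
  then obtain b' where b': "b' \<in> carrier (Rupt k f)" "b' \<otimes>\<^bsub>Rupt k f\<^esub> ?h g = \<one>\<^bsub>Rupt k f\<^esub>"
    by (auto simp: Units_def)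
  obtain b where b: "b \<in> carrier (k[X])" "b' = ?h b"
    using b'(1) rupture_carrier_as_pmod_image[OF k f(1)] long_division_closed(2)[OF k _ f(1)] by blast
  have "?h (b \<otimes>\<^bsub>k[X]\<^esub> g) = ?h \<one>\<^bsub>k[X]\<^esub>" using b'(2) b g(1) by simp
  then have "\<one>\<^bsub>k[X]\<^esub> \<ominus>\<^bsub>k[X]\<^esub> (b \<otimes>\<^bsub>k[X]\<^esub> g) \<in> PIdl\<^bsub>k[X]\<^esub> f"
    using UP.quotient_eq_iff_same_a_r_cos[OF UP.cgenideal_ideal[OF f(1)], of "\<one>\<^bsub>k[X]\<^esub>" "b \<otimes>\<^bsub>k[X]\<^esub> g"] b g(1) by simp
  then obtain a where a: "a \<in> carrier (k[X])" "\<one>\<^bsub>k[X]\<^esub> \<ominus>\<^bsub>k[X]\<^esub> (b \<otimes>\<^bsub>k[X]\<^esub> g) = a \<otimes>\<^bsub>k[X]\<^esub> f"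
    by (auto simp: cgenideal_def)
  have c: "b \<otimes>\<^bsub>k[X]\<^esub> g \<in> carrier (k[X])" using b g by simp
  have "(\<one>\<^bsub>k[X]\<^esub> \<ominus>\<^bsub>k[X]\<^esub> (b \<otimes>\<^bsub>k[X]\<^esub> g)) \<oplus>\<^bsub>k[X]\<^esub> (b \<otimes>\<^bsub>k[X]\<^esub> g) = \<one>\<^bsub>k[X]\<^esub>"
    using c UP.one_closed by algebra
  then show ?thesis using a b(1) by auto
qed

lemma (in ring) subfield_add_pow_closed:
  assumes "subfield k R" "x \<in> k" shows "[(n::nat)] \<cdot> x \<in> k"
proof (induction n)
  case 0 then show ?case using subringE(2)[OF subfieldE(1)[OF assms(1)]] by simp
next
  case (Suc n) then show ?case using subringE(7)[OF subfieldE(1)[OF assms(1)]] assms(2) by simp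
qed

text \<open>The degree n of the minimal polynomial divides e, so the leading coefficient n of its derivative
  does not vanish.\<close>

lemma (in domain) separable_of_degree_unit:
  assumes k: "subfield k R" and d: "dimension e k (carrier R)"
    and e: "[e] \<cdot> \<one> \<noteq> \<zero>" and x: "x \<in> carrier R"
  shows "separable_over k x"
proof -
  have alg: "(algebraic over k) x"
    using finite_dimension_imp_algebraic[OF k carrier_is_subring finite_dimensionI[OF d] x] .
  let ?f = "Irr k x" and ?g = "poly_derivative (Irr k x)"
  define n where "n = degree ?f"
  note f = IrrE[OF k x alg]
  have n1: "1 \<le> n" unfolding n_def using pirreducible_degree[OF k f(1,2)] .
  obtain m where m: "e = n * m" using degree_Irr_dvd_dimension[OF k d x] unfolding n_def by blast
  have n0: "[n] \<cdot> \<one> \<noteq> \<zero>"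
  proof
    assume "[n] \<cdot> \<one> = \<zero>"
    then have "[e] \<cdot> \<one> = \<zero>" unfolding m using add.nat_pow_pow[of \<one> m n] by simp
    then show False using e by simp
  qed
  have fne: "?f \<noteq> []" using n1 unfolding n_def by auto
  have f0: "?f ! 0 = \<one>" using f(3) fne by (simp add: hd_conv_nth)
  have fk: "set ?f \<subseteq> k" using f(1) unfolding univ_poly_carrier[symmetric] polynomial_def by auto
  let ?l = "map (\<lambda>j. [(n - j)] \<cdot> (?f ! j)) [0..<n]"
  have lk: "set ?l \<subseteq> k"
  proof
    fix y assume "y \<in> set ?l"
    then obtain j where j: "j < n" "y = [(n - j)] \<cdot> (?f ! j)" by auto
    then have "j < length ?f" unfolding n_def by simp
    then have "?f ! j \<in> k" using fk nth_mem by blast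
    then show "y \<in> k" using subfield_add_pow_closed[OF k] j by simp
  qed
  have lne: "?l \<noteq> []" using n1 by simp
  \<comment> \<open>The head is n times the leading coefficient 1 of the minimal polynomial. As it
    is nonzero, normalising the derivative strips nothing.\<close>
  have "lead_coeff ?l \<noteq> \<zero>" using n1 n0 f0 by (simp add: hd_map upt_conv_Cons)
  then have lp: "polynomial k ?l" using lk lne by (auto simp: polynomial_def)
  have g: "?g = ?l" unfolding poly_derivative_def n_def[symmetric] using normalize_polynomial[OF lp] .
  have "\<exists>a \<in> carrier (k[X]). \<exists>b \<in> carrier (k[X]).
           (a \<otimes>\<^bsub>k[X]\<^esub> ?f) \<oplus>\<^bsub>k[X]\<^esub> (b \<otimes>\<^bsub>k[X]\<^esub> ?g) = \<one>\<^bsub>k[X]\<^esub>"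
    unfolding g by (rule irreducible_coprime_lower_degree[OF k f(1,2)])
      (use lp lne in \<open>auto simp: univ_poly_carrier n_def\<close>)
  then show ?thesis using alg by (simp add: separable_over_def separable_poly_def)
qed

section \<open>The residue field and classes of units\<close>

lemma (in group) rcos_eq_iff:
  assumes "subgroup H G" "x \<in> carrier G" "y \<in> carrier G"
  shows "H #> x = H #> y \<longleftrightarrow> x \<otimes> inv y \<in> H"
proof
  assume "H #> x = H #> y"
  then have "x \<in> H #> y" using rcos_self[OF assms(2,1)] by simp
  then obtain h where h: "h \<in> H" "x = h \<otimes> y" by (auto simp: r_coset_def)
  have "h \<in> carrier G" using subgroup.mem_carrier[OF assms(1) h(1)] .
  then have "x \<otimes> inv y = h" using h(2) assms(3) by (simp add: m_assoc)
  then show "x \<otimes> inv y \<in> H" using h by simp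
next
  assume h: "x \<otimes> inv y \<in> H"
  have "(x \<otimes> inv y) \<otimes> y = x" using assms(2,3) by (simp add: m_assoc)
  then have "x \<in> H #> y" using h unfolding r_coset_def by force
  then show "H #> x = H #> y" using repr_independence[OF _ assms(3,1)] by metis
qed

text \<open>Sending \<open>f x\<close> to \<open>g x\<close> is well defined and injective because
  the two maps have the same fibres. This compares lines with classes of uniformisers, and classes
  in K with classes in the residue field.\<close>

lemma card_image_eq_if_same_kernel:
  assumes "\<And>x y. \<lbrakk>x \<in> U; y \<in> U\<rbrakk> \<Longrightarrow> f x = f y \<longleftrightarrow> g x = g y"
  shows "card (f ` U) = card (g ` U)"
proof -
  define h where "h z = g (inv_into U f z)" for z
  have h: "h (f x) = g x" if "x \<in> U" for x
    unfolding h_def using assms[of "inv_into U f (f x)" x] that inv_into_into[of "f x" f U] f_inv_into_f[of "f x" f U] by auto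
  have "bij_betw h (f ` U) (g ` U)"
    unfolding bij_betw_def inj_on_def using h assms by (force simp: image_image)
  then show ?thesis by (rule bij_betw_same_card)
qed

lemma (in field) field_comm_group: "comm_group (units_grp R)"
  using units_comm_group mult_of_is_Units by simp

lemma (in field) powers_subgroup: "subgroup (powers R e) (units_grp R)"
proof -
  interpret G: comm_group "units_grp R" by (rule field_comm_group)
  have eq: "powers R e = (\<lambda>x. x [^]\<^bsub>units_grp R\<^esub> e) ` carrier (units_grp R)"
    by (simp add: powers_def Multiplicative_Group.nat_pow_mult_of)
  show ?thesis
  proof (rule G.subgroupI)
    show "powers R e \<subseteq> carrier (units_grp R)" unfolding eq by (auto simp del: Multiplicative_Group.carrier_mult_of)
    show "powers R e \<noteq> {}" unfolding eq using G.one_closed by blast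
    fix a assume "a \<in> powers R e"
    then obtain x where x: "x \<in> carrier (units_grp R)" "a = x [^]\<^bsub>units_grp R\<^esub> e" unfolding eq by blast
    then have "inv\<^bsub>units_grp R\<^esub> a = (inv\<^bsub>units_grp R\<^esub> x) [^]\<^bsub>units_grp R\<^esub> e"
      by (simp add: G.nat_pow_inv del: Multiplicative_Group.carrier_mult_of)
    then show "inv\<^bsub>units_grp R\<^esub> a \<in> powers R e" unfolding eq using G.inv_closed[OF x(1)] by blast
    fix b assume "b \<in> powers R e"
    then obtain y where y: "y \<in> carrier (units_grp R)" "b = y [^]\<^bsub>units_grp R\<^esub> e" unfolding eq by blast
    have "a \<otimes>\<^bsub>units_grp R\<^esub> b = (x \<otimes>\<^bsub>units_grp R\<^esub> y) [^]\<^bsub>units_grp R\<^esub> e"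
      using x y G.nat_pow_distrib by (simp del: Multiplicative_Group.carrier_mult_of Multiplicative_Group.mult_mult_of)
    then show "a \<otimes>\<^bsub>units_grp R\<^esub> b \<in> powers R e" unfolding eq using G.m_closed[OF x(1) y(1)] by blast
  qed
qed

text \<open>The unit group is cyclic of order N with generator a; the e-th powers are generated by
  \<open>a^e\<close>, of order \<open>N div gcd N e\<close>, and Lagrange's theorem gives the
  index.\<close>

lemma (in field) card_power_cosets:
  assumes fin: "finite (carrier R)"
  shows "card (rcosets\<^bsub>units_grp R\<^esub> (powers R e)) = gcd (order R - 1) e"
proof -
  interpret G: comm_group "units_grp R" by (rule field_comm_group)
  have finG: "finite (carrier (units_grp R))" using finite_mult_of[OF fin] .
  define N where "N = order R - 1"
  have oG: "order (units_grp R) = N" using order_mult_of[OF fin] by (simp add: N_def)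
  have Npos: "0 < N" using G.order_gt_0_iff_finite finG oG by simp
  have gen: "card {a [^]\<^bsub>units_grp R\<^esub> k | k. k \<in> (UNIV :: nat set)} = G.ord a"
    if a: "a \<in> carrier (units_grp R)" for a
    using G.generate_pow_card[OF a] G.generate_pow_nat[OF a] G.ord_ge_1[OF finG a] by simp
  obtain a where a: "a \<in> carrier (units_grp R)" "carrier (units_grp R) = {a [^]\<^bsub>units_grp R\<^esub> k | k. k \<in> (UNIV :: nat set)}"
    using finite_field_mult_group_has_gen[OF fin] unfolding Multiplicative_Group.nat_pow_mult_of by blast
  have oa: "G.ord a = N" using gen[OF a(1)] a(2) oG by (simp add: order_def)
  have ae: "a [^]\<^bsub>units_grp R\<^esub> e \<in> carrier (units_grp R)" using a(1) by (rule G.nat_pow_closed)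
  have "powers R e = {(a [^]\<^bsub>units_grp R\<^esub> e) [^]\<^bsub>units_grp R\<^esub> k | k. k \<in> (UNIV :: nat set)}"
  proof -
    have "powers R e = {(a [^]\<^bsub>units_grp R\<^esub> k) [^]\<^bsub>units_grp R\<^esub> e | k. k \<in> (UNIV :: nat set)}"
      unfolding powers_def Multiplicative_Group.nat_pow_mult_of[symmetric] a(2) by blast
    moreover have "(a [^]\<^bsub>units_grp R\<^esub> k) [^]\<^bsub>units_grp R\<^esub> e = (a [^]\<^bsub>units_grp R\<^esub> e) [^]\<^bsub>units_grp R\<^esub> k" for k :: nat
      using G.nat_pow_pow[OF a(1)] by (simp add: mult.commute)
    ultimately show ?thesis by simp
  qed
  then have cP: "card (powers R e) = (if e = 0 then 1 else N div gcd N e)"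
    using gen[OF ae] G.ord_pow_gen[OF a(1), of e] oa by simp
  \<comment> \<open>For \<open>e = 0\<close> the two cases agree, because \<open>gcd N 0\<close> is
    N and N is positive.\<close>
  then have cP': "card (powers R e) = N div gcd N e" using Npos by simp
  have "card (rcosets\<^bsub>units_grp R\<^esub> (powers R e)) * card (powers R e) = N"
    using G.lagrange[OF powers_subgroup] oG by simp
  also have "N = gcd N e * (N div gcd N e)" by simp
  finally have "card (rcosets\<^bsub>units_grp R\<^esub> (powers R e)) * (N div gcd N e) = gcd N e * (N div gcd N e)"
    unfolding cP' .
  moreover have "0 < N div gcd N e" using Npos by (simp add: div_greater_zero_iff gcd_le1_nat)
  ultimately have "card (rcosets\<^bsub>units_grp R\<^esub> (powers R e)) = gcd N e"
    by (metis mult_cancel2 less_irrefl)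
  then show ?thesis by (simp add: N_def)
qed

section \<open>Reduction from units of K to the residue field\<close>

context discrete_valuation
begin

abbreviation val_ring :: "('a, 'm) ring_scheme" where
  "val_ring \<equiv> K\<lparr>carrier := ball 0\<rparr>"

definition res :: "'a \<Rightarrow> 'a set" where
  "res x = ball 1 +>\<^bsub>val_ring\<^esub> x"

lemma val_ring_subring: "subring (ball 0) K"
  by (rule subringI) (auto intro: ball_closed ball_neg ball_add ball_mult0)

lemma val_ring_domain: "domain val_ring"
  using subring_is_domain[OF val_ring_subring] .

text \<open>Additive inverses are defined relative to the carrier, so restricting the carrier to
  \<open>ball 0\<close> changes the constant, and the two have to be identified.\<close>

lemma val_ring_minus: "\<lbrakk>x \<in> ball 0; y \<in> ball 0\<rbrakk> \<Longrightarrow> x \<ominus>\<^bsub>val_ring\<^esub> y = x \<ominus> y"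
proof -
  assume x: "x \<in> ball 0" and y: "y \<in> ball 0"
  interpret D: domain val_ring by (rule val_ring_domain)
  have "\<ominus> y \<in> carrier val_ring" using ball_neg[OF y] by simp
  moreover have "\<ominus> y \<oplus>\<^bsub>val_ring\<^esub> y = \<zero>\<^bsub>val_ring\<^esub>" using ball_closed[OF y] by (simp add: l_neg)
  ultimately have "\<ominus>\<^bsub>val_ring\<^esub> y = \<ominus> y" using D.minus_equality y by simp
  then show ?thesis by (simp add: a_minus_def)
qed

text \<open>An element of the valuation ring outside \<open>ball 1\<close> has valuation 0, so its
  inverse is again in the ring. An ideal containing such an element contains 1.\<close>

lemma max_ideal: "maximalideal (ball 1) val_ring"
proof -
  interpret D: domain val_ring by (rule val_ring_domain)
  have id: "ideal (ball 1) val_ring"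
  proof (rule idealI[OF D.ring_axioms])
    show "subgroup (ball 1) (add_monoid val_ring)"
    proof (rule group.subgroupI[OF D.a_group])
      show "ball 1 \<subseteq> carrier (add_monoid val_ring)" using ball_mono[of _ 1 0] by auto
      show "ball 1 \<noteq> {}" using ball_zero by blast
      fix a assume a: "a \<in> ball 1"
      then have "a \<in> ball 0" using ball_mono[of a 1 0] by simp
      then have "\<ominus>\<^bsub>val_ring\<^esub> a = \<ominus> a"
        using val_ring_minus[of \<zero> a] ball_neg[of a 0] ball_closed[of a 0] D.minus_eq[of "\<zero>\<^bsub>val_ring\<^esub>" a] D.a_inv_closed[of a]
          D.l_zero[of "\<ominus>\<^bsub>val_ring\<^esub> a"]
        by (simp add: a_minus_def)
      then show "inv\<^bsub>add_monoid val_ring\<^esub> a \<in> ball 1" using ball_neg[OF a] by (simp add: a_inv_def)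
      show "a \<otimes>\<^bsub>add_monoid val_ring\<^esub> b \<in> ball 1" if "b \<in> ball 1" for b using ball_add[OF a that] by simp
    qed
    show "x \<otimes>\<^bsub>val_ring\<^esub> a \<in> ball 1" if "a \<in> ball 1" "x \<in> carrier val_ring" for a x
      using ball_mult0[of x a 1] that by simp
    show "a \<otimes>\<^bsub>val_ring\<^esub> x \<in> ball 1" if "a \<in> ball 1" "x \<in> carrier val_ring" for a x
      using ball_mult0[of x a 1] that ball_closed m_comm[of a x] by simp
  qed
  show ?thesis
  proof (rule maximalidealI[OF id])
    have "\<one> \<notin> ball 1" "\<one> \<in> ball 0" by simp_all
    then have "ball 0 \<noteq> ball 1" by blast
    then show "carrier val_ring \<noteq> ball 1" by simp
    fix J assume J: "ideal J val_ring" "ball 1 \<subseteq> J" "J \<subseteq> carrier val_ring"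
    show "J = ball 1 \<or> J = carrier val_ring"
    proof (cases "J \<subseteq> ball 1")
      case False
      then obtain x where x: "x \<in> J" "x \<notin> ball 1" by blast
      then have xb: "x \<in> ball 0" using J(3) by auto
      have x0: "x \<in> carrier K - {\<zero>}" using x(2) ball_closed[OF xb] by auto
      then have "v x = 0" using x(2) xb ball_iff by fastforce
      then have ix: "inv x \<in> ball 0" using ball_iff[OF nonzero_inv_closed[OF x0]] v_inv[OF x0] by simp
      have "inv x \<otimes>\<^bsub>val_ring\<^esub> x \<in> J" using ideal.I_l_closed[OF J(1) x(1)] ix by simp
      then have "\<one>\<^bsub>val_ring\<^esub> \<in> J" using nonzero_l_inv[OF x0] by simp
      then show ?thesis using ideal.one_imp_carrier[OF J(1)] by blast
    qed (use J in blast)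
  qed
qed

lemma residue_field_field: "field (residue_field K v)"
proof -
  interpret D: domain val_ring by (rule val_ring_domain)
  show ?thesis unfolding residue_field_def
    using maximalideal.quotient_is_field[OF max_ideal] D.cring_axioms by blast
qed

lemma res_hom: "ring_hom_ring val_ring (residue_field K v) res"
proof -
  interpret M: maximalideal "ball 1" val_ring by (rule max_ideal)
  show ?thesis using M.rcos_ring_hom_ring unfolding residue_field_def res_def[abs_def] .
qed

lemma res_surj: "carrier (residue_field K v) = res ` ball 0"
  unfolding residue_field_def FactRing_def A_RCOSETS_def' res_def by auto

lemma res_eq_iff: "\<lbrakk>x \<in> ball 0; y \<in> ball 0\<rbrakk> \<Longrightarrow> res x = res y \<longleftrightarrow> x \<ominus> y \<in> ball 1"
proof -
  assume a: "x \<in> ball 0" "y \<in> ball 0"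
  interpret D: domain val_ring by (rule val_ring_domain)
  interpret M: maximalideal "ball 1" val_ring by (rule max_ideal)
  show ?thesis unfolding res_def
    using D.quotient_eq_iff_same_a_r_cos[OF M.ideal_axioms, of x y] a val_ring_minus by simp
qed

lemma res_zero_iff: "x \<in> ball 0 \<Longrightarrow> res x = \<zero>\<^bsub>residue_field K v\<^esub> \<longleftrightarrow> x \<in> ball 1"
proof -
  assume a: "x \<in> ball 0"
  interpret H: ring_hom_ring val_ring "residue_field K v" res by (rule res_hom)
  have "res \<zero> = \<zero>\<^bsub>residue_field K v\<^esub>" using H.hom_zero by simp
  then show ?thesis using res_eq_iff[OF a, of \<zero>] ball_closed[OF a] by (simp add: a_minus_def)
qed

text \<open>The characteristic is the additive order of 1 in the residue field, so e times 1 is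
  nonzero there and its preimage in K lies outside the maximal ideal. This turns the hypothesis on e
  into a statement about valuations.\<close>

lemma degree_unit:
  assumes "e mod ring_characteristic (residue_field K v) \<noteq> 0"
  shows "[(e::nat)] \<cdot> \<one> \<noteq> \<zero>" "v ([e] \<cdot> \<one>) = 0"
proof -
  interpret k: field "residue_field K v" by (rule residue_field_field)
  interpret H: ring_hom_ring val_ring "residue_field K v" res by (rule res_hom)
  have r: "res ([n] \<cdot> \<one>) = [n] \<cdot>\<^bsub>residue_field K v\<^esub> \<one>\<^bsub>residue_field K v\<^esub>" for n :: nat
  proof (induction n)
    case 0 then show ?case using H.hom_zero by simp
  next
    case (Suc n)
    have "res ([n] \<cdot> \<one> \<oplus> \<one>) = res ([n] \<cdot> \<one>) \<oplus>\<^bsub>residue_field K v\<^esub> res \<one>"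
      using H.hom_add[of "[n] \<cdot> \<one>" \<one>] add_pow_one_ball by simp
    then show ?case using Suc H.hom_one by simp
  qed
  have "[e] \<cdot>\<^bsub>residue_field K v\<^esub> \<one>\<^bsub>residue_field K v\<^esub> \<noteq> \<zero>\<^bsub>residue_field K v\<^esub>"
  proof
    assume "[e] \<cdot>\<^bsub>residue_field K v\<^esub> \<one>\<^bsub>residue_field K v\<^esub> = \<zero>\<^bsub>residue_field K v\<^esub>"
    then have "ring_characteristic (residue_field K v) dvd e"
      unfolding ring_characteristic_def using k.add.pow_eq_id[of "\<one>\<^bsub>residue_field K v\<^esub>" e] by simp
    then show False using assms by simp
  qed
  then have n1: "[e] \<cdot> \<one> \<notin> ball 1" using res_zero_iff[OF add_pow_one_ball] r by simp
  then show ne: "[e] \<cdot> \<one> \<noteq> \<zero>" by auto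
  then show "v ([e] \<cdot> \<one>) = 0"
    using n1 add_pow_one_ball[of e] ball_iff[of "[e] \<cdot> \<one>"] by fastforce
qed

lemma res_unit: "\<lbrakk>x \<in> carrier K - {\<zero>}; v x = 0\<rbrakk> \<Longrightarrow> x \<in> ball 0 \<and> res x \<in> carrier (units_grp (residue_field K v))"
  using ball_iff[of x 0] ball_iff[of x 1] res_zero_iff[of x] res_surj by auto

lemma res_pow:
  assumes x: "x \<in> ball 0" shows "res (x [^] (n::nat)) = res x [^]\<^bsub>residue_field K v\<^esub> n"
proof -
  interpret H: ring_hom_ring val_ring "residue_field K v" res by (rule res_hom)
  show ?thesis
  proof (induction n)
    case 0 then show ?case using H.hom_one by simp
  next
    case (Suc n)
    then show ?case using H.hom_mult[of "x [^] n" x] ball_pow[OF x, of n] x by simp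
  qed
qed

text \<open>If x and \<open>c^e\<close> have the same nonzero residue, their quotient is a 1-unit
  and hence an e-th power. Conversely, an e-th root of a unit has valuation 0, so it has a nonzero
  residue.\<close>

lemma unit_power_iff:
  assumes compl: "val_complete K v" and e: "[e] \<cdot> \<one> \<noteq> \<zero>" "v ([e] \<cdot> \<one>) = 0"
    and x: "x \<in> carrier K - {\<zero>}" "v x = 0"
  shows "x \<in> powers K e \<longleftrightarrow> res x \<in> powers (residue_field K v) e"
proof
  have e0: "e \<noteq> 0" using e(1) by (intro notI) simp
  assume "x \<in> powers K e"
  then obtain c where c: "c \<in> carrier K - {\<zero>}" "x = c [^] e" by (auto simp: powers_def)
  then have "v c = 0" using v_pow[OF c(1), of e] x(2) e0 by simp
  then have "c \<in> ball 0" "res c \<in> carrier (units_grp (residue_field K v))" using res_unit c(1) by auto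
  then show "res x \<in> powers (residue_field K v) e" using c(2) res_pow unfolding powers_def by simp
next
  assume "res x \<in> powers (residue_field K v) e"
  then obtain y where y: "y \<in> carrier (residue_field K v)" "y \<noteq> \<zero>\<^bsub>residue_field K v\<^esub>"
    "res x = y [^]\<^bsub>residue_field K v\<^esub> e" by (auto simp: powers_def)
  obtain c where c: "c \<in> ball 0" "y = res c" using y(1) res_surj by auto
  have c1: "c \<notin> ball 1" using res_zero_iff[OF c(1)] c(2) y(2) by simp
  then have c0: "c \<in> carrier K - {\<zero>}" using ball_closed[OF c(1)] by auto
  have vc: "v c = 0" using ball_iff[OF c0] c(1) c1 by fastforce
  have ce: "c [^] e \<in> carrier K - {\<zero>}" "v (c [^] e) = 0"
    using nonzero_pow_closed[OF c0] v_pow[OF c0] vc by auto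
  have ice: "inv (c [^] e) \<in> carrier K - {\<zero>}" using nonzero_inv_closed[OF ce(1)] .
  have "x \<ominus> c [^] e \<in> ball 1"
    using res_eq_iff[of x "c [^] e"] res_pow[OF c(1), of e] y(3) c(2) res_unit[OF x] ball_pow[OF c(1)] by simp
  moreover have "inv (c [^] e) \<in> ball 0" using ball_iff[OF ice] v_inv[OF ce(1)] ce(2) by simp
  ultimately have 1: "inv (c [^] e) \<otimes> (x \<ominus> c [^] e) \<in> ball 1" using ball_mult0 by simp
  have cc: "c [^] e \<in> carrier K" "inv (c [^] e) \<in> carrier K" "x \<in> carrier K" using ce ice x by auto
  have "inv (c [^] e) \<otimes> (x \<ominus> c [^] e) = inv (c [^] e) \<otimes> x \<ominus> inv (c [^] e) \<otimes> c [^] e" using cc by algebra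
  then have "inv (c [^] e) \<otimes> x \<ominus> \<one> \<in> ball 1" using 1 nonzero_l_inv[OF ce(1)] by simp
  then obtain z where z: "z \<in> carrier K - {\<zero>}" "z [^] e = inv (c [^] e) \<otimes> x"
    using one_unit_root_exists[OF compl e, of "inv (c [^] e) \<otimes> x"] cc by auto
  have "(c \<otimes> z) [^] e = c [^] e \<otimes> (inv (c [^] e) \<otimes> x)" using c0 z by (simp add: nat_pow_distrib)
  also have "\<dots> = (c [^] e \<otimes> inv (c [^] e)) \<otimes> x" using cc by (simp add: m_assoc)
  also have "\<dots> = x" using nonzero_r_inv[OF ce(1)] cc by simp
  finally show "x \<in> powers K e" using nonzero_m_closed[OF c0 z(1)] unfolding powers_def
    by (metis Multiplicative_Group.carrier_mult_of imageI)
qed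

end

section \<open>Ramified lines\<close>

context discrete_valuation
begin

abbreviation pclass :: "nat \<Rightarrow> 'a \<Rightarrow> 'a set" where
  "pclass e x \<equiv> powers K e #>\<^bsub>units_grp K\<^esub> x"

lemma units_grp_inv: "x \<in> carrier K - {\<zero>} \<Longrightarrow> inv\<^bsub>units_grp K\<^esub> x = inv x"
  by (rule m_inv_mult_of) simp

lemma pclass_eq_iff:
  assumes "x \<in> carrier K - {\<zero>}" "y \<in> carrier K - {\<zero>}"
  shows "pclass e x = pclass e y \<longleftrightarrow> x \<otimes> inv y \<in> powers K e"
proof -
  interpret G: comm_group "units_grp K" by (rule field_comm_group)
  show ?thesis using G.rcos_eq_iff[OF powers_subgroup[of e], of x y] assms units_grp_inv by simp
qed

text \<open>Multiplication by an e-th power changes the valuation by a multiple of e, so the set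
  inside \<open>val_mod\<close> is a singleton and \<open>the_elem\<close> is meaningful.\<close>

lemma val_mod_pclass:
  assumes x: "x \<in> carrier K - {\<zero>}" shows "val_mod v e (pclass e x) = v x mod int e"
proof -
  have "(\<lambda>y. v y mod int e) ` pclass e x = {v x mod int e}"
  proof (intro equalityI subsetI)
    fix z assume "z \<in> (\<lambda>y. v y mod int e) ` pclass e x"
    then obtain c where c: "c \<in> carrier K - {\<zero>}" "z = v (c [^] e \<otimes> x) mod int e"
      by (auto simp: r_coset_def powers_def)
    have "v (c [^] e \<otimes> x) = int e * v c + v x"
      using v_mult[OF nonzero_pow_closed[OF c(1)] x] v_pow[OF c(1)] by simp
    then show "z \<in> {v x mod int e}" using c(2) by simp
  next
    interpret G: comm_group "units_grp K" by (rule field_comm_group)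
    have "x \<in> pclass e x" using G.rcos_self[OF _ powers_subgroup] x by simp
    then show "z \<in> (\<lambda>y. v y mod int e) ` pclass e x" if "z \<in> {v x mod int e}" for z using that by blast
  qed
  then show ?thesis by (simp add: val_mod_def)
qed

lemma power_classes_carrier: "carrier (power_classes K e) = pclass e ` (carrier K - {\<zero>})"
  by (auto simp: power_classes_def FactGroup_def RCOSETS_def)

lemma power_classes_group: "comm_group (power_classes K e)"
proof -
  interpret G: comm_group "units_grp K" by (rule field_comm_group)
  show ?thesis unfolding power_classes_def using G.abelian_FactGroup powers_subgroup by blast
qed

lemma pclass_mult:
  assumes "x \<in> carrier K - {\<zero>}" "y \<in> carrier K - {\<zero>}"
  shows "pclass e x \<otimes>\<^bsub>power_classes K e\<^esub> pclass e y = pclass e (x \<otimes> y)"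
proof -
  interpret G: comm_group "units_grp K" by (rule field_comm_group)
  interpret N: normal "powers K e" "units_grp K" using G.subgroup_imp_normal[OF powers_subgroup] .
  show ?thesis using N.rcos_sum[of x y] assms by (simp add: power_classes_def FactGroup_def)
qed

lemma pclass_one: "\<one>\<^bsub>power_classes K e\<^esub> = pclass e \<one>"
proof -
  interpret G: comm_group "units_grp K" by (rule field_comm_group)
  have "pclass e \<one> = powers K e" using G.coset_join2[OF _ powers_subgroup subgroup.one_closed[OF powers_subgroup]] by simp
  then show ?thesis by (simp add: power_classes_def FactGroup_def)
qed

lemma pclass_pow_mem: "x \<in> carrier K - {\<zero>} \<Longrightarrow> x [^] (e * n) \<in> powers K e"
  using nonzero_pow_closed[of x n] nat_pow_pow[of x n e] unfolding powers_def
  by (intro image_eqI[of _ _ "x [^] n"]) (simp_all add: mult.commute)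

text \<open>This is the cyclic subgroup generated by the class of x. For positive e natural
  exponents suffice, because the order of that class divides e.\<close>

definition line :: "nat \<Rightarrow> 'a \<Rightarrow> 'a set set" where
  "line e x = (\<lambda>n::nat. pclass e (x [^] n)) ` UNIV"

context
  fixes e :: nat assumes e: "0 < e"
begin

text \<open>An element of the class that maps to 1 has valuation only congruent to 1 modulo e;
  multiplying it by a suitable e-th power makes the valuation exactly 1 without leaving the class.
  This justifies the choice in \<open>adjoin_line\<close>.\<close>

lemma line_uniformisers_nonempty:
  assumes D: "D \<in> ramified_lines K v e" shows "\<exists>x. x \<in> line_uniformisers K v e D"
proof -
  have sub: "D \<subseteq> carrier (power_classes K e)"
    using D subgroup.subset by (auto simp: ramified_lines_def)
  have "bij_betw (val_mod v e) D {0..<int e}"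
    using D e by (auto simp: ramified_lines_def iso_def carrier_integer_mod_group)
  \<comment> \<open>The reduction matters for \<open>e = 1\<close>, where the class of 1 is
    represented by 0.\<close>
  moreover have "1 mod int e \<in> {0..<int e}" using e by simp
  ultimately obtain C where C: "C \<in> D" "val_mod v e C = 1 mod int e"
    by (metis bij_betw_imp_surj_on imageE)
  obtain x where x: "x \<in> carrier K - {\<zero>}" "C = pclass e x" using C(1) sub power_classes_carrier by auto
  have vx: "v x mod int e = 1 mod int e" using C(2) val_mod_pclass[OF x(1)] x(2) by simp
  then have "int e dvd v x - 1" by (simp add: mod_eq_dvd_iff)
  then obtain k where k: "v x - 1 = int e * k" by (elim dvdE)
  obtain c where c: "c \<in> carrier K - {\<zero>}" "v c = - k" using v_surj by blast
  have ce: "c [^] e \<in> carrier K - {\<zero>}" using nonzero_pow_closed[OF c(1)] .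
  let ?y = "c [^] e \<otimes> x"
  have y: "?y \<in> carrier K - {\<zero>}" using nonzero_m_closed[OF ce x(1)] .
  have vy: "v ?y = 1" using v_mult[OF ce x(1)] v_pow[OF c(1), of e] c(2) k by simp
  have "?y \<otimes> inv x = c [^] e \<otimes> (x \<otimes> inv x)" using ce x(1) nonzero_inv_closed[OF x(1)] by (simp add: m_assoc)
  then have "?y \<otimes> inv x = c [^] e" using nonzero_r_inv[OF x(1)] ce by simp
  then have "?y \<otimes> inv x \<in> powers K e" using c(1) by (auto simp: powers_def)
  then have "pclass e ?y = C" using pclass_eq_iff[OF y x(1)] x(2) by simp
  then show ?thesis using y vy C(1) by (auto simp: line_uniformisers_def)
qed

lemma line_uniformisersD:
  "x \<in> line_uniformisers K v e D \<Longrightarrow> x \<in> carrier K - {\<zero>} \<and> v x = 1 \<and> pclass e x \<in> D"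
  by (auto simp: line_uniformisers_def)

lemma line_val_mod:
  assumes D: "D \<in> ramified_lines K v e" and "C \<in> D" "C' \<in> D" "val_mod v e C = val_mod v e C'"
  shows "C = C'"
proof -
  have "bij_betw (val_mod v e) D {0..<int e}"
    using D e by (auto simp: ramified_lines_def iso_def carrier_integer_mod_group)
  then show ?thesis using assms(2-4) by (auto simp: bij_betw_def inj_on_def)
qed

lemma line_uniformisers_class:
  assumes D: "D \<in> ramified_lines K v e" and "x \<in> line_uniformisers K v e D" "y \<in> line_uniformisers K v e D"
  shows "pclass e x = pclass e y"
  using line_val_mod[OF D] line_uniformisersD[OF assms(2)] line_uniformisersD[OF assms(3)] val_mod_pclass by simp

lemma pclass_pow_mod:
  assumes x: "x \<in> carrier K - {\<zero>}" and nm: "int n mod int e = int m mod int e"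
  shows "pclass e (x [^] n) = pclass e (x [^] m)"
proof -
  have *: "pclass e (x [^] n) = pclass e (x [^] m)" if "n mod e = m mod e" "m \<le> n" for n m
  proof -
    have "e dvd n - m" using that by (simp add: mod_eq_dvd_iff_nat)
    then obtain k where "n - m = e * k" by (elim dvdE)
    then have k: "n = m + e * k" using that(2) by linarith
    have xm: "x [^] m \<in> carrier K - {\<zero>}" "x [^] (e * k) \<in> carrier K - {\<zero>}"
      using nonzero_pow_closed[OF x] by auto
    have "x [^] n = x [^] (e * k) \<otimes> x [^] m" using x k by (simp add: nat_pow_mult add.commute)
    then have "x [^] n \<otimes> inv (x [^] m) = x [^] (e * k) \<otimes> (x [^] m \<otimes> inv (x [^] m))"
      using xm nonzero_inv_closed[OF xm(1)] by (simp add: m_assoc)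
    also have "\<dots> = x [^] (e * k)" using nonzero_r_inv[OF xm(1)] xm by simp
    finally show ?thesis
      using pclass_eq_iff[OF nonzero_pow_closed[OF x] nonzero_pow_closed[OF x]] pclass_pow_mem[OF x] by simp
  qed
  have "n mod e = m mod e" using nm by (metis of_nat_eq_iff zmod_int)
  then show ?thesis using *[of n m] *[of m n] by (cases "m \<le> n") auto
qed

lemma line_is_ramified:
  assumes x: "x \<in> carrier K - {\<zero>}" "v x = 1"
  shows "line e x \<in> ramified_lines K v e" "x \<in> line_uniformisers K v e (line e x)"
proof -
  interpret Q: comm_group "power_classes K e" by (rule power_classes_group)
  have pc: "x [^] n \<in> carrier K - {\<zero>}" for n :: nat using nonzero_pow_closed[OF x(1)] .
  have vm: "val_mod v e (pclass e (x [^] n)) = int n mod int e" for n :: nat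
    using val_mod_pclass[OF pc] v_pow[OF x(1)] x(2) by simp
  have mult: "pclass e (x [^] n) \<otimes>\<^bsub>power_classes K e\<^esub> pclass e (x [^] m) = pclass e (x [^] (n + m))" for n m :: nat
    using pclass_mult[OF pc pc] x by (simp add: nat_pow_mult)
  have cl: "pclass e (x [^] n) \<in> carrier (power_classes K e)" for n :: nat
    using pc power_classes_carrier by blast
  have sg: "subgroup (line e x) (power_classes K e)"
  proof (rule Q.subgroupI)
    show "line e x \<subseteq> carrier (power_classes K e)" using cl by (auto simp: line_def)
    show "line e x \<noteq> {}" by (simp add: line_def)
    fix C assume "C \<in> line e x"
    then obtain n :: nat where n: "C = pclass e (x [^] n)" by (auto simp: line_def)
    \<comment> \<open>The exponents n and \<open>n * (e - 1)\<close> add up to \<open>e * n\<close>,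
      so the inverse of a power is found among the natural powers.\<close>
    have "pclass e (x [^] (n * (e - 1))) \<otimes>\<^bsub>power_classes K e\<^esub> C = pclass e (x [^] (n * (e - 1) + n))"
      unfolding n mult ..
    also have "n * (e - 1) + n = e * n" using e by (cases e) auto
    also have "pclass e (x [^] (e * n)) = pclass e (x [^] (0::nat))" by (rule pclass_pow_mod[OF x(1)]) simp
    finally have "pclass e (x [^] (n * (e - 1))) \<otimes>\<^bsub>power_classes K e\<^esub> C = \<one>\<^bsub>power_classes K e\<^esub>"
      by (simp add: pclass_one)
    then have "inv\<^bsub>power_classes K e\<^esub> C = pclass e (x [^] (n * (e - 1)))"
      using Q.inv_equality cl n by blast
    then show "inv\<^bsub>power_classes K e\<^esub> C \<in> line e x" by (auto simp: line_def)
    fix C' assume "C' \<in> line e x"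
    then obtain m :: nat where "C' = pclass e (x [^] m)" by (auto simp: line_def)
    then show "C \<otimes>\<^bsub>power_classes K e\<^esub> C' \<in> line e x" using mult n by (auto simp: line_def)
  qed
  have "val_mod v e \<in> iso ((power_classes K e)\<lparr>carrier := line e x\<rparr>) (integer_mod_group e)"
    unfolding iso_def
  proof (intro CollectI conjI homI)
    show "val_mod v e C \<in> carrier (integer_mod_group e)" if "C \<in> carrier ((power_classes K e)\<lparr>carrier := line e x\<rparr>)" for C
      using that e vm by (auto simp: line_def carrier_integer_mod_group)
    show "val_mod v e (C \<otimes>\<^bsub>(power_classes K e)\<lparr>carrier := line e x\<rparr>\<^esub> C') = val_mod v e C \<otimes>\<^bsub>integer_mod_group e\<^esub> val_mod v e C'"
      if CC': "C \<in> carrier ((power_classes K e)\<lparr>carrier := line e x\<rparr>)" "C' \<in> carrier ((power_classes K e)\<lparr>carrier := line e x\<rparr>)" for C C'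
    proof -
      obtain n m :: nat where nm: "C = pclass e (x [^] n)" "C' = pclass e (x [^] m)"
        using CC' by (auto simp: line_def)
      have "val_mod v e (C \<otimes>\<^bsub>power_classes K e\<^esub> C') = int (n + m) mod int e"
        unfolding nm mult vm ..
      then show ?thesis using e unfolding nm vm by (simp add: mult_integer_mod_group mod_add_eq)
    qed
    show "bij_betw (val_mod v e) (carrier ((power_classes K e)\<lparr>carrier := line e x\<rparr>)) (carrier (integer_mod_group e))"
      unfolding bij_betw_def
    proof
      show "inj_on (val_mod v e) (carrier ((power_classes K e)\<lparr>carrier := line e x\<rparr>))"
      proof (rule inj_onI)
        fix C C' assume "C \<in> carrier ((power_classes K e)\<lparr>carrier := line e x\<rparr>)"
          "C' \<in> carrier ((power_classes K e)\<lparr>carrier := line e x\<rparr>)" and eq: "val_mod v e C = val_mod v e C'"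
        then obtain n m :: nat where nm: "C = pclass e (x [^] n)" "C' = pclass e (x [^] m)"
          by (auto simp: line_def)
        show "C = C'" using pclass_pow_mod[OF x(1) eq[unfolded nm vm]] nm by simp
      qed
      have 1: "z \<in> val_mod v e ` line e x" if "0 \<le> z" "z < int e" for z
      proof -
        have "val_mod v e (pclass e (x [^] nat z)) = z" using that vm[of "nat z"] by simp
        moreover have "pclass e (x [^] nat z) \<in> line e x" by (simp add: line_def)
        ultimately show ?thesis using imageI[of _ "line e x" "val_mod v e"] by metis
      qed
      have 2: "val_mod v e ` line e x \<subseteq> {0..<int e}" unfolding line_def image_image vm using e by auto
      have "val_mod v e ` line e x = {0..<int e}"
      proof (rule equalityI[OF 2 subsetI])
        fix z assume "z \<in> {0..<int e}" then show "z \<in> val_mod v e ` line e x" by (intro 1) simp_all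
      qed
      then show "val_mod v e ` carrier ((power_classes K e)\<lparr>carrier := line e x\<rparr>) = carrier (integer_mod_group e)"
        using e by (simp add: carrier_integer_mod_group)
    qed
  qed
  then show "line e x \<in> ramified_lines K v e" using sg by (simp add: ramified_lines_def)
  have "pclass e (x [^] (1::nat)) \<in> line e x" unfolding line_def by (rule rangeI)
  then show "x \<in> line_uniformisers K v e (line e x)" using x by (simp add: line_uniformisers_def)
qed

text \<open>D contains the line generated by x, and the same map \<open>val_mod\<close> is a
  bijection of both onto the integers modulo e, so the inclusion is an equality.\<close>

lemma ramified_line_eq:
  assumes D: "D \<in> ramified_lines K v e" and x: "x \<in> line_uniformisers K v e D"
  shows "D = line e x"
proof -
  have x': "x \<in> carrier K - {\<zero>}" "v x = 1" "pclass e x \<in> D" using line_uniformisersD[OF x] by auto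
  have sg: "subgroup D (power_classes K e)" using D by (simp add: ramified_lines_def)
  interpret Q: comm_group "power_classes K e" by (rule power_classes_group)
  have "pclass e (x [^] n) \<in> D" for n :: nat
  proof (induction n)
    case 0 then show ?case using subgroup.one_closed[OF sg] by (simp add: pclass_one)
  next
    case (Suc n)
    show ?case using subgroup.m_closed[OF sg Suc x'(3)] pclass_mult[OF nonzero_pow_closed[OF x'(1)] x'(1)] by simp
  qed
  then have 1: "line e x \<subseteq> D" by (auto simp: line_def)
  have "C \<in> line e x" if C: "C \<in> D" for C
  proof -
    have "bij_betw (val_mod v e) (line e x) {0..<int e}" "bij_betw (val_mod v e) D {0..<int e}"
      using line_is_ramified(1)[OF x'(1,2)] D e by (auto simp: ramified_lines_def iso_def carrier_integer_mod_group)
    then obtain C' where "C' \<in> line e x" "val_mod v e C' = val_mod v e C"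
      using C by (metis bij_betw_apply bij_betw_imp_surj_on imageE)
    then show ?thesis using line_val_mod[OF D, of C' C] 1 C by auto
  qed
  with 1 show ?thesis by blast
qed

lemma ramified_line_eq_iff:
  assumes D: "D \<in> ramified_lines K v e" "D' \<in> ramified_lines K v e"
    and x: "x \<in> line_uniformisers K v e D" "y \<in> line_uniformisers K v e D'" and xy: "pclass e x = pclass e y"
  shows "D = D'"
proof -
  have "x \<in> line_uniformisers K v e D'" using x xy by (auto simp: line_uniformisers_def)
  then show ?thesis using ramified_line_eq[OF D(1) x(1)] ramified_line_eq[OF D(2)] by simp
qed

text \<open>A line contains exactly one class of uniformisers and is generated by it, so lines and
  classes are images of the set of uniformisers with the same fibres.\<close>

lemma card_ramified_lines_classes:
  "card (ramified_lines K v e) = card (pclass e ` {x \<in> carrier K - {\<zero>}. v x = 1})"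
proof -
  let ?U = "{x \<in> carrier K - {\<zero>}. v x = 1}"
  have "ramified_lines K v e = line e ` ?U"
  proof (intro equalityI subsetI)
    fix D assume D: "D \<in> ramified_lines K v e"
    then obtain x where x: "x \<in> line_uniformisers K v e D" using line_uniformisers_nonempty by blast
    then show "D \<in> line e ` ?U" using ramified_line_eq[OF D x] line_uniformisersD[OF x] by blast
  qed (use line_is_ramified in auto)
  moreover have "line e x = line e y \<longleftrightarrow> pclass e x = pclass e y" if "x \<in> ?U" "y \<in> ?U" for x y
    using that line_is_ramified[of x] line_is_ramified[of y] line_uniformisers_class[of "line e x" x y] ramified_line_eq_iff[of "line e x" "line e y" x y]
    by auto
  ultimately show ?thesis using card_image_eq_if_same_kernel[of ?U "line e" "pclass e"] by simp
qed

end

lemma card_ramified_lines: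
  assumes compl: "val_complete K v" and e: "[e] \<cdot> \<one> \<noteq> \<zero>" "v ([e] \<cdot> \<one>) = 0"
    and fin: "finite (carrier (residue_field K v))"
  shows "card (ramified_lines K v e) = gcd (order (residue_field K v) - 1) e"
proof -
  have e0: "0 < e" using e(1) by (intro gr0I) simp
  interpret k: field "residue_field K v" by (rule residue_field_field)
  interpret kG: comm_group "units_grp (residue_field K v)" by (rule k.field_comm_group)
  interpret H: ring_hom_ring val_ring "residue_field K v" res by (rule res_hom)
  let ?U = "{x \<in> carrier K - {\<zero>}. v x = 0}" and ?U1 = "{x \<in> carrier K - {\<zero>}. v x = 1}"
  let ?c = "\<lambda>u. powers (residue_field K v) e #>\<^bsub>units_grp (residue_field K v)\<^esub> res u"
  obtain p where p: "p \<in> carrier K - {\<zero>}" "v p = 1" using v_surj by blast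
  have ip: "inv p \<in> carrier K - {\<zero>}" using nonzero_inv_closed[OF p(1)] .
  have "?U1 = (\<lambda>u. u \<otimes> p) ` ?U"
  proof (intro equalityI subsetI)
    fix x assume x: "x \<in> ?U1"
    then have "x \<otimes> inv p \<in> ?U" using nonzero_m_closed[OF _ ip] v_mult[OF _ ip] v_inv[OF p(1)] p(2) by auto
    moreover have "x = (x \<otimes> inv p) \<otimes> p" using x p ip nonzero_l_inv[OF p(1)] by (simp add: m_assoc)
    ultimately show "x \<in> (\<lambda>u. u \<otimes> p) ` ?U" by blast
  next
    fix x assume "x \<in> (\<lambda>u. u \<otimes> p) ` ?U"
    then show "x \<in> ?U1" using nonzero_m_closed[OF _ p(1)] v_mult[OF _ p(1)] p(2) by auto
  qed
  then have "pclass e ` ?U1 = (\<lambda>u. pclass e (u \<otimes> p)) ` ?U" by (simp add: image_image)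
  \<comment> \<open>The fixed uniformiser p cancels in the quotient of the two elements, and
    \<open>unit_power_iff\<close> transfers the remaining question about x and y to the residue
    field.\<close>
  moreover have "pclass e (x \<otimes> p) = pclass e (y \<otimes> p) \<longleftrightarrow> ?c x = ?c y" if xy: "x \<in> ?U" "y \<in> ?U" for x y
  proof -
    have x: "x \<in> carrier K - {\<zero>}" "v x = 0" and y: "y \<in> carrier K - {\<zero>}" "v y = 0" using xy by auto
    have iy: "inv y \<in> carrier K - {\<zero>}" "v (inv y) = 0" using nonzero_inv_closed[OF y(1)] v_inv[OF y(1)] y(2) by auto
    have z: "x \<otimes> inv y \<in> carrier K - {\<zero>}" "v (x \<otimes> inv y) = 0"
      using nonzero_m_closed[OF x(1) iy(1)] v_mult[OF x(1) iy(1)] x iy by auto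
    have xp: "x \<otimes> p \<in> carrier K - {\<zero>}" "y \<otimes> p \<in> carrier K - {\<zero>}" using nonzero_m_closed x y p by auto
    have "(inv y \<otimes> inv p) \<otimes> (y \<otimes> p) = (inv y \<otimes> y) \<otimes> (inv p \<otimes> p)" using y iy p ip by (simp add: m_ac)
    then have "inv (y \<otimes> p) = inv y \<otimes> inv p"
      using nonzero_l_inv[OF y(1)] nonzero_l_inv[OF p(1)] y iy p ip by (intro inv_char) (simp_all add: m_comm)
    then have "(x \<otimes> p) \<otimes> inv (y \<otimes> p) = (x \<otimes> inv y) \<otimes> (p \<otimes> inv p)" using x y iy p ip by (simp add: m_ac)
    then have "(x \<otimes> p) \<otimes> inv (y \<otimes> p) = x \<otimes> inv y" using nonzero_r_inv[OF p(1)] z by simp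
    then have "pclass e (x \<otimes> p) = pclass e (y \<otimes> p) \<longleftrightarrow> x \<otimes> inv y \<in> powers K e"
      using pclass_eq_iff[OF xp] by simp
    also have "\<dots> \<longleftrightarrow> res (x \<otimes> inv y) \<in> powers (residue_field K v) e" using unit_power_iff[OF compl e z] .
    also have "res (x \<otimes> inv y) = res x \<otimes>\<^bsub>residue_field K v\<^esub> res (inv y)"
      using H.hom_mult[of x "inv y"] res_unit[OF x] res_unit[OF iy] by simp
    also have "res (inv y) = inv\<^bsub>units_grp (residue_field K v)\<^esub> (res y)"
    proof -
      have "res (inv y) \<otimes>\<^bsub>residue_field K v\<^esub> res y = \<one>\<^bsub>residue_field K v\<^esub>"
        using H.hom_mult[of "inv y" y] res_unit[OF y] res_unit[OF iy] nonzero_l_inv[OF y(1)] H.hom_one by simp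
      then show ?thesis using kG.inv_equality[of "res (inv y)" "res y"] res_unit[OF y] res_unit[OF iy] by simp
    qed
    also have "(res x \<otimes>\<^bsub>residue_field K v\<^esub> inv\<^bsub>units_grp (residue_field K v)\<^esub> (res y) \<in> powers (residue_field K v) e)
      \<longleftrightarrow> ?c x = ?c y"
      using kG.rcos_eq_iff[OF k.powers_subgroup[of e], of "res x" "res y"] res_unit[OF x] res_unit[OF y] by simp
    finally show ?thesis .
  qed
  ultimately have "card (ramified_lines K v e) = card (?c ` ?U)"
    unfolding card_ramified_lines_classes[OF e0]
    using card_image_eq_if_same_kernel[of ?U "\<lambda>u. pclass e (u \<otimes> p)" ?c] by simp
  also have "?c ` ?U = rcosets\<^bsub>units_grp (residue_field K v)\<^esub> (powers (residue_field K v) e)"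
  proof -
    have resU: "res ` ?U = carrier (units_grp (residue_field K v))"
    proof (intro equalityI subsetI)
      fix y assume y: "y \<in> carrier (units_grp (residue_field K v))"
      then obtain x where x: "x \<in> ball 0" "y = res x" using res_surj by auto
      then have x1: "x \<notin> ball 1" using y res_zero_iff by auto
      then have x0: "x \<in> carrier K - {\<zero>}" using ball_closed[OF x(1)] by auto
      then have "v x = 0" using ball_iff[OF x0] x(1) x1 by fastforce
      then show "y \<in> res ` ?U" using x0 x(2) by blast
    qed (use res_unit in blast)
    have "?c ` ?U = (\<lambda>y. powers (residue_field K v) e #>\<^bsub>units_grp (residue_field K v)\<^esub> y) ` (res ` ?U)"
      by (simp only: image_image)
    also have "\<dots> = rcosets\<^bsub>units_grp (residue_field K v)\<^esub> (powers (residue_field K v) e)"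
      unfolding resU by (auto simp: RCOSETS_def simp del: Multiplicative_Group.carrier_mult_of)
    finally show ?thesis .
  qed
  finally show ?thesis using k.card_power_cosets[OF fin] by simp
qed

end

section \<open>Isomorphism classes\<close>

lemma extension_iso_refl: "extension_iso K E E"
proof -
  obtain L i where E: "E = (L, i)" by (cases E)
  have "(\<lambda>x. x) \<in> ring_iso L L" by (rule ring_iso_memI) (auto simp: bij_betw_def)
  then show ?thesis unfolding E extension_iso_def by auto
qed

lemma extension_iso_sym:
  assumes E: "field_extension K E" and iso: "extension_iso K E F"
  shows "extension_iso K F E"
proof -
  obtain L i M j where EF: "E = (L, i)" "F = (M, j)" by (cases E, cases F)
  have ring: "ring L" and i: "i \<in> ring_hom K L"
    using E unfolding EF field_extension_def by (auto simp: field_def domain_def cring_def)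
  obtain h where h: "h \<in> ring_iso L M" "\<And>x. x \<in> carrier K \<Longrightarrow> h (i x) = j x"
    using iso unfolding EF extension_iso_def by auto
  have inj: "inj_on h (carrier L)" using ring_iso_memE(5)[OF h(1)] by (simp add: bij_betw_def)
  have "inv_into (carrier L) h (j x) = i x" if "x \<in> carrier K" for x
    using inv_into_f_f[OF inj ring_hom_memE(1)[OF i that]] h(2)[OF that] by simp
  then show ?thesis using ring_iso_set_sym[OF ring h(1)] unfolding EF extension_iso_def by auto
qed

lemma extension_iso_trans:
  assumes "extension_iso K E F" "extension_iso K F G" shows "extension_iso K E G"
proof -
  obtain L i M j N k where eq: "E = (L, i)" "F = (M, j)" "G = (N, k)" by (cases E, cases F, cases G)
  obtain h where h: "h \<in> ring_iso L M" "\<forall>x \<in> carrier K. h (i x) = j x"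
    using assms(1) unfolding eq extension_iso_def by auto
  obtain g where g: "g \<in> ring_iso M N" "\<forall>x \<in> carrier K. g (j x) = k x"
    using assms(2) unfolding eq extension_iso_def by auto
  have "g \<circ> h \<in> ring_iso L N" using ring_iso_set_trans[OF h(1) g(1)] .
  then show ?thesis using h(2) g(2) unfolding eq extension_iso_def by (auto intro!: bexI[of _ "g \<circ> h"])
qed

lemma extension_class_eqI:
  assumes "field_extension K E" "extension_iso K E F"
  shows "extension_class K E = extension_class K F"
  using extension_iso_trans[OF extension_iso_sym[OF assms]] extension_iso_trans[OF assms(2)]
  by (auto simp: extension_class_def)

text \<open>Reflexivity puts F in its own class. For this F must have the carrier type from which
  members of classes are taken, while E may live on any type.\<close>

lemma extension_class_eqD:
  fixes K :: "('a, 'm) ring_scheme" and F :: "('a, 'a list set) extension"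
  assumes "field_extension K F" "extension_class K E = extension_class K F"
  shows "extension_iso K E F"
proof -
  have "F \<in> extension_class K F" using assms(1) extension_iso_refl[of K F] by (simp add: extension_class_def)
  then show ?thesis unfolding assms(2)[symmetric] by (simp add: extension_class_def)
qed

text \<open>Tameness is recorded as e times 1 being a unit of the valuation ring, the form in which
  extraction of roots uses it.\<close>

locale tame_local_field = local_field +
  fixes e :: nat
  assumes e_unit: "[e] \<cdot> \<one> \<noteq> \<zero>" "v ([e] \<cdot> \<one>) = 0"
begin

lemma e_positive: "0 < e"
  using e_unit(1) by (intro gr0I) simp

definition uniformisers :: "'a set" where
  "uniformisers = {x \<in> carrier K - {\<zero>}. v x = 1}"

lemma uniformisersD: "x \<in> uniformisers \<Longrightarrow> x \<in> carrier K - {\<zero>}" "x \<in> uniformisers \<Longrightarrow> v x = 1"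
  by (auto simp: uniformisers_def)

lemma totally_ramified_ramified_extension:
  assumes "totally_ramified K v e (L, i)"
  obtains w where "ramified_extension K v L i w e"
proof -
  have F: "field L" "i \<in> ring_hom K L" and d: "ring.dimension L e (i ` carrier K) (carrier L)"
    using assms by (auto simp: totally_ramified_def field_extension_def has_degree_def)
  obtain w where w: "discrete_valuation L w" "\<And>x. x \<in> carrier (units_grp K) \<Longrightarrow> w (i x) = int e * v x"
    using assms by (auto simp: totally_ramified_def has_ramification_index_def)
  interpret W: discrete_valuation L w by (rule w(1))
  have "ramified_extension K v L i w e"
    by unfold_locales (use F d w(2) e_positive in auto)
  then show ?thesis by (rule that)
qed

lemma totally_ramified_separable:
  assumes "totally_ramified K v e E" shows "separable_extension K E"
proof -
  obtain L i where E: "E = (L, i)" by (cases E)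
  obtain w where "ramified_extension K v L i w e"
    using totally_ramified_ramified_extension assms unfolding E by blast
  then interpret R: ramified_extension K v L i w e .
  have "[e] \<cdot>\<^bsub>L\<^esub> \<one>\<^bsub>L\<^esub> \<noteq> \<zero>\<^bsub>L\<^esub>"
    using R.i_nonzero[of "[e] \<cdot> \<one>"] e_unit(1) by (simp add: R.i_add_pow)
  moreover have "subfield (i ` carrier K) L" by (rule R.image_subfield) simp
  ultimately show ?thesis
    unfolding E separable_extension_def using R.W.separable_of_degree_unit[OF _ R.dim_L] by simp
qed

lemma totally_ramified_root:
  assumes "totally_ramified K v e (L, i)"
  shows "\<exists>p \<in> uniformisers. \<exists>t \<in> carrier L. t [^]\<^bsub>L\<^esub> e = i p"
proof -
  obtain w where "ramified_extension K v L i w e"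
    using totally_ramified_ramified_extension[OF assms] .
  then interpret R: ramified_extension K v L i w e .
  show ?thesis using R.exists_uniformiser_root[OF complete e_unit] by (auto simp: uniformisers_def)
qed

lemma adjoin_root_totally_ramified:
  assumes p: "p \<in> uniformisers" shows "totally_ramified K v e (adjoin_root e p)"
proof -
  obtain L i where Li: "adjoin_root e p = (L, i)" by fastforce
  note pc = uniformisersD[OF p]
  have pK: "p \<in> carrier K" using pc by simp
  note A = adjoin_root_power_basis[OF pK e_positive Li]
  interpret E: embedded_field K L i by (rule A(1))
  obtain t where t: "E.power_basis t e" "t [^]\<^bsub>L\<^esub> e = i p" using A(3) by blast
  interpret U: uniformiser_root K v L i t e p
    by unfold_locales (use t pc A(2) in auto)
  show ?thesis unfolding Li totally_ramified_def field_extension_def has_degree_def has_ramification_index_def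
    using U.is_field E.i_hom field_axioms E.power_basis_dimension[OF t(1) A(2)] U.w_discrete_valuation U.w_embedding
    by auto
qed

lemma adjoin_root_field_extension: "p \<in> uniformisers \<Longrightarrow> field_extension K (adjoin_root e p)"
  using adjoin_root_totally_ramified by (simp add: totally_ramified_def)

text \<open>An e-th root of a uniformiser of K is a uniformiser of L, so its powers form a basis.
  The class of T in \<open>adjoin_root e p\<close> has the same property with the same p, and
  \<open>power_basis_iso\<close> matches the two.\<close>

lemma extension_iso_adjoin_root:
  assumes E: "totally_ramified K v e (L, i)" and p: "p \<in> uniformisers"
    and t: "t \<in> carrier L" "t [^]\<^bsub>L\<^esub> e = i p"
  shows "extension_iso K (L, i) (adjoin_root e p)"
proof -
  obtain w where "ramified_extension K v L i w e"
    using totally_ramified_ramified_extension[OF E] .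
  then interpret R: ramified_extension K v L i w e .
  note pc = uniformisersD[OF p]
  have pK: "p \<in> carrier K" using pc by simp
  have b: "R.power_basis t e" using R.basis_uniformiser[OF R.pow_root_w[OF t pc]] .
  obtain M j where Mj: "adjoin_root e p = (M, j)" by fastforce
  note A = adjoin_root_power_basis[OF pK e_positive Mj]
  obtain s where s: "embedded_field.power_basis K M j s e" "s [^]\<^bsub>M\<^esub> e = j p" using A(3) by blast
  show ?thesis
    using power_basis_iso[OF R.embedded_field_axioms A(1) b t(2) s pK] unfolding Mj extension_iso_def by simp
qed

lemma adjoin_root_has_root:
  assumes p: "p \<in> uniformisers" and Li: "adjoin_root e p = (L, i)"
  shows "\<exists>t \<in> carrier L. t [^]\<^bsub>L\<^esub> e = i p"
proof -
  have pK: "p \<in> carrier K" using uniformisersD[OF p] by simp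
  note A = adjoin_root_power_basis[OF pK e_positive Li]
  then show ?thesis by (auto simp: embedded_field.power_basis_def[OF A(1)])
qed

text \<open>An isomorphism carries the root of p into the extension that has a root of q, so
  \<open>roots_differ_by_power\<close> applies there. Conversely, if \<open>p = c^e q\<close> and s
  is a root of q, then \<open>c s\<close> is a root of p in the same extension.\<close>

lemma adjoin_root_iso_iff:
  assumes p: "p \<in> uniformisers" and q: "q \<in> uniformisers"
  shows "extension_iso K (adjoin_root e p) (adjoin_root e q) \<longleftrightarrow> pclass e p = pclass e q"
proof -
  note pc = uniformisersD[OF p] and qc = uniformisersD[OF q]
  obtain L i where Li: "adjoin_root e p = (L, i)" by fastforce
  obtain M j where Mj: "adjoin_root e q = (M, j)" by fastforce
  obtain t where t: "t \<in> carrier L" "t [^]\<^bsub>L\<^esub> e = i p" using adjoin_root_has_root[OF p Li] by blast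
  obtain s where s: "s \<in> carrier M" "s [^]\<^bsub>M\<^esub> e = j q" using adjoin_root_has_root[OF q Mj] by blast
  have TM: "totally_ramified K v e (M, j)" using adjoin_root_totally_ramified[OF q] Mj by simp
  have TL: "totally_ramified K v e (L, i)" using adjoin_root_totally_ramified[OF p] Li by simp
  obtain w where "ramified_extension K v M j w e"
    using totally_ramified_ramified_extension[OF TM] .
  then interpret R: ramified_extension K v M j w e .
  show ?thesis
  proof
    assume "extension_iso K (adjoin_root e p) (adjoin_root e q)"
    then obtain h where h: "h \<in> ring_iso L M" "\<And>x. x \<in> carrier K \<Longrightarrow> h (i x) = j x"
      unfolding Li Mj extension_iso_def by auto
    interpret L: field L using TL by (auto simp: totally_ramified_def field_extension_def)
    interpret H: ring_hom_cring L M h by unfold_locales (use h(1) in \<open>simp add: ring_iso_def\<close>)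
    have "h t [^]\<^bsub>M\<^esub> e = h (t [^]\<^bsub>L\<^esub> e)" using t(1) by simp
    then have ht: "h t [^]\<^bsub>M\<^esub> e = j p" using t(2) h(2) pc by simp
    obtain c where c: "c \<in> carrier K - {\<zero>}" "p = c [^] e \<otimes> q"
      using R.roots_differ_by_power[OF complete e_unit s qc H.hom_closed[OF t(1)] ht pc] by blast
    have ce: "c [^] e \<in> carrier K" using c(1) by simp
    have "p \<otimes> inv q = c [^] e \<otimes> (q \<otimes> inv q)"
      unfolding c(2) using ce qc(1) nonzero_inv_closed[OF qc(1)] by (simp add: m_assoc)
    then have "p \<otimes> inv q = c [^] e" using nonzero_r_inv[OF qc(1)] ce by simp
    then have "p \<otimes> inv q \<in> powers K e" using c(1) by (auto simp: powers_def)
    then show "pclass e p = pclass e q" using pclass_eq_iff[OF pc(1) qc(1)] by simp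
  next
    assume "pclass e p = pclass e q"
    then have "p \<otimes> inv q \<in> powers K e" using pclass_eq_iff[OF pc(1) qc(1)] by simp
    then obtain c where c: "c \<in> carrier K - {\<zero>}" "p \<otimes> inv q = c [^] e" by (auto simp: powers_def)
    have "c [^] e \<otimes> q = p \<otimes> (inv q \<otimes> q)"
      unfolding c(2)[symmetric] using pc(1) qc(1) nonzero_inv_closed[OF qc(1)] by (simp add: m_assoc)
    then have pe: "c [^] e \<otimes> q = p" using nonzero_l_inv[OF qc(1)] pc(1) by simp
    have "(j c \<otimes>\<^bsub>M\<^esub> s) [^]\<^bsub>M\<^esub> e = j c [^]\<^bsub>M\<^esub> e \<otimes>\<^bsub>M\<^esub> s [^]\<^bsub>M\<^esub> e" using c(1) s(1) by (simp add: R.nat_pow_distrib)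
    also have "\<dots> = j (c [^] e \<otimes> q)" unfolding s(2) using c(1) qc(1) by simp
    finally have "(j c \<otimes>\<^bsub>M\<^esub> s) [^]\<^bsub>M\<^esub> e = j p" unfolding pe .
    moreover have "j c \<otimes>\<^bsub>M\<^esub> s \<in> carrier M" using c(1) s(1) by simp
    ultimately have "extension_iso K (M, j) (adjoin_root e p)"
      using extension_iso_adjoin_root[OF TM p] by blast
    then show "extension_iso K (adjoin_root e p) (adjoin_root e q)"
      using extension_iso_sym[of K "(M, j)"] TM Mj by (simp add: totally_ramified_def)
  qed
qed

lemma adjoin_root_class_eq_iff:
  assumes p: "p \<in> uniformisers" and q: "q \<in> uniformisers"
  shows "extension_class K (adjoin_root e p) = extension_class K (adjoin_root e q) \<longleftrightarrow> pclass e p = pclass e q"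
  using adjoin_root_iso_iff[OF p q] extension_class_eqI[OF adjoin_root_field_extension[OF p]]
    extension_class_eqD[OF adjoin_root_field_extension[OF q]] by blast

lemma totally_ramified_class:
  assumes "totally_ramified K v e E"
  shows "\<exists>p \<in> uniformisers. extension_class K E = extension_class K (adjoin_root e p)"
proof -
  obtain L i where E: "E = (L, i)" by (cases E)
  obtain p t where p: "p \<in> uniformisers" and t: "t \<in> carrier L" "t [^]\<^bsub>L\<^esub> e = i p"
    using totally_ramified_root assms unfolding E by blast
  have "extension_iso K E (adjoin_root e p)"
    using extension_iso_adjoin_root[of L i p t] p t assms unfolding E by blast
  moreover have "field_extension K E" using assms by (simp add: totally_ramified_def)
  ultimately show ?thesis using extension_class_eqI[of K E "adjoin_root e p"] p by blast
qed

text \<open>This indexes the classes by the uniformisers of K, the set that also generates the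
  ramified lines. Separability comes for free from
  \<open>totally_ramified_separable\<close>.\<close>

lemma totally_ramified_classes_eq:
  "totally_ramified_classes K v e = (\<lambda>p. extension_class K (adjoin_root e p)) ` uniformisers"
proof (intro equalityI subsetI)
  fix C assume "C \<in> totally_ramified_classes K v e"
  then obtain E :: "('a, 'a list set) extension" where "totally_ramified K v e E" "C = extension_class K E"
    by (auto simp: totally_ramified_classes_def)
  then show "C \<in> (\<lambda>p. extension_class K (adjoin_root e p)) ` uniformisers"
    using totally_ramified_class[of E] by auto
next
  fix C assume "C \<in> (\<lambda>p. extension_class K (adjoin_root e p)) ` uniformisers"
  then obtain p where p: "p \<in> uniformisers" "C = extension_class K (adjoin_root e p)" by blast
  have T: "totally_ramified K v e (adjoin_root e p)" using adjoin_root_totally_ramified[OF p(1)] .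
  show "C \<in> totally_ramified_classes K v e"
    unfolding totally_ramified_classes_def p(2) using T totally_ramified_separable[OF T] by blast
qed

lemma line_uniformisers_subset: "line_uniformisers K v e D \<subseteq> uniformisers"
  using line_uniformisersD[OF e_positive] by (auto simp: uniformisers_def)

lemma adjoin_line_uniformiser:
  assumes "D \<in> ramified_lines K v e"
  shows "\<exists>p \<in> line_uniformisers K v e D. adjoin_line K v e D = adjoin_root e p"
  using someI_ex[OF line_uniformisers_nonempty[OF e_positive assms]] by (auto simp: adjoin_line_def)

text \<open>All uniformisers of a line share one class modulo e-th powers, so the choice made in
  \<open>adjoin_line\<close> does not affect the isomorphism class.\<close>

lemma adjoin_line_class:
  assumes D: "D \<in> ramified_lines K v e" and p: "p \<in> line_uniformisers K v e D"
  shows "extension_class K (adjoin_root e p) = extension_class K (adjoin_line K v e D)"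
proof -
  obtain q where q: "q \<in> line_uniformisers K v e D" "adjoin_line K v e D = adjoin_root e q"
    using adjoin_line_uniformiser[OF D] by blast
  show ?thesis unfolding q(2)
    using adjoin_root_class_eq_iff line_uniformisers_class[OF e_positive D p q(1)] line_uniformisers_subset p q(1) by blast
qed

lemma adjoin_line_bij:
  "bij_betw (\<lambda>D. extension_class K (adjoin_line K v e D)) (ramified_lines K v e) (totally_ramified_classes K v e)"
  unfolding bij_betw_def
proof
  show "inj_on (\<lambda>D. extension_class K (adjoin_line K v e D)) (ramified_lines K v e)"
  proof (rule inj_onI)
    fix D D' assume D: "D \<in> ramified_lines K v e" "D' \<in> ramified_lines K v e"
      and eq: "extension_class K (adjoin_line K v e D) = extension_class K (adjoin_line K v e D')"
    obtain p where p: "p \<in> line_uniformisers K v e D" using line_uniformisers_nonempty[OF e_positive D(1)] by blast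
    obtain q where q: "q \<in> line_uniformisers K v e D'" using line_uniformisers_nonempty[OF e_positive D(2)] by blast
    have "pclass e p = pclass e q"
      using adjoin_line_class[OF D(1) p] adjoin_line_class[OF D(2) q] eq
        adjoin_root_class_eq_iff[of p q] line_uniformisers_subset p q by blast
    then show "D = D'" using ramified_line_eq_iff[OF e_positive D p q] by simp
  qed
  show "(\<lambda>D. extension_class K (adjoin_line K v e D)) ` ramified_lines K v e = totally_ramified_classes K v e"
    unfolding totally_ramified_classes_eq
  proof (intro equalityI subsetI)
    fix C assume "C \<in> (\<lambda>D. extension_class K (adjoin_line K v e D)) ` ramified_lines K v e"
    then obtain D where D: "D \<in> ramified_lines K v e" "C = extension_class K (adjoin_line K v e D)" by blast
    obtain p where p: "p \<in> line_uniformisers K v e D" "adjoin_line K v e D = adjoin_root e p"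
      using adjoin_line_uniformiser[OF D(1)] by blast
    then show "C \<in> (\<lambda>p. extension_class K (adjoin_root e p)) ` uniformisers"
      using line_uniformisers_subset unfolding D(2) p(2) by blast
  next
    fix C assume "C \<in> (\<lambda>p. extension_class K (adjoin_root e p)) ` uniformisers"
    then obtain p where p: "p \<in> uniformisers" "C = extension_class K (adjoin_root e p)" by blast
    have "line e p \<in> ramified_lines K v e" "p \<in> line_uniformisers K v e (line e p)"
      using line_is_ramified[OF e_positive] uniformisersD[OF p(1)] by auto
    then show "C \<in> (\<lambda>D. extension_class K (adjoin_line K v e D)) ` ramified_lines K v e"
      using adjoin_line_class p(2) by blast
  qed
qed

end

theorem proposition5p1p1:
  fixes K :: "('a, 'm) ring_scheme" and v :: "'a \<Rightarrow> int" and p q e :: nat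
  assumes "local_field K v"
    and "p = ring_characteristic (residue_field K v)"
    and "q = order (residue_field K v)"
    and "e > 0"
    and "e mod p \<noteq> 0"
  shows "bij_betw (\<lambda>D. extension_class K (adjoin_line K v e D))
           (ramified_lines K v e) (totally_ramified_classes K v e)
       \<and> (\<forall>D \<in> ramified_lines K v e. \<forall>\<pi> \<in> line_uniformisers K v e D.
            extension_class K (ring.adjoin_root K e \<pi>) = extension_class K (adjoin_line K v e D))
       \<and> (\<forall>E :: ('a, 'b) extension. totally_ramified K v e E \<longrightarrow>
            separable_extension K E \<and> extension_class K E \<in> totally_ramified_classes K v e)
       \<and> card (totally_ramified_classes K v e) = gcd (q - 1) e"
proof -
  interpret local_field K v by fact
  interpret tame_local_field K v e
    by unfold_locales (use degree_unit assms in auto)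
  have "card (totally_ramified_classes K v e) = gcd (q - 1) e"
    using bij_betw_same_card[OF adjoin_line_bij] card_ramified_lines[OF complete e_unit finite_residue_field] assms(3)
    by simp
  moreover have "extension_class K E \<in> totally_ramified_classes K v e"
    if "totally_ramified K v e E" for E :: "('a, 'b) extension"
    using totally_ramified_class[OF that] by (auto simp: totally_ramified_classes_eq)
  ultimately show ?thesis
    using adjoin_line_bij adjoin_line_class totally_ramified_separable by blast
qed

end
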